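(* Let $I\in J(\mathcal{P})_\lambda$ with $\max I=\{(s_i,\lambda_i)\mid i\in S\}$, $S=\{i_1<\dots<i_t\}$, $t\ge1$. Let $\mathcal{O}_{m',J,K}\subset R_\lambda^{I^*}$ be a $G_\lambda^I$-orbit, let $r_i$ and $x$ be the associated exponents and characteristic element, and let $y_{i_1},\dots,y_{i_t}\in R^*$ be such that $f=((\pi^{s_{i_1}}y_{i_1},\dots,\pi^{s_{i_t}}y_{i_t}),x)\in\mathcal{O}_{m',J,K}$. Let $\mathcal{O}=\{(g\,e(I),gf)\mid g\in G_\lambda\}\subset R_\lambda^{I^*}\times R_\lambda^{I^*}$. Let $i\in\{1,\dots,k\}\setminus S$, and let $i_l\in S$ be such that $\partial_{\lambda_i}I=s_{i_l}$ with $i_l<i$, or $\partial_{\lambda_i}I=\lambda_i-\lambda_{i_l}+s_{i_l}$ with $i_l>i$ (such an $i_l$ exists). Let $$\begin{aligned}m_i=\min\Big(&\min_{j<i,\,j\in S}(s_j+val(y_j-y_{i_l})),\ \min_{j>i,\,j\in S}(\lambda_i-\lambda_j+s_j+val(y_j-y_{i_l})),\\&\min_{j<i,\,j\in S,\,\rho_j>1}r_j,\ \min_{j<i,\,j\notin S}r_j,\\&\min_{j>i,\,j\in S,\,\rho_j>1}(\lambda_i-\lambda_j+r_j),\ \min_{j>i,\,j\notin S}(\lambda_i-\lambda_j+r_j)\Big).\end{aligned}$$ Then $m_i\ge\partial_{\lambda_i}I$, and exactly one of the following holds for the $i$-th block components $(a_i,b_i)$ of the elements $(\underline a,\underline b)\in\mathcal{O}$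 (which always satisfy $a_i,b_i\in\pi^{\partial_{\lambda_i}I}R_{\lambda_i}^{\rho_i}$): (i) $r_i\ge m_i>\partial_{\lambda_i}I$, and $b_i-y_{i_l}a_i\in\pi^{m_i}R_{\lambda_i}^{\rho_i}$ for all $(\underline a,\underline b)\in\mathcal{O}$; (ii) $m_i>r_i\ge\partial_{\lambda_i}I$, and $b_i-y_{i_l}a_i\in\pi^{r_i}R_{\lambda_i}^{\rho_i*}$ for all $(\underline a,\underline b)\in\mathcal{O}$; (iii) neither of the numerical conditions in (i), (ii) holds, and $(a_i,b_i)$ can be any element of $\pi^{\partial_{\lambda_i}I}R_{\lambda_i}^{\rho_i}\oplus\pi^{\partial_{\lambda_i}I}R_{\lambda_i}^{\rho_i}$, i.e. every element of this set is the $i$-th component of some $(\underline a,\underline b)\in\mathcal{O}$.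
   Context: Let $R$ be a discrete valuation ring with uniformizer $\pi$, finite residue field $\mathbb{F}_q$ and unit group $R^*$; $val$ is the valuation on $R$, $val(0)=\infty$, $\pi^\infty:=0$, and a minimum over an empty set is $\infty$. Write $R_n=R/\pi^nR$, $R_n^{\rho*}=R_n^\rho\setminus\pi R_n^\rho$ and $\pi^jR_n^{\rho*}=\pi^jR_n^\rho\setminus\pi^{j+1}R_n^\rho$. For $\lambda=(\lambda_1^{\rho_1}>\dots>\lambda_k^{\rho_k})$ (positive integers $\lambda_1>\dots>\lambda_k$, multiplicities $\rho_i\ge1$) put $R_\lambda=\bigoplus_{i=1}^kR_{\lambda_i}^{\rho_i}$ and $G_\lambda=\mathrm{Aut}_R(R_\lambda)$. An element $\underline a\in R_\lambda$ has block components $a_i\in R_{\lambda_i}^{\rho_i}$. The fundamental poset is $\mathcal{P}=\{(v,l)\mid l\in\mathbb{N},\,0\le v<l\}$ with $(v,l)\le(v',l')$ iff $v\ge v'$ and $l-v\le l'-v'$. Order ideals are down-closed subsets; $\max(I)$ is the set of maximal elements of $I$. For an element $e$ of a finite $R$-module $M$, fix an isomorphism $M\cong\bigoplus_i(R/\pi^{\mu_i}R)^{\sigma_i}$ ($\mu_i$ distinct); $I(e)$ is the order ideal generated by the pairs $(v_i,\mu_i)$, where $v_i$ is the minimum of the valuations of the coordinates of $e$ in the $i$-th block, over the blocks where $e$ is non-zero ($I(e)$ does not depend on the isomorphism; $I(0)=\emptyset$). For an order ideal $I$ put $M^I=\{e\in M\mid I(e)\subset I\}$ and $M^{I^*}=\{e\in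 M\mid I(e)=I\}$. $J(\mathcal{P})_\lambda$ is the set of order ideals $I$ all of whose maximal elements are of the form $(v,\lambda_i)$; the sets $R_\lambda^{I^*}$, $I\in J(\mathcal{P})_\lambda$, are exactly the $G_\lambda$-orbits of $R_\lambda$. Given $I$ with $\max I=\{(s_i,\lambda_i)\mid i\in S\}$: for $i\notin S$ the boundary valuation is $\partial_{\lambda_i}I=\min\big(\min_{j\in S,\,j<i}s_j,\ \min_{j\in S,\,j>i}(\lambda_i-\lambda_j+s_j)\big)$, which equals $\min\{v\mid(v,\lambda_i)\in I\}$ whenever the latter set is nonempty (otherwise it is $\ge\lambda_i$). The canonical form $e(I)\in R_\lambda^{I^*}$ has first coordinate $\pi^{s_i}$ in the block $R_{\lambda_i}^{\rho_i}$ for each $i\in S$, and all other coordinates $0$; $G_\lambda^I$ is its stabilizer in $G_\lambda$. $R_{\lambda'}\cong\bigoplus_{i\in S}R_{\lambda_i}$ is the direct sum of the first cyclic summands of the blocks $i\in S$, $R_{\lambda''}$ is the direct sum of all remaining cyclic summands; elements of $R_\lambda=R_{\lambda'}\oplus R_{\lambda''}$ are written $m=(m',m'')$ (up to permuting coordinates), and $e(I)'$ is the projection of $e(I)$ to $R_{\lambda'}$. For $m=(m',m'')\in R_\lambda^{I^*}$ let $\bar m'$ be the image of $m'$ in $R_{\lambda'}/R\,e(I)'$, $J=I(\bar m')$, $K=I(m'')$; then $$\mathcal{O}_{m',J,K}=\{(l',l'')\mid l'\in m'+R_{\lambda'}^{J\cup K},\ l''\in R_{\lambda''}^{K^*}+R_{\lambda''}^{J}\}$$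 is the $G_\lambda^I$-orbit of $m$ (known), and every $G_\lambda^I$-orbit in $R_\lambda^{I^*}$ is of this form. Put $r_i=\min\{v\mid(v,\lambda_i)\in J\cup K\}$ ($\infty$ if there is no such $v$). The characteristic element $x\in R_{\lambda''}$ has block $\pi^{r_i}(1,0,\dots,0)\in R_{\lambda_i}^{\rho_i}$ for $i\notin S$ and block $\pi^{r_i}(1,0,\dots,0)\in R_{\lambda_i}^{\rho_i-1}$ for $i\in S$, $\rho_i>1$ (there is no block in $R_{\lambda''}$ for $i\in S$, $\rho_i=1$). Thus the blocks of $f$ are $f_i=(\pi^{s_i}y_i,\pi^{r_i},0,\dots,0)$ for $i\in S$, $\rho_i>1$; $f_i=\pi^{s_i}y_i$ for $i\in S$, $\rho_i=1$; $f_i=(\pi^{r_i},0,\dots,0)$ for $i\notin S$. *)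

theory Defs
  imports "HOL-Algebra.Algebra" "HOL-Library.Extended_Nat"
begin

section \<open>Discrete valuation rings\<close>

text \<open>A discrete valuation ring is a local principal ideal domain that is not a field; the
  uniformizer is a generator of its maximal ideal.\<close>

locale discrete_valuation_ring = principal_domain R for R (structure) +
  fixes \<pi> :: 'a
  assumes uniformizer_closed: "\<pi> \<in> carrier R"
    and uniformizer_nonzero: "\<pi> \<noteq> \<zero>"
    and uniformizer_maximal: "maximalideal (PIdl \<pi>) R"
    and local_ring: "maximalideal M R \<Longrightarrow> M = PIdl \<pi>"

text \<open>Suprema in \<open>enat\<close> are total, so the zero element, which is divisible by all powers of the
  uniformizer, gets the value \<open>\<infinity>\<close>. The definition is used both for \<open>R\<close> and for the quotients
  \<open>R/\<pi>\<^sup>nR\<close> with the class of the uniformizer.\<close>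

definition val :: "('a, 'b) ring_scheme \<Rightarrow> 'a \<Rightarrow> 'a \<Rightarrow> enat" where
  "val R \<pi> a = (SUP n\<in>{n::nat. a \<in> PIdl\<^bsub>R\<^esub> (\<pi> [^]\<^bsub>R\<^esub> n)}. enat n)"

fun epow :: "('a, 'b) ring_scheme \<Rightarrow> 'a \<Rightarrow> enat \<Rightarrow> 'a" where
  "epow R \<pi> (enat n) = \<pi> [^]\<^bsub>R\<^esub> n"
| "epow R \<pi> \<infinity> = \<zero>\<^bsub>R\<^esub>"

definition quot_pow :: "('a, 'b) ring_scheme \<Rightarrow> 'a \<Rightarrow> nat \<Rightarrow> 'a set ring" where
  "quot_pow R \<pi> n = R Quot (PIdl\<^bsub>R\<^esub> (\<pi> [^]\<^bsub>R\<^esub> n))"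

definition quot_proj :: "('a, 'b) ring_scheme \<Rightarrow> 'a \<Rightarrow> nat \<Rightarrow> 'a \<Rightarrow> 'a set" where
  "quot_proj R \<pi> n a = PIdl\<^bsub>R\<^esub> (\<pi> [^]\<^bsub>R\<^esub> n) +>\<^bsub>R\<^esub> a"


section \<open>Modules\<close>

definition module_iso ::
  "('a, 'b) ring_scheme \<Rightarrow> ('a, 'm, 'c) module_scheme \<Rightarrow> ('a, 'n, 'd) module_scheme \<Rightarrow> ('m \<Rightarrow> 'n) set"
  where
  "module_iso R M N =
     {h \<in> iso (add_monoid M) (add_monoid N).
        \<forall>r\<in>carrier R. \<forall>x\<in>carrier M. h (r \<odot>\<^bsub>M\<^esub> x) = r \<odot>\<^bsub>N\<^esub> h x}"

definition module_aut :: "('a, 'b) ring_scheme \<Rightarrow> ('a, 'm, 'c) module_scheme \<Rightarrow> ('m \<Rightarrow> 'm) set" where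
  "module_aut R M = module_iso R M M"

text \<open>The multiplicative fields of the record play no role for modules.\<close>

definition quot_module :: "('a, 'm, 'c) module_scheme \<Rightarrow> 'm set \<Rightarrow> ('a, 'm set) module" where
  "quot_module M N =
     \<lparr>carrier = a_rcosets\<^bsub>M\<^esub> N, monoid.mult = (\<lambda>_ _. undefined), monoid.one = undefined,
      ring.zero = N, ring.add = set_add M,
      smult = (\<lambda>r C. \<Union>x\<in>C. N +>\<^bsub>M\<^esub> (r \<odot>\<^bsub>M\<^esub> x))\<rparr>"

definition cyclic_submodule :: "('a, 'b) ring_scheme \<Rightarrow> ('a, 'm, 'c) module_scheme \<Rightarrow> 'm \<Rightarrow> 'm set" where
  "cyclic_submodule R M x = {r \<odot>\<^bsub>M\<^esub> x |r. r \<in> carrier R}"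

definition smult_image :: "('a, 'm, 'c) module_scheme \<Rightarrow> 'a \<Rightarrow> 'm set" where
  "smult_image M r = {r \<odot>\<^bsub>M\<^esub> x |x. x \<in> carrier M}"

text \<open>The direct sum of the modules \<open>R/\<pi>\<^bsup>\<mu> t\<^esup>R\<close> over \<open>t \<in> T\<close>. A coordinate is indexed by a pair,
  the number of its block and its (1-based) position within the block.\<close>

definition cyclic_sum ::
  "('a, 'b) ring_scheme \<Rightarrow> 'a \<Rightarrow> (nat \<times> nat) set \<Rightarrow> (nat \<times> nat \<Rightarrow> nat) \<Rightarrow> ('a, nat \<times> nat \<Rightarrow> 'a set) module"
  where
  "cyclic_sum R \<pi> T \<mu> =
     \<lparr>carrier = (\<Pi>\<^sub>E t\<in>T. carrier (quot_pow R \<pi> (\<mu> t))),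
      monoid.mult = (\<lambda>_ _. undefined), monoid.one = undefined,
      ring.zero = (\<lambda>t\<in>T. \<zero>\<^bsub>quot_pow R \<pi> (\<mu> t)\<^esub>),
      ring.add = (\<lambda>x y. \<lambda>t\<in>T. x t \<oplus>\<^bsub>quot_pow R \<pi> (\<mu> t)\<^esub> y t),
      smult = (\<lambda>r x. \<lambda>t\<in>T. quot_proj R \<pi> (\<mu> t) r \<otimes>\<^bsub>quot_pow R \<pi> (\<mu> t)\<^esub> x t)\<rparr>"


section \<open>The fundamental poset and order ideals\<close>

definition poset_P :: "(nat \<times> nat) set" where
  "poset_P = {(v, l). v < l}"

definition poset_le :: "nat \<times> nat \<Rightarrow> nat \<times> nat \<Rightarrow> bool" where
  "poset_le p q \<longleftrightarrow> fst p \<ge> fst q \<and> snd p - fst p \<le> snd q - fst q"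

definition order_ideal :: "(nat \<times> nat) set \<Rightarrow> bool" where
  "order_ideal I \<longleftrightarrow> I \<subseteq> poset_P \<and> (\<forall>q\<in>I. \<forall>p\<in>poset_P. poset_le p q \<longrightarrow> p \<in> I)"

definition gen_ideal :: "(nat \<times> nat) set \<Rightarrow> (nat \<times> nat) set" where
  "gen_ideal A = {p \<in> poset_P. \<exists>q\<in>A. poset_le p q}"

definition max_elems :: "(nat \<times> nat) set \<Rightarrow> (nat \<times> nat) set" where
  "max_elems I = {p \<in> I. \<forall>q\<in>I. poset_le p q \<longrightarrow> q = p}"

definition ideals_of_type :: "nat \<Rightarrow> (nat \<Rightarrow> nat) \<Rightarrow> (nat \<times> nat) set set" where
  "ideals_of_type k lam =
     {I. order_ideal I \<and> max_elems I \<subseteq> {(v, lam i) |v i. i \<in> {1..k}}}"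

text \<open>The pairs \<open>(v, l)\<close> where \<open>v\<close> is the least valuation of a coordinate in the block of all
  coordinates with exponent \<open>l\<close>. That infimum is \<open>\<infinity>\<close>, hence not of the form \<open>enat v\<close>, precisely
  if the block is empty or the element vanishes on it.\<close>

definition block_vals ::
  "('a, 'b) ring_scheme \<Rightarrow> 'a \<Rightarrow> (nat \<times> nat) set \<Rightarrow> (nat \<times> nat \<Rightarrow> nat) \<Rightarrow> (nat \<times> nat \<Rightarrow> 'a set) \<Rightarrow> (nat \<times> nat) set"
  where
  "block_vals R \<pi> T \<mu> x =
     {(v, l). enat v = (INF t\<in>{t\<in>T. \<mu> t = l}. val (quot_pow R \<pi> l) (quot_proj R \<pi> l \<pi>) (x t))}"

definition is_decomposition ::
  "('a, 'b) ring_scheme \<Rightarrow> 'a \<Rightarrow> ('a, 'm, 'c) module_scheme \<Rightarrow>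
   (nat \<times> nat) set \<Rightarrow> (nat \<times> nat \<Rightarrow> nat) \<Rightarrow> ('m \<Rightarrow> nat \<times> nat \<Rightarrow> 'a set) \<Rightarrow> bool"
  where
  "is_decomposition R \<pi> M T \<mu> \<phi> \<longleftrightarrow>
     finite T \<and> (\<forall>t\<in>T. 0 < \<mu> t) \<and> \<phi> \<in> module_iso R M (cyclic_sum R \<pi> T \<mu>)"

definition elem_ideal ::
  "('a, 'b) ring_scheme \<Rightarrow> 'a \<Rightarrow> ('a, 'm, 'c) module_scheme \<Rightarrow> 'm \<Rightarrow> (nat \<times> nat) set" where
  "elem_ideal R \<pi> M e =
     (let (T, \<mu>, \<phi>) = (SOME (T, \<mu>, \<phi>). is_decomposition R \<pi> M T \<mu> \<phi>)
      in gen_ideal (block_vals R \<pi> T \<mu> (\<phi> e)))"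

definition ideal_part ::
  "('a, 'b) ring_scheme \<Rightarrow> 'a \<Rightarrow> ('a, 'm, 'c) module_scheme \<Rightarrow> (nat \<times> nat) set \<Rightarrow> 'm set" where
  "ideal_part R \<pi> M I = {e \<in> carrier M. elem_ideal R \<pi> M e \<subseteq> I}"

definition ideal_part_exact ::
  "('a, 'b) ring_scheme \<Rightarrow> 'a \<Rightarrow> ('a, 'm, 'c) module_scheme \<Rightarrow> (nat \<times> nat) set \<Rightarrow> 'm set" where
  "ideal_part_exact R \<pi> M I = {e \<in> carrier M. elem_ideal R \<pi> M e = I}"


section \<open>The module of a given type and its parts\<close>

definition is_type :: "nat \<Rightarrow> (nat \<Rightarrow> nat) \<Rightarrow> (nat \<Rightarrow> nat) \<Rightarrow> bool" where
  "is_type k lam \<rho> \<longleftrightarrow> strict_antimono_on {1..k} lam \<and> (\<forall>i\<in>{1..k}. 1 \<le> lam i \<and> 1 \<le> \<rho> i)"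

definition idx :: "nat \<Rightarrow> (nat \<Rightarrow> nat) \<Rightarrow> (nat \<times> nat) set" where
  "idx k \<rho> = (SIGMA i:{1..k}. {1..\<rho> i})"

definition idx_first :: "nat set \<Rightarrow> (nat \<times> nat) set" where
  "idx_first S = S \<times> {1}"

definition idx_rest :: "nat \<Rightarrow> (nat \<Rightarrow> nat) \<Rightarrow> nat set \<Rightarrow> (nat \<times> nat) set" where
  "idx_rest k \<rho> S = idx k \<rho> - idx_first S"

definition idx_block :: "(nat \<Rightarrow> nat) \<Rightarrow> nat \<Rightarrow> (nat \<times> nat) set" where
  "idx_block \<rho> i = {i} \<times> {1..\<rho> i}"

definition mod_full ::
  "('a, 'b) ring_scheme \<Rightarrow> 'a \<Rightarrow> nat \<Rightarrow> (nat \<Rightarrow> nat) \<Rightarrow> (nat \<Rightarrow> nat) \<Rightarrow> ('a, nat \<times> nat \<Rightarrow> 'a set) module" where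
  "mod_full R \<pi> k lam \<rho> = cyclic_sum R \<pi> (idx k \<rho>) (\<lambda>(i, c). lam i)"

definition mod_first ::
  "('a, 'b) ring_scheme \<Rightarrow> 'a \<Rightarrow> (nat \<Rightarrow> nat) \<Rightarrow> nat set \<Rightarrow> ('a, nat \<times> nat \<Rightarrow> 'a set) module" where
  "mod_first R \<pi> lam S = cyclic_sum R \<pi> (idx_first S) (\<lambda>(i, c). lam i)"

definition mod_rest ::
  "('a, 'b) ring_scheme \<Rightarrow> 'a \<Rightarrow> nat \<Rightarrow> (nat \<Rightarrow> nat) \<Rightarrow> (nat \<Rightarrow> nat) \<Rightarrow> nat set \<Rightarrow>
   ('a, nat \<times> nat \<Rightarrow> 'a set) module" where
  "mod_rest R \<pi> k lam \<rho> S = cyclic_sum R \<pi> (idx_rest k \<rho> S) (\<lambda>(i, c). lam i)"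

definition mod_block ::
  "('a, 'b) ring_scheme \<Rightarrow> 'a \<Rightarrow> (nat \<Rightarrow> nat) \<Rightarrow> (nat \<Rightarrow> nat) \<Rightarrow> nat \<Rightarrow> ('a, nat \<times> nat \<Rightarrow> 'a set) module" where
  "mod_block R \<pi> lam \<rho> i = cyclic_sum R \<pi> (idx_block \<rho> i) (\<lambda>(i, c). lam i)"

text \<open>\<open>\<pi>\<^sup>vM\<close> and \<open>\<pi>\<^sup>vM\<^sup>* = \<pi>\<^sup>vM - \<pi>\<^bsup>v+1\<^esup>M\<close>.\<close>

definition pi_multiples :: "('a, 'b) ring_scheme \<Rightarrow> 'a \<Rightarrow> ('a, 'm, 'c) module_scheme \<Rightarrow> enat \<Rightarrow> 'm set" where
  "pi_multiples R \<pi> M v = smult_image M (epow R \<pi> v)"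

definition pi_multiples_exact :: "('a, 'b) ring_scheme \<Rightarrow> 'a \<Rightarrow> ('a, 'm, 'c) module_scheme \<Rightarrow> enat \<Rightarrow> 'm set" where
  "pi_multiples_exact R \<pi> M v = pi_multiples R \<pi> M v - pi_multiples R \<pi> M (v + 1)"


section \<open>Canonical forms, characteristic elements and orbits\<close>

text \<open>Infima over empty sets are \<open>\<infinity>\<close>. The natural subtractions are only used for
  \<open>lam j < lam i\<close>.\<close>

definition boundary_val :: "(nat \<Rightarrow> nat) \<Rightarrow> nat set \<Rightarrow> (nat \<Rightarrow> nat) \<Rightarrow> nat \<Rightarrow> enat" where
  "boundary_val lam S s i =
     min (INF j\<in>{j\<in>S. j < i}. enat (s j))
         (INF j\<in>{j\<in>S. i < j}. enat (lam i - lam j + s j))"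

definition canonical_form ::
  "('a, 'b) ring_scheme \<Rightarrow> 'a \<Rightarrow> nat \<Rightarrow> (nat \<Rightarrow> nat) \<Rightarrow> (nat \<Rightarrow> nat) \<Rightarrow> nat set \<Rightarrow> (nat \<Rightarrow> nat) \<Rightarrow>
   nat \<times> nat \<Rightarrow> 'a set" where
  "canonical_form R \<pi> k lam \<rho> S s =
     (\<lambda>(i, c)\<in>idx k \<rho>. quot_proj R \<pi> (lam i)
        (if i \<in> S \<and> c = 1 then \<pi> [^]\<^bsub>R\<^esub> s i else \<zero>\<^bsub>R\<^esub>))"

text \<open>The ideal of the image of \<open>m'\<close> in the quotient of \<open>R\<^sub>\<lambda>\<^sub>'\<close> by the cyclic submodule generated by
  the projection of the canonical form.\<close>

definition ideal_J ::
  "('a, 'b) ring_scheme \<Rightarrow> 'a \<Rightarrow> nat \<Rightarrow> (nat \<Rightarrow> nat) \<Rightarrow> (nat \<Rightarrow> nat) \<Rightarrow> nat set \<Rightarrow> (nat \<Rightarrow> nat) \<Rightarrow>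
   (nat \<times> nat \<Rightarrow> 'a set) \<Rightarrow> (nat \<times> nat) set" where
  "ideal_J R \<pi> k lam \<rho> S s m =
     (let M = mod_first R \<pi> lam S;
          N = cyclic_submodule R M (restrict (canonical_form R \<pi> k lam \<rho> S s) (idx_first S))
      in elem_ideal R \<pi> (quot_module M N) (N +>\<^bsub>M\<^esub> restrict m (idx_first S)))"

definition ideal_K ::
  "('a, 'b) ring_scheme \<Rightarrow> 'a \<Rightarrow> nat \<Rightarrow> (nat \<Rightarrow> nat) \<Rightarrow> (nat \<Rightarrow> nat) \<Rightarrow> nat set \<Rightarrow>
   (nat \<times> nat \<Rightarrow> 'a set) \<Rightarrow> (nat \<times> nat) set" where
  "ideal_K R \<pi> k lam \<rho> S m =
     elem_ideal R \<pi> (mod_rest R \<pi> k lam \<rho> S) (restrict m (idx_rest k \<rho> S))"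

text \<open>\<open>\<O>\<^bsub>m',J,K\<^esub>\<close>, where the first-coordinates part \<open>m'\<close> is an element of \<open>mod_first R \<pi> lam S\<close>. An element
  \<open>l\<close> of \<open>R\<^sub>\<lambda>\<close> is split into its two parts by restriction of the index set.\<close>

definition orbit_set ::
  "('a, 'b) ring_scheme \<Rightarrow> 'a \<Rightarrow> nat \<Rightarrow> (nat \<Rightarrow> nat) \<Rightarrow> (nat \<Rightarrow> nat) \<Rightarrow> nat set \<Rightarrow>
   (nat \<times> nat \<Rightarrow> 'a set) \<Rightarrow> (nat \<times> nat) set \<Rightarrow> (nat \<times> nat) set \<Rightarrow> (nat \<times> nat \<Rightarrow> 'a set) set" where
  "orbit_set R \<pi> k lam \<rho> S m' J K =
     (let M' = mod_first R \<pi> lam S; M'' = mod_rest R \<pi> k lam \<rho> S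
      in {l \<in> carrier (mod_full R \<pi> k lam \<rho>).
            restrict l (idx_first S) \<in> m' <+\<^bsub>M'\<^esub> ideal_part R \<pi> M' (J \<union> K) \<and>
            restrict l (idx_rest k \<rho> S)
              \<in> ideal_part_exact R \<pi> M'' K <+>\<^bsub>M''\<^esub> ideal_part R \<pi> M'' J})"

definition char_exp :: "(nat \<Rightarrow> nat) \<Rightarrow> (nat \<times> nat) set \<Rightarrow> (nat \<times> nat) set \<Rightarrow> nat \<Rightarrow> enat" where
  "char_exp lam J K i = (INF v\<in>{v. (v, lam i) \<in> J \<union> K}. enat v)"

text \<open>For \<open>i \<in> S\<close>, the first coordinate of block \<open>i\<close> of \<open>R\<^sub>\<lambda>\<^sub>'\<^sub>'\<close> is the second coordinate of block \<open>i\<close>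
  of \<open>R\<^sub>\<lambda>\<close>.\<close>

definition char_elem ::
  "('a, 'b) ring_scheme \<Rightarrow> 'a \<Rightarrow> nat \<Rightarrow> (nat \<Rightarrow> nat) \<Rightarrow> (nat \<Rightarrow> nat) \<Rightarrow> nat set \<Rightarrow> (nat \<Rightarrow> enat) \<Rightarrow>
   nat \<times> nat \<Rightarrow> 'a set" where
  "char_elem R \<pi> k lam \<rho> S r =
     (\<lambda>(i, c)\<in>idx_rest k \<rho> S. quot_proj R \<pi> (lam i)
        (if c = (if i \<in> S then 2 else 1) then epow R \<pi> (r i) else \<zero>\<^bsub>R\<^esub>))"

definition pair_elem ::
  "('a, 'b) ring_scheme \<Rightarrow> 'a \<Rightarrow> nat \<Rightarrow> (nat \<Rightarrow> nat) \<Rightarrow> (nat \<Rightarrow> nat) \<Rightarrow> nat set \<Rightarrow> (nat \<Rightarrow> nat) \<Rightarrow>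
   (nat \<Rightarrow> 'a) \<Rightarrow> (nat \<times> nat \<Rightarrow> 'a set) \<Rightarrow> nat \<times> nat \<Rightarrow> 'a set" where
  "pair_elem R \<pi> k lam \<rho> S s y x =
     (\<lambda>(i, c)\<in>idx k \<rho>.
        if (i, c) \<in> idx_first S then quot_proj R \<pi> (lam i) (\<pi> [^]\<^bsub>R\<^esub> s i \<otimes>\<^bsub>R\<^esub> y i) else x (i, c))"

definition m_val ::
  "('a, 'b) ring_scheme \<Rightarrow> 'a \<Rightarrow> (nat \<Rightarrow> nat) \<Rightarrow> (nat \<Rightarrow> nat) \<Rightarrow> nat \<Rightarrow> nat set \<Rightarrow> (nat \<Rightarrow> nat) \<Rightarrow>
   (nat \<Rightarrow> enat) \<Rightarrow> (nat \<Rightarrow> 'a) \<Rightarrow> nat \<Rightarrow> nat \<Rightarrow> enat" where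
  "m_val R \<pi> lam \<rho> k S s r y l i = Min
     {INF j\<in>{j\<in>S. j < i}. enat (s j) + val R \<pi> (y j \<ominus>\<^bsub>R\<^esub> y l),
      INF j\<in>{j\<in>S. i < j}. enat (lam i - lam j + s j) + val R \<pi> (y j \<ominus>\<^bsub>R\<^esub> y l),
      INF j\<in>{j\<in>S. j < i \<and> \<rho> j > 1}. r j,
      INF j\<in>{j\<in>{1..k} - S. j < i}. r j,
      INF j\<in>{j\<in>S. i < j \<and> \<rho> j > 1}. enat (lam i - lam j) + r j,
      INF j\<in>{j\<in>{1..k} - S. i < j}. enat (lam i - lam j) + r j}"

end

theory Submission
  imports Defs
begin

text \<open>Write \<open>h = f - y\<^sub>l e\<close>, so that \<open>b\<^sub>i - y\<^sub>l a\<^sub>i\<close> is the \<open>i\<close>-th component of \<open>g h\<close>. A homomorphism can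
  raise but not lower the valuation of block \<open>j\<close> when mapping it to block \<open>i\<close>, and raises it by at
  least \<open>\<lambda>\<^sub>i - \<lambda>\<^sub>j\<close> if \<open>j > i\<close>; hence the contribution of the blocks \<open>j \<noteq> i\<close> of \<open>h\<close> is divisible by
  \<open>\<pi>\<close> to the power \<open>m\<^sub>i\<close>, while block \<open>i\<close> contributes \<open>\<pi>\<close> to the power \<open>r\<^sub>i\<close> times a column of the \<open>i\<close>-th
  diagonal block of \<open>g\<close>, which is nonzero modulo \<open>\<pi>\<close> because \<open>g\<close> is invertible. This gives (i) and
  (ii). If \<open>m\<^sub>i\<close> is the boundary valuation, then it is attained by the coordinate \<open>\<pi>\<close> to the power
  \<open>s\<^sub>l\<close> of \<open>e\<close>, at which \<open>h\<close> vanishes, and by some coordinate of \<open>h\<close>; a shear adding multiples of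
  these two coordinates to block \<open>i\<close> produces every pair \<open>(a\<^sub>i, b\<^sub>i)\<close>.

  About \<open>J\<close> and \<open>K\<close> only \<open>J \<union> K \<subseteq> I\<close> is needed. It holds because homomorphisms shrink the ideals of
  elements, once the quotient of \<open>R\<^sub>\<lambda>\<^sub>'\<close> by \<open>R e(I)'\<close> is known to be a direct sum of cyclic modules.\<close>

section \<open>Divisibility by powers of the uniformizer\<close>

text \<open>\<open>elem_ideal\<close> picks an unspecified decomposition, so the ideal of an element
  is known only through that choice. Comparing the chosen decompositions of two modules along a
  homomorphism gives an inclusion without a proof that the choice does not matter; the price is that
  each module involved must be shown to have some decomposition, which takes work only for the
  quotient that defines J. The inclusion of J and K in I is used in one form: if r_j is finite, then
  (r_j, \<lambda>_j) lies below a maximal element (s_p, \<lambda>_p) of I. So neither r_i nor any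
  term of m_i that involves some r_j is smaller than the boundary valuation. Hence both numerical
  conditions fail exactly when m_i equals the boundary valuation. Elements are handled through
  families of representatives in R, so that statements about cosets and valuations become
  divisibility by powers of \<pi>, with exponents cut off at that of the modulus. Values that may be
  infinite enter through their finite lower bounds.\<close>

lemma enat_le_SUP_iff:
  fixes N :: "nat set"
  assumes "0 \<in> N" and down: "\<And>m n. m \<le> n \<Longrightarrow> n \<in> N \<Longrightarrow> m \<in> N"
  shows "enat n \<le> (SUP m\<in>N. enat m) \<longleftrightarrow> n \<in> N"
proof
  assume le: "enat n \<le> (SUP m\<in>N. enat m)"
  show "n \<in> N"
  proof (rule ccontr)
    assume n: "n \<notin> N"
    with \<open>0 \<in> N\<close> have "n > 0"
      by (cases n) auto
    have "m \<le> n - 1" if "m \<in> N" for m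
      using that n down[of n m] by fastforce
    then have "(SUP m\<in>N. enat m) \<le> enat (n - 1)"
      by (intro SUP_least) auto
    with le have "enat n \<le> enat (n - 1)"
      by (rule order_trans)
    with \<open>n > 0\<close> show False
      by simp
  qed
qed (auto intro: SUP_upper)

context discrete_valuation_ring
begin

declare uniformizer_closed [simp, intro]

lemma uniformizer_pow_closed [simp, intro]: "\<pi> [^] (n::nat) \<in> carrier R"
  by simp

lemma uniformizer_pow_nonzero [simp]: "\<pi> [^] (n::nat) \<noteq> \<zero>"
proof (induction n)
  case (Suc n)
  then show ?case
    using uniformizer_nonzero integral_iff[of "\<pi> [^] n" \<pi>] by simp
qed simp

lemma uniformizer_not_unit: "\<pi> \<notin> Units R"
proof
  assume u: "\<pi> \<in> Units R"
  interpret maximalideal "PIdl \<pi>" R by (rule uniformizer_maximal)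
  have "inv \<pi> \<otimes> \<pi> \<in> PIdl \<pi>"
    using u by (intro I_l_closed cgenideal_self) auto
  then have "\<one> \<in> PIdl \<pi>"
    using u by simp
  then show False
    using I_notcarr one_imp_carrier by auto
qed

lemma mem_cgenideal_iff: "b \<in> carrier R \<Longrightarrow> a \<in> carrier R \<Longrightarrow> b \<in> PIdl a \<longleftrightarrow> a divides b"
  by (auto simp: cgenideal_def factor_def m_comm)

lemma dvd_add:
  assumes "p \<in> carrier R" "a \<in> carrier R" "b \<in> carrier R" "p divides a" "p divides b"
  shows "p divides (a \<oplus> b)"
proof -
  obtain c d where "c \<in> carrier R" "a = p \<otimes> c" "d \<in> carrier R" "b = p \<otimes> d"
    using assms by (auto simp: factor_def)
  then show ?thesis
    using assms by (intro dividesI[of "c \<oplus> d"]) (auto simp: r_distr)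
qed

lemma dvd_diff:
  assumes "p \<in> carrier R" "a \<in> carrier R" "b \<in> carrier R" "p divides a" "p divides b"
  shows "p divides (a \<ominus> b)"
proof -
  obtain c d where "c \<in> carrier R" "a = p \<otimes> c" "d \<in> carrier R" "b = p \<otimes> d"
    using assms by (auto simp: factor_def)
  then show ?thesis
    using assms by (intro dividesI[of "c \<ominus> d"]) (auto simp: r_distr minus_eq r_minus)
qed

lemma dvd_zero [simp]: "p \<in> carrier R \<Longrightarrow> p divides \<zero>"
  by (rule dividesI[of \<zero>]) auto

lemma one_dvd [simp]: "a \<in> carrier R \<Longrightarrow> \<one> divides a"
  by (rule dividesI[of a]) auto

text \<open>A nonzero non-unit of a principal ideal domain has an irreducible divisor. This divisor
  generates a maximal ideal, which by locality is the one generated by \<pi>. Zero is excluded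
  because \<pi> divides it.\<close>

lemma unit_if_not_dvd:
  assumes "a \<in> carrier R" "\<not> \<pi> divides a"
  shows "a \<in> Units R"
proof (rule ccontr)
  assume a: "a \<notin> Units R"
  have "a \<in> carrier R - {\<zero>}"
    using assms dvd_zero by blast
  then obtain b where b: "b \<in> carrier R" "ring_irreducible b" "b divides a"
    by (rule exists_irreducible_divisor[OF _ a])
  have "PIdl b = PIdl \<pi>"
    by (rule local_ring[OF irreducible_imp_maximalideal[OF b(1,2)]])
  then have "\<pi> divides b"
    using b(1) cgenideal_self[of b] by (simp add: mem_cgenideal_iff)
  then have "\<pi> divides a"
    by (rule divides_trans[OF _ b(3) uniformizer_closed])
  with assms(2) show False ..
qed

lemma dvd_mult_left:
  "p \<in> carrier R \<Longrightarrow> a \<in> carrier R \<Longrightarrow> b \<in> carrier R \<Longrightarrow> p divides b \<Longrightarrow> p divides a \<otimes> b"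
  using divides_prod_r[of p b a] by (simp add: m_comm)

lemma pow_dvd_pow: "n \<le> m \<Longrightarrow> \<pi> [^] (n::nat) divides \<pi> [^] (m::nat)"
  by (metis dividesI le_add_diff_inverse nat_pow_mult uniformizer_closed uniformizer_pow_closed)

lemma pow_dvd_le:
  "n \<le> m \<Longrightarrow> a \<in> carrier R \<Longrightarrow> \<pi> [^] (m::nat) divides a \<Longrightarrow> \<pi> [^] (n::nat) divides a"
  by (rule divides_trans[OF pow_dvd_pow]) auto

text \<open>The slack in \<open>N \<le> n + m\<close> admits exponents formed with truncated
  subtraction; \<open>pow_dvd_cancel\<close> is arranged in the same way.\<close>

lemma pow_dvd_mult:
  assumes "a \<in> carrier R" "\<pi> [^] (m::nat) divides a" "N \<le> n + m"
  shows "\<pi> [^] (N::nat) divides \<pi> [^] (n::nat) \<otimes> a"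
proof -
  obtain c where "c \<in> carrier R" "a = \<pi> [^] m \<otimes> c"
    using assms by (auto simp: factor_def)
  then have "\<pi> [^] n \<otimes> a = \<pi> [^] (n + m) \<otimes> c"
    by (simp add: m_assoc nat_pow_mult[symmetric])
  then have "\<pi> [^] (n + m) divides \<pi> [^] n \<otimes> a"
    using \<open>c \<in> carrier R\<close> by auto
  then show ?thesis
    using assms pow_dvd_le by simp
qed

lemma pow_dvd_cancel:
  assumes "a \<in> carrier R" "\<pi> [^] (N::nat) divides \<pi> [^] (n::nat) \<otimes> a" "n + m \<le> N"
  shows "\<pi> [^] (m::nat) divides a"
proof -
  have "\<pi> [^] (n + m) divides \<pi> [^] n \<otimes> a"
    using assms pow_dvd_le[of "n + m" N] by simp
  then obtain c where c: "c \<in> carrier R" "\<pi> [^] n \<otimes> a = \<pi> [^] (n + m) \<otimes> c"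
    by (auto simp: factor_def)
  then have "\<pi> [^] n \<otimes> a = \<pi> [^] n \<otimes> (\<pi> [^] m \<otimes> c)"
    by (simp add: m_assoc[symmetric] nat_pow_mult)
  then have "a = \<pi> [^] m \<otimes> c"
    using m_lcancel[of "\<pi> [^] n"] assms(1) c by simp
  with c show ?thesis by auto
qed

lemma pow_dvd_unit_mult:
  assumes "u \<in> Units R" "\<pi> [^] (N::nat) divides \<pi> [^] (n::nat) \<otimes> u"
  shows "N \<le> n"
proof (rule ccontr)
  assume "\<not> N \<le> n"
  then have "\<pi> [^] (1::nat) divides u"
    using assms by (intro pow_dvd_cancel[of u N n 1]) auto
  then have "\<pi> divides u"
    by simp
  then show False
    using assms divides_unit uniformizer_not_unit by auto
qed

text \<open>The exponents of the powers of \<pi> that divide a form a down-closed set containing 0,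
  so a supremum of at least n, finite or not, forces n itself into the set.\<close>

lemma le_val_iff:
  assumes "a \<in> carrier R"
  shows "enat n \<le> val R \<pi> a \<longleftrightarrow> \<pi> [^] n divides a"
  unfolding val_def
  using assms enat_le_SUP_iff[of "{n. \<pi> [^] n divides a}" n] pow_dvd_le[of _ _ a]
  by (simp add: mem_cgenideal_iff)

section \<open>The quotients by powers of the uniformizer\<close>

lemma quot_proj_ring_hom: "ring_hom_cring R (quot_pow R \<pi> n) (quot_proj R \<pi> n)"
proof -
  interpret ideal "PIdl (\<pi> [^] n)" R by (simp add: cgenideal_ideal)
  show ?thesis
    using rcos_ring_hom_cring[OF is_cring] unfolding quot_pow_def quot_proj_def .
qed

lemma quot_cring: "cring (quot_pow R \<pi> n)"
  using quot_proj_ring_hom ring_hom_cring_def by blast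

lemma quot_proj_mem_ring_hom: "quot_proj R \<pi> n \<in> ring_hom R (quot_pow R \<pi> n)"
  using ring_hom_cring.homh[OF quot_proj_ring_hom] .

lemma quot_proj_closed [simp]: "a \<in> carrier R \<Longrightarrow> quot_proj R \<pi> n a \<in> carrier (quot_pow R \<pi> n)"
  by (rule ring_hom_closed[OF quot_proj_mem_ring_hom])

lemma quot_proj_add:
  "a \<in> carrier R \<Longrightarrow> b \<in> carrier R \<Longrightarrow>
     quot_proj R \<pi> n (a \<oplus> b) = quot_proj R \<pi> n a \<oplus>\<^bsub>quot_pow R \<pi> n\<^esub> quot_proj R \<pi> n b"
  by (rule ring_hom_add[OF quot_proj_mem_ring_hom])

lemma quot_proj_mult:
  "a \<in> carrier R \<Longrightarrow> b \<in> carrier R \<Longrightarrow>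
     quot_proj R \<pi> n (a \<otimes> b) = quot_proj R \<pi> n a \<otimes>\<^bsub>quot_pow R \<pi> n\<^esub> quot_proj R \<pi> n b"
  by (rule ring_hom_mult[OF quot_proj_mem_ring_hom])

lemma quot_proj_zero: "quot_proj R \<pi> n \<zero> = \<zero>\<^bsub>quot_pow R \<pi> n\<^esub>"
  by (rule ring_hom_cring.hom_zero[OF quot_proj_ring_hom])

lemma quot_proj_pow: "quot_proj R \<pi> n \<pi> [^]\<^bsub>quot_pow R \<pi> n\<^esub> (m::nat) = quot_proj R \<pi> n (\<pi> [^] m)"
proof -
  interpret h: ring_hom_cring R "quot_pow R \<pi> n" "quot_proj R \<pi> n"
    by (rule quot_proj_ring_hom)
  show ?thesis
    by (induction m) auto
qed

lemma quot_proj_surj: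
  assumes "q \<in> carrier (quot_pow R \<pi> n)"
  obtains a where "a \<in> carrier R" "q = quot_proj R \<pi> n a"
  using assms by (auto simp: quot_pow_def quot_proj_def FactRing_def A_RCOSETS_def')

lemma quot_proj_eq_iff:
  assumes "a \<in> carrier R" "b \<in> carrier R"
  shows "quot_proj R \<pi> n a = quot_proj R \<pi> n b \<longleftrightarrow> \<pi> [^] n divides (a \<ominus> b)"
  using quotient_eq_iff_same_a_r_cos[of "PIdl (\<pi> [^] n)" a b] assms
  by (simp add: cgenideal_ideal mem_cgenideal_iff quot_proj_def)

text \<open>In the quotient \<pi>^l is zero, so an exponent beyond l tests the same as l. With the
  \<open>min\<close> the equivalence covers the zero class too, whose value is infinite.\<close>

lemma le_val_quot_iff:
  assumes a: "a \<in> carrier R"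
  shows "enat m \<le> val (quot_pow R \<pi> l) (quot_proj R \<pi> l \<pi>) (quot_proj R \<pi> l a)
           \<longleftrightarrow> \<pi> [^] (min m l) divides a"
proof -
  let ?Q = "quot_pow R \<pi> l" and ?p = "quot_proj R \<pi> l"
  interpret Q: cring ?Q by (rule quot_cring)
  have mem: "?p a \<in> PIdl\<^bsub>?Q\<^esub> (?p \<pi> [^]\<^bsub>?Q\<^esub> m) \<longleftrightarrow> \<pi> [^] (min m l) divides a" for m
  proof
    assume "?p a \<in> PIdl\<^bsub>?Q\<^esub> (?p \<pi> [^]\<^bsub>?Q\<^esub> m)"
    then obtain q where "q \<in> carrier ?Q" "?p a = q \<otimes>\<^bsub>?Q\<^esub> ?p (\<pi> [^] m)"
      by (auto simp: cgenideal_def quot_proj_pow)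
    then obtain c where c: "c \<in> carrier R" "?p a = ?p (c \<otimes> \<pi> [^] m)"
      by (metis quot_proj_surj quot_proj_mult uniformizer_pow_closed)
    then have "\<pi> [^] l divides (a \<ominus> c \<otimes> \<pi> [^] m)"
      using a by (simp add: quot_proj_eq_iff)
    then have "\<pi> [^] (min m l) divides (a \<ominus> c \<otimes> \<pi> [^] m)"
      using a c by (intro pow_dvd_le[of "min m l" l]) auto
    moreover have "\<pi> [^] (min m l) divides c \<otimes> \<pi> [^] m"
      using c by (intro dvd_mult_left pow_dvd_pow) auto
    moreover have "a = (a \<ominus> c \<otimes> \<pi> [^] m) \<oplus> c \<otimes> \<pi> [^] m"
      using a c uniformizer_pow_closed[of m] by algebra
    ultimately show "\<pi> [^] (min m l) divides a"
      using a c dvd_add[of "\<pi> [^] (min m l)" "a \<ominus> c \<otimes> \<pi> [^] m" "c \<otimes> \<pi> [^] m"] by simp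
  next
    assume d: "\<pi> [^] (min m l) divides a"
    have "\<exists>c\<in>carrier R. ?p a = ?p (c \<otimes> \<pi> [^] m)"
    proof (cases "m \<le> l")
      case True
      with d obtain c where "c \<in> carrier R" "a = \<pi> [^] m \<otimes> c"
        by (auto simp: factor_def)
      then show ?thesis
        by (auto simp: m_comm)
    next
      case False
      with d have "\<pi> [^] l divides a"
        by simp
      then have "?p a = ?p (\<zero> \<otimes> \<pi> [^] m)"
        using a by (simp add: quot_proj_eq_iff minus_eq)
      then show ?thesis by blast
    qed
    then show "?p a \<in> PIdl\<^bsub>?Q\<^esub> (?p \<pi> [^]\<^bsub>?Q\<^esub> m)"
      by (auto simp: cgenideal_def quot_proj_pow quot_proj_mult)
  qed
  have "\<pi> [^] (min m l) divides a" if "m \<le> n" "\<pi> [^] (min n l) divides a" for m n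
    using that a by (intro pow_dvd_le[of "min m l" "min n l"]) auto
  then show ?thesis
    unfolding val_def mem using enat_le_SUP_iff[of "{m. \<pi> [^] (min m l) divides a}" m] a
    by simp
qed

end

section \<open>Direct sums of cyclic modules and their homomorphisms\<close>

text \<open>Bijectivity is separated from linearity because the restrictions to some coordinates and
  the projection to a quotient, through which J and K are compared with I, need not be
  injective.\<close>

definition lin_hom ::
  "('a, 'b) ring_scheme \<Rightarrow> ('a, 'm, 'c) module_scheme \<Rightarrow> ('a, 'n, 'd) module_scheme \<Rightarrow> ('m \<Rightarrow> 'n) set"
  where
  "lin_hom R M N =
     {h \<in> hom (add_monoid M) (add_monoid N).
        \<forall>r\<in>carrier R. \<forall>x\<in>carrier M. h (r \<odot>\<^bsub>M\<^esub> x) = r \<odot>\<^bsub>N\<^esub> h x}"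

lemma lin_homI:
  assumes "\<And>x. x \<in> carrier M \<Longrightarrow> h x \<in> carrier N"
    and "\<And>x y. x \<in> carrier M \<Longrightarrow> y \<in> carrier M \<Longrightarrow> h (x \<oplus>\<^bsub>M\<^esub> y) = h x \<oplus>\<^bsub>N\<^esub> h y"
    and "\<And>r x. r \<in> carrier R \<Longrightarrow> x \<in> carrier M \<Longrightarrow> h (r \<odot>\<^bsub>M\<^esub> x) = r \<odot>\<^bsub>N\<^esub> h x"
  shows "h \<in> lin_hom R M N"
  using assms by (auto simp: lin_hom_def intro!: homI)

lemma lin_hom_closed: "h \<in> lin_hom R M N \<Longrightarrow> x \<in> carrier M \<Longrightarrow> h x \<in> carrier N"
  by (auto simp: lin_hom_def hom_def)

lemma lin_hom_add:
  "h \<in> lin_hom R M N \<Longrightarrow> x \<in> carrier M \<Longrightarrow> y \<in> carrier M \<Longrightarrow> h (x \<oplus>\<^bsub>M\<^esub> y) = h x \<oplus>\<^bsub>N\<^esub> h y"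
  by (auto simp: lin_hom_def hom_def)

lemma lin_hom_smult:
  "h \<in> lin_hom R M N \<Longrightarrow> r \<in> carrier R \<Longrightarrow> x \<in> carrier M \<Longrightarrow> h (r \<odot>\<^bsub>M\<^esub> x) = r \<odot>\<^bsub>N\<^esub> h x"
  by (auto simp: lin_hom_def)

lemma lin_hom_comp:
  assumes g: "g \<in> lin_hom R M N" and h: "h \<in> lin_hom R N P"
  shows "(\<lambda>x. h (g x)) \<in> lin_hom R M P"
  by (rule lin_homI)
    (simp_all add: lin_hom_closed[OF g] lin_hom_closed[OF h] lin_hom_add[OF g] lin_hom_add[OF h]
      lin_hom_smult[OF g] lin_hom_smult[OF h])

lemma module_iso_iff: "h \<in> module_iso R M N \<longleftrightarrow> h \<in> lin_hom R M N \<and> bij_betw h (carrier M) (carrier N)"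
  by (auto simp: lin_hom_def module_iso_def iso_def)

lemma lin_hom_inv_into:
  assumes h: "h \<in> module_iso R M N" and M: "module R M"
  shows "inv_into (carrier M) h \<in> lin_hom R N M"
proof -
  interpret module R M by (rule M)
  let ?k = "inv_into (carrier M) h"
  have lin: "h \<in> lin_hom R M N" and bij: "bij_betw h (carrier M) (carrier N)"
    using h by (auto simp: module_iso_iff)
  have k: "?k y \<in> carrier M" "h (?k y) = y" if "y \<in> carrier N" for y
    using that bij by (auto simp: bij_betw_def inv_into_into f_inv_into_f)
  have eq: "?k y = x" if "x \<in> carrier M" "h x = y" for x y
    using that bij by (auto simp: bij_betw_def inv_into_f_f)
  show ?thesis
    using k by (intro lin_homI eq) (auto simp: lin_hom_add[OF lin] lin_hom_smult[OF lin])
qed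

context discrete_valuation_ring
begin

text \<open>Families are indexed by all pairs rather than by T, so one family represents elements
  over every index set, and restricting an element keeps its lift.\<close>

abbreviation lifts :: "(nat \<times> nat \<Rightarrow> 'a) set" where
  "lifts \<equiv> UNIV \<rightarrow> carrier R"

definition residues :: "(nat \<times> nat) set \<Rightarrow> (nat \<times> nat \<Rightarrow> nat) \<Rightarrow> (nat \<times> nat \<Rightarrow> 'a) \<Rightarrow> nat \<times> nat \<Rightarrow> 'a set" where
  "residues T \<mu> V = (\<lambda>t\<in>T. quot_proj R \<pi> (\<mu> t) (V t))"

abbreviation csum :: "(nat \<times> nat) set \<Rightarrow> (nat \<times> nat \<Rightarrow> nat) \<Rightarrow> ('a, nat \<times> nat \<Rightarrow> 'a set) module" where
  "csum \<equiv> cyclic_sum R \<pi>"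

lemma lifts_closed [simp]: "V \<in> lifts \<Longrightarrow> V t \<in> carrier R"
  by auto

lemma residues_apply [simp]: "t \<in> T \<Longrightarrow> residues T \<mu> V t = quot_proj R \<pi> (\<mu> t) (V t)"
  by (simp add: residues_def)

lemma residues_closed [simp]: "V \<in> lifts \<Longrightarrow> residues T \<mu> V \<in> carrier (csum T \<mu>)"
  by (simp add: residues_def cyclic_sum_def del: Pi_UNIV)

lemma residues_surj:
  assumes "x \<in> carrier (csum T \<mu>)"
  obtains V where "V \<in> lifts" "x = residues T \<mu> V"
proof -
  have "\<exists>a\<in>carrier R. t \<in> T \<longrightarrow> x t = quot_proj R \<pi> (\<mu> t) a" for t
    using assms by (cases "t \<in> T") (auto simp: cyclic_sum_def PiE_iff intro: quot_proj_surj)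
  then obtain V where V: "\<And>t. V t \<in> carrier R" "\<And>t. t \<in> T \<Longrightarrow> x t = quot_proj R \<pi> (\<mu> t) (V t)"
    by metis
  then have "x = residues T \<mu> V"
    using assms by (auto simp: cyclic_sum_def residues_def PiE_iff intro!: extensionalityI[of _ T])
  with V show ?thesis
    using that[of V] by auto
qed

lemma residues_eq_iff:
  assumes "V \<in> lifts" "W \<in> lifts"
  shows "residues T \<mu> V = residues T \<mu> W \<longleftrightarrow> (\<forall>t\<in>T. \<pi> [^] \<mu> t divides (V t \<ominus> W t))"
proof -
  have "residues T \<mu> V = residues T \<mu> W \<longleftrightarrow>
      (\<forall>t\<in>T. quot_proj R \<pi> (\<mu> t) (V t) = quot_proj R \<pi> (\<mu> t) (W t))"
    by (auto simp: residues_def fun_eq_iff)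
  also have "\<dots> \<longleftrightarrow> (\<forall>t\<in>T. \<pi> [^] \<mu> t divides (V t \<ominus> W t))"
    using assms by (simp add: quot_proj_eq_iff)
  finally show ?thesis .
qed

lemma residues_cong: "(\<And>t. t \<in> T \<Longrightarrow> V t = W t) \<Longrightarrow> residues T \<mu> V = residues T \<mu> W"
  unfolding residues_def by (rule restrict_ext) simp

lemma residues_add:
  "V \<in> lifts \<Longrightarrow> W \<in> lifts \<Longrightarrow>
     residues T \<mu> V \<oplus>\<^bsub>csum T \<mu>\<^esub> residues T \<mu> W = residues T \<mu> (\<lambda>t. V t \<oplus> W t)"
  by (simp add: residues_def cyclic_sum_def quot_proj_add cong: restrict_cong)

lemma residues_smult:
  "a \<in> carrier R \<Longrightarrow> V \<in> lifts \<Longrightarrow> a \<odot>\<^bsub>csum T \<mu>\<^esub> residues T \<mu> V = residues T \<mu> (\<lambda>t. a \<otimes> V t)"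
  by (simp add: residues_def cyclic_sum_def quot_proj_mult cong: restrict_cong)

lemma residues_zero: "residues T \<mu> (\<lambda>t. \<zero>) = \<zero>\<^bsub>csum T \<mu>\<^esub>"
  by (auto simp: residues_def cyclic_sum_def quot_proj_zero)

lemma residues_eq_zero_iff:
  assumes "V \<in> lifts"
  shows "residues T \<mu> V = \<zero>\<^bsub>csum T \<mu>\<^esub> \<longleftrightarrow> (\<forall>t\<in>T. \<pi> [^] \<mu> t divides V t)"
  using assms residues_eq_iff[of V "\<lambda>t. \<zero>" T \<mu>] by (simp add: residues_zero minus_eq)

lemma csum_module: "module R (csum T \<mu>)"
proof (rule moduleI)
  let ?M = "csum T \<mu>"
  show "cring R" by (rule is_cring)
  have zero: "\<zero>\<^bsub>?M\<^esub> \<in> carrier ?M"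
    unfolding residues_zero[symmetric] by (rule residues_closed) auto
  show "abelian_group ?M"
  proof (rule abelian_groupI)
    have laws: "x \<oplus>\<^bsub>?M\<^esub> y \<in> carrier ?M \<and> x \<oplus>\<^bsub>?M\<^esub> y = y \<oplus>\<^bsub>?M\<^esub> x \<and>
        x \<oplus>\<^bsub>?M\<^esub> y \<oplus>\<^bsub>?M\<^esub> z = x \<oplus>\<^bsub>?M\<^esub> (y \<oplus>\<^bsub>?M\<^esub> z)"
      if xyz: "x \<in> carrier ?M" "y \<in> carrier ?M" "z \<in> carrier ?M" for x y z
    proof -
      obtain V W Z where "V \<in> lifts" "x = residues T \<mu> V" "W \<in> lifts" "y = residues T \<mu> W"
        "Z \<in> lifts" "z = residues T \<mu> Z"
        using xyz by (metis residues_surj)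
      moreover from this have "(\<lambda>t. V t \<oplus> W t) \<in> lifts" "(\<lambda>t. W t \<oplus> Z t) \<in> lifts"
        by auto
      ultimately show ?thesis
        by (simp add: residues_add a_ac)
    qed
    show "x \<oplus>\<^bsub>?M\<^esub> y \<in> carrier ?M" "x \<oplus>\<^bsub>?M\<^esub> y = y \<oplus>\<^bsub>?M\<^esub> x"
      if "x \<in> carrier ?M" "y \<in> carrier ?M" for x y
      using laws[of x y x] that by auto
    show "x \<oplus>\<^bsub>?M\<^esub> y \<oplus>\<^bsub>?M\<^esub> z = x \<oplus>\<^bsub>?M\<^esub> (y \<oplus>\<^bsub>?M\<^esub> z)"
      if "x \<in> carrier ?M" "y \<in> carrier ?M" "z \<in> carrier ?M" for x y z
      using laws[of x y z] that by blast
  next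
    fix x assume "x \<in> carrier ?M"
    then obtain V where V: "V \<in> lifts" "x = residues T \<mu> V"
      by (metis residues_surj)
    then show "\<zero>\<^bsub>?M\<^esub> \<oplus>\<^bsub>?M\<^esub> x = x"
      by (simp add: residues_zero[symmetric] residues_add)
    from V have "residues T \<mu> (\<lambda>t. \<ominus> V t) \<oplus>\<^bsub>?M\<^esub> x = \<zero>\<^bsub>?M\<^esub>"
      by (simp add: residues_zero[symmetric] residues_add l_neg)
    moreover have "residues T \<mu> (\<lambda>t. \<ominus> V t) \<in> carrier ?M"
      using V by (intro residues_closed) auto
    ultimately show "\<exists>y\<in>carrier ?M. y \<oplus>\<^bsub>?M\<^esub> x = \<zero>\<^bsub>?M\<^esub>"
      by blast
  qed (rule zero)
  have laws: "a \<odot>\<^bsub>?M\<^esub> x \<in> carrier ?M \<and>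
      (a \<oplus> b) \<odot>\<^bsub>?M\<^esub> x = a \<odot>\<^bsub>?M\<^esub> x \<oplus>\<^bsub>?M\<^esub> b \<odot>\<^bsub>?M\<^esub> x \<and>
      a \<odot>\<^bsub>?M\<^esub> (x \<oplus>\<^bsub>?M\<^esub> y) = a \<odot>\<^bsub>?M\<^esub> x \<oplus>\<^bsub>?M\<^esub> a \<odot>\<^bsub>?M\<^esub> y \<and>
      a \<otimes> b \<odot>\<^bsub>?M\<^esub> x = a \<odot>\<^bsub>?M\<^esub> (b \<odot>\<^bsub>?M\<^esub> x) \<and> \<one> \<odot>\<^bsub>?M\<^esub> x = x"
    if ab: "a \<in> carrier R" "b \<in> carrier R" and xy: "x \<in> carrier ?M" "y \<in> carrier ?M" for a b x y
  proof -
    obtain V W where V: "V \<in> lifts" "x = residues T \<mu> V" and W: "W \<in> lifts" "y = residues T \<mu> W"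
      using xy by (metis residues_surj)
    have [simp]: "(\<lambda>t. c \<otimes> V t) \<in> lifts" "(\<lambda>t. c \<otimes> W t) \<in> lifts" if "c \<in> carrier R" for c
      using V W that by auto
    have [simp]: "(\<lambda>t. V t \<oplus> W t) \<in> lifts"
      using V W by auto
    show ?thesis
      using V W ab by (simp add: residues_smult residues_add l_distr r_distr m_assoc)
  qed
  show "a \<odot>\<^bsub>?M\<^esub> x \<in> carrier ?M" if "a \<in> carrier R" "x \<in> carrier ?M" for a x
    using laws[of a a x x] that by simp
  show "(a \<oplus> b) \<odot>\<^bsub>?M\<^esub> x = a \<odot>\<^bsub>?M\<^esub> x \<oplus>\<^bsub>?M\<^esub> b \<odot>\<^bsub>?M\<^esub> x"
    "a \<otimes> b \<odot>\<^bsub>?M\<^esub> x = a \<odot>\<^bsub>?M\<^esub> (b \<odot>\<^bsub>?M\<^esub> x)"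
    if "a \<in> carrier R" "b \<in> carrier R" "x \<in> carrier ?M" for a b x
    using laws[of a b x x] that by auto
  show "a \<odot>\<^bsub>?M\<^esub> (x \<oplus>\<^bsub>?M\<^esub> y) = a \<odot>\<^bsub>?M\<^esub> x \<oplus>\<^bsub>?M\<^esub> a \<odot>\<^bsub>?M\<^esub> y"
    if "a \<in> carrier R" "x \<in> carrier ?M" "y \<in> carrier ?M" for a x y
    using laws[of a a x y] that by auto
  show "\<one> \<odot>\<^bsub>?M\<^esub> x = x" if "x \<in> carrier ?M" for x
    using laws[of \<one> \<one> x x] that by auto
qed

text \<open>A linear recipe on representatives descends to the residues as soon as it respects
  families that represent zero. Restrictions, chain differences and shears are all built this
  way.\<close>

lemma lin_hom_of_lifts:
  assumes closed: "\<And>V. V \<in> lifts \<Longrightarrow> \<Phi> V \<in> lifts"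
    and add: "\<And>V W t. V \<in> lifts \<Longrightarrow> W \<in> lifts \<Longrightarrow> t \<in> T' \<Longrightarrow> \<Phi> (\<lambda>t. V t \<oplus> W t) t = \<Phi> V t \<oplus> \<Phi> W t"
    and smult: "\<And>a V t. a \<in> carrier R \<Longrightarrow> V \<in> lifts \<Longrightarrow> t \<in> T' \<Longrightarrow> \<Phi> (\<lambda>t. a \<otimes> V t) t = a \<otimes> \<Phi> V t"
    and zero: "\<And>V t. V \<in> lifts \<Longrightarrow> (\<And>t. t \<in> T \<Longrightarrow> \<pi> [^] \<mu> t divides V t) \<Longrightarrow> t \<in> T' \<Longrightarrow>
                 \<pi> [^] \<mu>' t divides \<Phi> V t"
  obtains h where "h \<in> lin_hom R (csum T \<mu>) (csum T' \<mu>')"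
    "\<And>V. V \<in> lifts \<Longrightarrow> h (residues T \<mu> V) = residues T' \<mu>' (\<Phi> V)"
proof
  define h where "h x = residues T' \<mu>' (\<Phi> (SOME V. V \<in> lifts \<and> residues T \<mu> V = x))" for x
  have wd: "residues T' \<mu>' (\<Phi> V) = residues T' \<mu>' (\<Phi> W)"
    if V: "V \<in> lifts" and W: "W \<in> lifts" and eq: "residues T \<mu> V = residues T \<mu> W" for V W
  proof -
    \<comment> \<open>The difference is written as a sum with a scalar multiple, the form to which
      \<open>add\<close> and \<open>smult\<close> apply.\<close>
    let ?D = "\<lambda>t. V t \<oplus> (\<ominus> \<one>) \<otimes> W t"
    have D: "?D t = V t \<ominus> W t" for t
      using V W by (simp add: minus_eq l_minus)
    have "\<Phi> ?D t = \<Phi> V t \<ominus> \<Phi> W t" if "t \<in> T'" for t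
    proof -
      have "(\<lambda>t. (\<ominus> \<one>) \<otimes> W t) \<in> lifts"
        using W by auto
      then show ?thesis
        using V W that closed[OF W] add[of V "\<lambda>t. (\<ominus> \<one>) \<otimes> W t" t] smult[of "\<ominus> \<one>" W t]
        by (simp add: minus_eq l_minus)
    qed
    moreover have "\<pi> [^] \<mu>' t divides \<Phi> ?D t" if "t \<in> T'" for t
      using V W eq that by (intro zero) (auto simp: residues_eq_iff D)
    ultimately show ?thesis
      using closed[OF V] closed[OF W] by (simp add: residues_eq_iff)
  qed
  show h: "h (residues T \<mu> V) = residues T' \<mu>' (\<Phi> V)" if "V \<in> lifts" for V
    unfolding h_def using that
    by (intro wd) (auto intro: someI2[of "\<lambda>W. W \<in> lifts \<and> residues T \<mu> W = residues T \<mu> V" V])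
  show "h \<in> lin_hom R (csum T \<mu>) (csum T' \<mu>')"
  proof (rule lin_homI)
    show "h x \<in> carrier (csum T' \<mu>')" if x: "x \<in> carrier (csum T \<mu>)" for x
    proof -
      obtain V where "V \<in> lifts" "x = residues T \<mu> V"
        by (rule residues_surj[OF x])
      then show ?thesis
        using closed[of V] by (simp add: h)
    qed
    show "h (x \<oplus>\<^bsub>csum T \<mu>\<^esub> y) = h x \<oplus>\<^bsub>csum T' \<mu>'\<^esub> h y"
      if xy: "x \<in> carrier (csum T \<mu>)" "y \<in> carrier (csum T \<mu>)" for x y
    proof -
      obtain V W where V: "V \<in> lifts" "x = residues T \<mu> V" and W: "W \<in> lifts" "y = residues T \<mu> W"
        using xy by (metis residues_surj)
      then have "(\<lambda>t. V t \<oplus> W t) \<in> lifts"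
        by auto
      then show ?thesis
        using V W closed by (simp add: residues_add h add cong: residues_cong)
    qed
    show "h (a \<odot>\<^bsub>csum T \<mu>\<^esub> x) = a \<odot>\<^bsub>csum T' \<mu>'\<^esub> h x"
      if a: "a \<in> carrier R" and x: "x \<in> carrier (csum T \<mu>)" for a x
    proof -
      obtain V where V: "V \<in> lifts" "x = residues T \<mu> V"
        using x by (metis residues_surj)
      then have "(\<lambda>t. a \<otimes> V t) \<in> lifts"
        using a by auto
      then show ?thesis
        using V a closed by (simp add: residues_smult h smult cong: residues_cong)
    qed
  qed
qed

subsection \<open>Multiples of powers of the uniformizer\<close>

text \<open>This is the ideal \<pi>^n (R/\<pi>^l), given by representatives; it is zero once n
  reaches l.\<close>

definition multiples :: "nat \<Rightarrow> nat \<Rightarrow> 'a set set" where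
  "multiples l n = {quot_proj R \<pi> l (\<pi> [^] n \<otimes> b) |b. b \<in> carrier R}"

lemma quot_proj_mem_multiples_iff:
  assumes a: "a \<in> carrier R"
  shows "quot_proj R \<pi> l a \<in> multiples l n \<longleftrightarrow> \<pi> [^] (min n l) divides a"
proof
  assume "quot_proj R \<pi> l a \<in> multiples l n"
  then obtain b where b: "b \<in> carrier R" "\<pi> [^] l divides (a \<ominus> \<pi> [^] n \<otimes> b)"
    using a by (auto simp: multiples_def quot_proj_eq_iff)
  then have "\<pi> [^] (min n l) divides (a \<ominus> \<pi> [^] n \<otimes> b)"
    using a by (intro pow_dvd_le[of "min n l" l]) auto
  moreover have "\<pi> [^] (min n l) divides \<pi> [^] n \<otimes> b"
    using b by (intro pow_dvd_le[of "min n l" n]) auto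
  moreover have "a = (a \<ominus> \<pi> [^] n \<otimes> b) \<oplus> \<pi> [^] n \<otimes> b"
    using a b uniformizer_pow_closed[of n] by algebra
  ultimately show "\<pi> [^] (min n l) divides a"
    using a b dvd_add[of "\<pi> [^] (min n l)" "a \<ominus> \<pi> [^] n \<otimes> b" "\<pi> [^] n \<otimes> b"] by simp
next
  assume d: "\<pi> [^] (min n l) divides a"
  show "quot_proj R \<pi> l a \<in> multiples l n"
  proof (cases "n \<le> l")
    case True
    with d show ?thesis
      by (auto simp: multiples_def factor_def)
  next
    case False
    with d a have "quot_proj R \<pi> l a = quot_proj R \<pi> l (\<pi> [^] n \<otimes> \<zero>)"
      by (simp add: quot_proj_eq_iff minus_eq)
    then show ?thesis
      unfolding multiples_def by blast
  qed
qed

lemma zero_mem_multiples [simp]: "quot_proj R \<pi> l \<zero> \<in> multiples l n"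
  by (simp add: quot_proj_mem_multiples_iff)

lemma multiples_add:
  assumes "p \<in> multiples l n" "q \<in> multiples l n"
  shows "p \<oplus>\<^bsub>quot_pow R \<pi> l\<^esub> q \<in> multiples l n"
proof -
  obtain b c where "b \<in> carrier R" "c \<in> carrier R"
    "p = quot_proj R \<pi> l (\<pi> [^] n \<otimes> b)" "q = quot_proj R \<pi> l (\<pi> [^] n \<otimes> c)"
    using assms by (auto simp: multiples_def)
  then have "p \<oplus>\<^bsub>quot_pow R \<pi> l\<^esub> q = quot_proj R \<pi> l (\<pi> [^] n \<otimes> (b \<oplus> c))"
    by (simp add: r_distr quot_proj_add)
  then show ?thesis
    using \<open>b \<in> carrier R\<close> \<open>c \<in> carrier R\<close> by (auto simp: multiples_def)
qed

text \<open>Quantifying over the finite n below v treats v = \<infinity> uniformly: there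
  \<open>epow\<close> is zero, and n = \<open>\<mu> t\<close> already forces the coordinate at t to
  vanish.\<close>

lemma mem_pi_multiples_iff:
  assumes x: "x \<in> carrier (csum T \<mu>)"
  shows "x \<in> pi_multiples R \<pi> (csum T \<mu>) v \<longleftrightarrow>
           (\<forall>n. enat n \<le> v \<longrightarrow> (\<forall>t\<in>T. x t \<in> multiples (\<mu> t) n))"
proof (cases v)
  case (enat m)
  show ?thesis
  proof
    assume "x \<in> pi_multiples R \<pi> (csum T \<mu>) v"
    then obtain W where W: "W \<in> lifts" "x = \<pi> [^] m \<odot>\<^bsub>csum T \<mu>\<^esub> residues T \<mu> W"
      using enat by (auto simp: pi_multiples_def smult_image_def elim: residues_surj)
    then have "x = residues T \<mu> (\<lambda>t. \<pi> [^] m \<otimes> W t)"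
      by (simp add: residues_smult)
    moreover have "\<pi> [^] (min n (\<mu> t)) divides \<pi> [^] m \<otimes> W t" if "n \<le> m" for n t
      using W that by (intro pow_dvd_le[of "min n (\<mu> t)" m]) auto
    ultimately show "\<forall>n. enat n \<le> v \<longrightarrow> (\<forall>t\<in>T. x t \<in> multiples (\<mu> t) n)"
      using W enat by (simp add: quot_proj_mem_multiples_iff)
  next
    assume "\<forall>n. enat n \<le> v \<longrightarrow> (\<forall>t\<in>T. x t \<in> multiples (\<mu> t) n)"
    then have "t \<in> T \<Longrightarrow> x t \<in> multiples (\<mu> t) m" for t
      using enat by blast
    then have "\<exists>b\<in>carrier R. t \<in> T \<longrightarrow> x t = quot_proj R \<pi> (\<mu> t) (\<pi> [^] m \<otimes> b)" for t
      unfolding multiples_def by blast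
    then obtain W where W: "\<And>t. W t \<in> carrier R"
      "\<And>t. t \<in> T \<Longrightarrow> x t = quot_proj R \<pi> (\<mu> t) (\<pi> [^] m \<otimes> W t)"
      by metis
    then have W': "W \<in> lifts" and "x = residues T \<mu> (\<lambda>t. \<pi> [^] m \<otimes> W t)"
      using x by (auto simp: cyclic_sum_def residues_def PiE_iff intro!: extensionalityI[of _ T])
    then have "x = \<pi> [^] m \<odot>\<^bsub>csum T \<mu>\<^esub> residues T \<mu> W"
      using W' by (simp add: residues_smult)
    moreover have "residues T \<mu> W \<in> carrier (csum T \<mu>)"
      using W' by simp
    ultimately show "x \<in> pi_multiples R \<pi> (csum T \<mu>) v"
      using enat by (auto simp: pi_multiples_def smult_image_def)
  qed
next
  case infinity
  interpret M: module R "csum T \<mu>" by (rule csum_module)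
  obtain V where V: "V \<in> lifts" "x = residues T \<mu> V"
    using x by (rule residues_surj)
  have "x \<in> pi_multiples R \<pi> (csum T \<mu>) v \<longleftrightarrow> x = \<zero>\<^bsub>csum T \<mu>\<^esub>"
    using infinity by (auto simp: pi_multiples_def smult_image_def intro!: exI[of _ "\<zero>\<^bsub>csum T \<mu>\<^esub>"])
  also have "\<dots> \<longleftrightarrow> (\<forall>n. \<forall>t\<in>T. \<pi> [^] (min n (\<mu> t)) divides V t)"
  proof
    assume "x = \<zero>\<^bsub>csum T \<mu>\<^esub>"
    then have "\<pi> [^] \<mu> t divides V t" if "t \<in> T" for t
      using V that by (simp add: residues_eq_zero_iff)
    then show "\<forall>n. \<forall>t\<in>T. \<pi> [^] (min n (\<mu> t)) divides V t"
      using V pow_dvd_le[of "min n (\<mu> t)" "\<mu> t" "V t" for n t] by simp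
  next
    assume dvd: "\<forall>n. \<forall>t\<in>T. \<pi> [^] (min n (\<mu> t)) divides V t"
    have "\<pi> [^] \<mu> t divides V t" if "t \<in> T" for t
      using bspec[OF spec[OF dvd, of "\<mu> t"] that] by simp
    then show "x = \<zero>\<^bsub>csum T \<mu>\<^esub>"
      using V by (simp add: residues_eq_zero_iff)
  qed
  finally show ?thesis
    using V infinity by (simp add: quot_proj_mem_multiples_iff)
qed

definition single :: "nat \<times> nat \<Rightarrow> 'a \<Rightarrow> nat \<times> nat \<Rightarrow> 'a" where
  "single t a = (\<lambda>u. if u = t then a else \<zero>)"

lemma single_lifts [simp]: "a \<in> carrier R \<Longrightarrow> single t a \<in> lifts"
  by (auto simp: single_def)

text \<open>The two alternatives in \<open>n\<close> are the two constraints on a homomorphism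
  between cyclic modules. By linearity a factor \<pi>^m is kept. Moreover, the power of \<pi> with
  exponent \<open>\<mu> t - m\<close> kills the vector, hence its image, which forces the coordinate
  at t' to be divisible by \<pi> to the power \<open>\<mu>' t' - (\<mu> t - m)\<close>.\<close>

lemma lin_hom_single_mem_multiples:
  assumes g: "g \<in> lin_hom R (csum T \<mu>) (csum T' \<mu>')" and t': "t' \<in> T'"
    and a: "a \<in> carrier R" "\<pi> [^] m divides a"
    and n: "n \<le> m \<or> min n (\<mu>' t') + \<mu> t \<le> \<mu>' t' + m"
  shows "g (residues T \<mu> (single t a)) t' \<in> multiples (\<mu>' t') n"
proof -
  obtain c where c: "c \<in> carrier R" "a = \<pi> [^] m \<otimes> c"
    using a by (auto simp: factor_def)
  obtain W where W: "W \<in> lifts" "g (residues T \<mu> (single t a)) = residues T' \<mu>' W"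
    by (rule residues_surj[OF lin_hom_closed[OF g residues_closed[OF single_lifts[OF a(1)]]]])
  obtain Z where Z: "Z \<in> lifts" "g (residues T \<mu> (single t c)) = residues T' \<mu>' Z"
    by (rule residues_surj[OF lin_hom_closed[OF g residues_closed[OF single_lifts[OF c(1)]]]])
  interpret M: module R "csum T \<mu>" by (rule csum_module)
  interpret N: module R "csum T' \<mu>'" by (rule csum_module)
  have "g \<zero>\<^bsub>csum T \<mu>\<^esub> = \<zero>\<^bsub>csum T' \<mu>'\<^esub>"
    using lin_hom_smult[OF g zero_closed M.zero_closed] lin_hom_closed[OF g M.zero_closed] by simp
  show ?thesis
  proof (cases "n \<le> m")
    case True
    have "single t a = (\<lambda>u. \<pi> [^] m \<otimes> single t c u)"
      using c by (simp add: single_def fun_eq_iff)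
    then have "residues T \<mu> (single t a) = \<pi> [^] m \<odot>\<^bsub>csum T \<mu>\<^esub> residues T \<mu> (single t c)"
      using c by (simp only: residues_smult uniformizer_pow_closed single_lifts)
    then have "g (residues T \<mu> (single t a)) = \<pi> [^] m \<odot>\<^bsub>csum T' \<mu>'\<^esub> residues T' \<mu>' Z"
      using Z c by (simp only: lin_hom_smult[OF g] uniformizer_pow_closed single_lifts residues_closed)
    then have "residues T' \<mu>' W = residues T' \<mu>' (\<lambda>t. \<pi> [^] m \<otimes> Z t)"
      using W Z by (simp add: residues_smult)
    then have "g (residues T \<mu> (single t a)) t' = quot_proj R \<pi> (\<mu>' t') (\<pi> [^] m \<otimes> Z t')"
      using W t' by simp
    moreover have "\<pi> [^] (min n (\<mu>' t')) divides \<pi> [^] m \<otimes> Z t'"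
      using Z True by (intro pow_dvd_le[of "min n (\<mu>' t')" m]) auto
    ultimately show ?thesis
      using Z by (simp add: quot_proj_mem_multiples_iff)
  next
    case False
    with n have n: "min n (\<mu>' t') + \<mu> t \<le> \<mu>' t' + m"
      by simp
    \<comment> \<open>If m exceeds \<open>\<mu> t\<close>, then the vector is already zero and the
      truncated exponent 0 kills it as well.\<close>
    let ?k = "\<mu> t - m"
    have "\<pi> [^] \<mu> u divides \<pi> [^] ?k \<otimes> single t a u" for u
      using a by (auto simp: single_def intro!: pow_dvd_mult)
    moreover have "(\<lambda>u. \<pi> [^] ?k \<otimes> single t a u) \<in> lifts"
      using a by (auto simp: single_def)
    ultimately have "\<pi> [^] ?k \<odot>\<^bsub>csum T \<mu>\<^esub> residues T \<mu> (single t a) = \<zero>\<^bsub>csum T \<mu>\<^esub>"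
      using a by (simp add: residues_smult residues_eq_zero_iff)
    then have "\<pi> [^] ?k \<odot>\<^bsub>csum T' \<mu>'\<^esub> residues T' \<mu>' W = \<zero>\<^bsub>csum T' \<mu>'\<^esub>"
      using lin_hom_smult[OF g uniformizer_pow_closed residues_closed[OF single_lifts[OF a(1)]], of ?k t]
        \<open>g \<zero>\<^bsub>csum T \<mu>\<^esub> = \<zero>\<^bsub>csum T' \<mu>'\<^esub>\<close> W by simp
    moreover have "(\<lambda>u. \<pi> [^] ?k \<otimes> W u) \<in> lifts"
      using W by auto
    ultimately have "\<pi> [^] \<mu>' t' divides \<pi> [^] ?k \<otimes> W t'"
      using W t' by (simp add: residues_smult residues_eq_zero_iff)
    then have "\<pi> [^] (min n (\<mu>' t')) divides W t'"
      using W n by (intro pow_dvd_cancel[of "W t'" "\<mu>' t'" ?k]) auto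
    then show ?thesis
      using W t' by (simp add: quot_proj_mem_multiples_iff)
  qed
qed

lemma lin_hom_mem_multiples:
  assumes g: "g \<in> lin_hom R (csum T \<mu>) (csum T' \<mu>')" and t': "t' \<in> T'" and T: "finite T"
    and V: "V \<in> lifts"
    and dvd: "\<And>t. t \<in> T \<Longrightarrow>
      \<exists>m. \<pi> [^] m divides V t \<and> (n \<le> m \<or> min n (\<mu>' t') + \<mu> t \<le> \<mu>' t' + m)"
  shows "g (residues T \<mu> V) t' \<in> multiples (\<mu>' t') n"
proof -
  interpret M: module R "csum T \<mu>" by (rule csum_module)
  interpret N: module R "csum T' \<mu>'" by (rule csum_module)
  \<comment> \<open>The induction adds one coordinate at a time; those outside A are set to
    zero.\<close>
  have "g (residues T \<mu> (\<lambda>u. if u \<in> A then V u else \<zero>)) t' \<in> multiples (\<mu>' t') n"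
    if "A \<subseteq> T" for A
    using finite_subset[OF that T] that
  proof (induction A)
    case empty
    have "g \<zero>\<^bsub>csum T \<mu>\<^esub> = \<zero>\<^bsub>csum T' \<mu>'\<^esub>"
      using lin_hom_smult[OF g zero_closed M.zero_closed] lin_hom_closed[OF g M.zero_closed] by simp
    then show ?case
      using t' by (simp add: residues_zero) (simp add: residues_zero[symmetric])
  next
    case (insert u A)
    let ?XA = "\<lambda>v. if v \<in> A then V v else \<zero>"
    have XA: "?XA \<in> lifts"
      using V by auto
    have "residues T \<mu> (\<lambda>v. if v \<in> insert u A then V v else \<zero>) =
        residues T \<mu> (single u (V u)) \<oplus>\<^bsub>csum T \<mu>\<^esub> residues T \<mu> ?XA"
      using V XA insert by (auto simp: residues_add single_def intro!: residues_cong)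
    then have "g (residues T \<mu> (\<lambda>v. if v \<in> insert u A then V v else \<zero>)) =
        g (residues T \<mu> (single u (V u))) \<oplus>\<^bsub>csum T' \<mu>'\<^esub> g (residues T \<mu> ?XA)"
      using V XA by (simp add: lin_hom_add[OF g])
    moreover have "g (residues T \<mu> (single u (V u))) t' \<in> multiples (\<mu>' t') n"
    proof -
      obtain m where "\<pi> [^] m divides V u" "n \<le> m \<or> min n (\<mu>' t') + \<mu> u \<le> \<mu>' t' + m"
        using dvd[of u] insert by auto
      then show ?thesis
        using V by (intro lin_hom_single_mem_multiples[OF g t']) auto
    qed
    moreover have "g (residues T \<mu> ?XA) t' \<in> multiples (\<mu>' t') n"
      using insert by auto
    ultimately show ?case
      using t' by (simp add: cyclic_sum_def multiples_add)
  qed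
  from this[of T] show ?thesis
    by (simp cong: residues_cong)
qed

end

section \<open>Ideals of elements\<close>

context discrete_valuation_ring
begin

text \<open>This removes the minimum over a block: each coordinate may generate separately. The
  number a need not be the valuation of \<open>V t\<close>, only an upper bound for it below
  \<open>\<mu> t\<close>, since a larger a gives a smaller element of the poset.\<close>

lemma mem_gen_block_vals_iff:
  assumes V: "V \<in> lifts"
  shows "(v, l) \<in> gen_ideal (block_vals R \<pi> T \<mu> (residues T \<mu> V)) \<longleftrightarrow>
    v < l \<and> (\<exists>t\<in>T. \<exists>a<\<mu> t. \<not> \<pi> [^] Suc a divides V t \<and> a \<le> v \<and> l - v \<le> \<mu> t - a)"
    (is "?L \<longleftrightarrow> ?P")
proof
  let ?val = "\<lambda>l q. val (quot_pow R \<pi> l) (quot_proj R \<pi> l \<pi>) q"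
  {
    assume ?L
    then obtain v' l' where "v < l" "v' \<le> v" "l - v \<le> l' - v'"
      and v': "enat v' = (INF t\<in>{t\<in>T. \<mu> t = l'}. ?val l' (residues T \<mu> V t))"
      by (auto simp: gen_ideal_def poset_P_def poset_le_def block_vals_def)
    have "\<not> enat (Suc v') \<le> (INF t\<in>{t\<in>T. \<mu> t = l'}. ?val l' (residues T \<mu> V t))"
      unfolding v'[symmetric] by simp
    then obtain t where t: "t \<in> T" "\<mu> t = l'" "\<not> enat (Suc v') \<le> ?val l' (residues T \<mu> V t)"
      by (auto simp: le_INF_iff)
    then have "\<not> \<pi> [^] (min (Suc v') l') divides V t"
      using V by (auto simp: le_val_quot_iff)
    moreover have "v' < l'"
      using \<open>v < l\<close> \<open>l - v \<le> l' - v'\<close> by simp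
    ultimately have "v' < \<mu> t \<and> \<not> \<pi> [^] Suc v' divides V t \<and> v' \<le> v \<and> l - v \<le> \<mu> t - v'"
      using t \<open>v' \<le> v\<close> \<open>l - v \<le> l' - v'\<close> by (simp add: min_def split: if_splits)
    then show ?P
      using t(1) \<open>v < l\<close> by blast
  }
  assume ?P
  then obtain t a where "v < l" "t \<in> T" and a: "a < \<mu> t" "\<not> \<pi> [^] Suc a divides V t"
    "a \<le> v" "l - v \<le> \<mu> t - a"
    by blast
  have "\<not> enat (Suc a) \<le> ?val (\<mu> t) (residues T \<mu> V t)"
    using V a \<open>t \<in> T\<close> le_val_quot_iff[of "V t" "Suc a" "\<mu> t"] by (simp add: min_def del: nat_pow_Suc)
  moreover have "(INF u\<in>{u\<in>T. \<mu> u = \<mu> t}. ?val (\<mu> t) (residues T \<mu> V u)) \<le> ?val (\<mu> t) (residues T \<mu> V t)"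
    using \<open>t \<in> T\<close> by (intro INF_lower) auto
  ultimately have "(INF u\<in>{u\<in>T. \<mu> u = \<mu> t}. ?val (\<mu> t) (residues T \<mu> V u)) < enat (Suc a)"
    by (meson leI order.strict_trans1)
  then obtain v' where v': "(INF u\<in>{u\<in>T. \<mu> u = \<mu> t}. ?val (\<mu> t) (residues T \<mu> V u)) = enat v'" "v' < Suc a"
    by (auto elim: less_enatE)
  then have "(v', \<mu> t) \<in> block_vals R \<pi> T \<mu> (residues T \<mu> V)"
    by (simp add: block_vals_def)
  moreover have "poset_le (v, l) (v', \<mu> t)"
    using a v'(2) by (simp add: poset_le_def)
  ultimately show ?L
    using \<open>v < l\<close> by (auto simp: gen_ideal_def poset_P_def)
qed

text \<open>By contraposition. If (v, l) is not below the pair of a coordinate with valuation a,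
  then either a > v, which gives \<open>Suc a' \<le> a\<close>, or
  \<open>\<mu> t - a < l - v\<close>, which gives the other alternative of
  \<open>lin_hom_mem_multiples\<close>. As this holds at every coordinate of x, the image cannot
  have valuation a' at t'.\<close>

lemma gen_block_vals_mono:
  assumes g: "g \<in> lin_hom R (csum T \<mu>) (csum T' \<mu>')" and T: "finite T"
    and x: "x \<in> carrier (csum T \<mu>)"
  shows "gen_ideal (block_vals R \<pi> T' \<mu>' (g x)) \<subseteq> gen_ideal (block_vals R \<pi> T \<mu> x)"
proof (intro subrelI)
  fix v l assume vl: "(v, l) \<in> gen_ideal (block_vals R \<pi> T' \<mu>' (g x))"
  obtain V where V: "V \<in> lifts" "x = residues T \<mu> V"
    by (rule residues_surj[OF x])
  obtain W where W: "W \<in> lifts" "g x = residues T' \<mu>' W"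
    by (rule residues_surj[OF lin_hom_closed[OF g x]])
  obtain t' a' where "v < l" "t' \<in> T'" and a': "a' < \<mu>' t'" "\<not> \<pi> [^] Suc a' divides W t'"
    "a' \<le> v" "l - v \<le> \<mu>' t' - a'"
    using vl W by (auto simp add: mem_gen_block_vals_iff simp del: nat_pow_Suc)
  show "(v, l) \<in> gen_ideal (block_vals R \<pi> T \<mu> x)"
  proof (rule ccontr)
    assume no: "(v, l) \<notin> gen_ideal (block_vals R \<pi> T \<mu> x)"
    have "g (residues T \<mu> V) t' \<in> multiples (\<mu>' t') (Suc a')"
    proof (rule lin_hom_mem_multiples[OF g \<open>t' \<in> T'\<close> T V(1)])
      fix t assume t: "t \<in> T"
      show "\<exists>m. \<pi> [^] m divides V t \<and> (Suc a' \<le> m \<or> min (Suc a') (\<mu>' t') + \<mu> t \<le> \<mu>' t' + m)"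
      proof (cases "\<pi> [^] \<mu> t divides V t")
        case True
        then show ?thesis
          by (intro exI[of _ "\<mu> t"]) simp
      next
        case False
        \<comment> \<open>The least exponent that fails to divide is one more than the valuation; it
          is not 0 because \<pi>^0 divides everything.\<close>
        define m where "m = (LEAST m::nat. \<not> \<pi> [^] m divides V t)"
        have m: "\<not> \<pi> [^] m divides V t" "m \<le> \<mu> t"
          using LeastI[of "\<lambda>m. \<not> \<pi> [^] m divides V t" "\<mu> t"] False Least_le[of "\<lambda>m. \<not> \<pi> [^] m divides V t" "\<mu> t"]
      by (simp_all add: m_def)
        then have "m \<noteq> 0"
          using V by (cases m) auto
        then obtain a where a: "m = Suc a"
          by (cases m) auto
        then have "\<pi> [^] a divides V t"
          using not_less_Least[of a "\<lambda>m. \<not> \<pi> [^] m divides V t"] by (auto simp: m_def)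
        moreover have "\<not> (a \<le> v \<and> l - v \<le> \<mu> t - a)"
        proof -
          have "a < \<mu> t" "\<not> \<pi> [^] Suc a divides V t"
            using m a by auto
          then show ?thesis
            using no V t \<open>v < l\<close> unfolding V(2) mem_gen_block_vals_iff[OF V(1)] by blast
        qed
        ultimately show ?thesis
          using a' m(2) a \<open>v < l\<close> by (intro exI[of _ a]) auto
      qed
    qed
    then show False
      using V W a' \<open>t' \<in> T'\<close> by (simp add: quot_proj_mem_multiples_iff min_def split: if_splits)
  qed
qed

text \<open>The choice in \<open>elem_ideal\<close> depends on the module alone, so a single
  decomposition describes the ideals of all its elements.\<close>

lemma elem_ideal_eq_gen_ideal:
  assumes "\<exists>T \<mu> \<phi>. is_decomposition R \<pi> M T \<mu> \<phi>"
  obtains T \<mu> \<phi> where "is_decomposition R \<pi> M T \<mu> \<phi>"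
    "\<forall>e. elem_ideal R \<pi> M e = gen_ideal (block_vals R \<pi> T \<mu> (\<phi> e))"
proof -
  obtain T \<mu> \<phi> where t: "(SOME (T, \<mu>, \<phi>). is_decomposition R \<pi> M T \<mu> \<phi>) = (T, \<mu>, \<phi>)"
    by (metis prod_cases3)
  have "\<exists>p. case p of (T, \<mu>, \<phi>) \<Rightarrow> is_decomposition R \<pi> M T \<mu> \<phi>"
    using assms by auto
  from someI_ex[OF this] have "is_decomposition R \<pi> M T \<mu> \<phi>"
    by (simp add: t)
  then show thesis
    by (rule that) (simp add: elem_ideal_def t)
qed

text \<open>Composing h with the inverse of the chosen \<phi> on one side and the chosen \<psi> on
  the other reduces this to direct sums of cyclic modules, whichever decompositions were
  chosen.\<close>

lemma elem_ideal_lin_hom_subset: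
  assumes M: "module R M" and h: "h \<in> lin_hom R M N" and e: "e \<in> carrier M"
    and dM: "\<exists>T \<mu> \<phi>. is_decomposition R \<pi> M T \<mu> \<phi>"
    and dN: "\<exists>T \<mu> \<phi>. is_decomposition R \<pi> N T \<mu> \<phi>"
  shows "elem_ideal R \<pi> N (h e) \<subseteq> elem_ideal R \<pi> M e"
proof -
  obtain T \<mu> \<phi> where \<phi>: "is_decomposition R \<pi> M T \<mu> \<phi>"
    and eM: "\<forall>e. elem_ideal R \<pi> M e = gen_ideal (block_vals R \<pi> T \<mu> (\<phi> e))"
    by (rule elem_ideal_eq_gen_ideal[OF dM])
  obtain T' \<mu>' \<psi> where \<psi>: "is_decomposition R \<pi> N T' \<mu>' \<psi>"
    and eN: "\<forall>e. elem_ideal R \<pi> N e = gen_ideal (block_vals R \<pi> T' \<mu>' (\<psi> e))"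
    by (rule elem_ideal_eq_gen_ideal[OF dN])
  have \<phi>': "\<phi> \<in> module_iso R M (csum T \<mu>)" and "finite T" and \<psi>': "\<psi> \<in> module_iso R N (csum T' \<mu>')"
    using \<phi> \<psi> by (auto simp: is_decomposition_def)
  let ?k = "inv_into (carrier M) \<phi>"
  have lin: "?k \<in> lin_hom R (csum T \<mu>) M"
    by (rule lin_hom_inv_into[OF \<phi>' M])
  have "(\<lambda>x. \<psi> (h (?k x))) \<in> lin_hom R (csum T \<mu>) (csum T' \<mu>')"
    using \<psi>' by (intro lin_hom_comp[OF lin_hom_comp[OF lin h]]) (simp add: module_iso_iff)
  moreover have "\<phi> e \<in> carrier (csum T \<mu>)"
    using \<phi>' e by (auto simp: module_iso_iff lin_hom_closed)
  moreover have "?k (\<phi> e) = e"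
    using \<phi>' e by (auto simp: module_iso_iff bij_betw_def inv_into_f_f)
  ultimately show ?thesis
    using gen_block_vals_mono[of "\<lambda>x. \<psi> (h (?k x))" T \<mu> T' \<mu>' "\<phi> e"] \<open>finite T\<close>
    by (simp add: eM eN)
qed

lemma is_decomposition_csum:
  assumes "finite T" "\<And>t. t \<in> T \<Longrightarrow> 0 < \<mu> t"
  shows "is_decomposition R \<pi> (csum T \<mu>) T \<mu> (\<lambda>x. x)"
  using assms by (auto simp: is_decomposition_def module_iso_iff lin_hom_def hom_def bij_betw_def)

lemma restrict_residues: "T' \<subseteq> T \<Longrightarrow> restrict (residues T \<mu> V) T' = residues T' \<mu> V"
  by (auto simp: residues_def restrict_def fun_eq_iff)

lemma restrict_lin_hom:
  assumes "T' \<subseteq> T"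
  shows "(\<lambda>x. restrict x T') \<in> lin_hom R (csum T \<mu>) (csum T' \<mu>)"
proof -
  obtain h where h: "h \<in> lin_hom R (csum T \<mu>) (csum T' \<mu>)"
    "\<And>V. V \<in> lifts \<Longrightarrow> h (residues T \<mu> V) = residues T' \<mu> V"
    using lin_hom_of_lifts[of "\<lambda>V. V" T' T \<mu> \<mu>] assms by blast
  have eq: "restrict x T' = h x" if x: "x \<in> carrier (csum T \<mu>)" for x
  proof -
    obtain V where "V \<in> lifts" "x = residues T \<mu> V"
      by (rule residues_surj[OF x])
    then show ?thesis
      using assms by (simp add: h(2) restrict_residues)
  qed
  interpret M: module R "csum T \<mu>" by (rule csum_module)
  show ?thesis
    using h(1) by (intro lin_homI)
      (simp_all add: eq lin_hom_closed[OF h(1)] lin_hom_add[OF h(1)] lin_hom_smult[OF h(1)])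
qed

section \<open>Quotient modules\<close>

text \<open>The homomorphism theorem. Its additive part is that of the factor group, so only the
  scalar multiplication has to be compared.\<close>

lemma quot_module_iso:
  assumes M: "module R M" and P: "module R P" and F: "F \<in> lin_hom R M P"
    and surj: "F ` carrier M = carrier P"
    and N: "N = {x \<in> carrier M. F x = \<zero>\<^bsub>P\<^esub>}"
  shows "\<exists>\<phi>. \<phi> \<in> module_iso R (quot_module M N) P"
    and "(\<lambda>x. N +>\<^bsub>M\<^esub> x) \<in> lin_hom R M (quot_module M N)"
proof -
  interpret M: module R M by (rule M)
  interpret P: module R P by (rule P)
  interpret F: group_hom "add_monoid M" "add_monoid P" F
    using F by (intro group_hom.intro group_hom_axioms.intro M.a_group P.a_group) (simp add: lin_hom_def)
  have ker: "N = kernel (add_monoid M) (add_monoid P) F"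
    by (auto simp: N kernel_def)
  have eq: "carrier (quot_module M N) = carrier (add_monoid M Mod N)"
    "add (quot_module M N) = monoid.mult (add_monoid M Mod N)"
    by (simp_all add: quot_module_def FactGroup_def A_RCOSETS_def set_add_def)
  have normal: "N \<lhd> add_monoid M"
    unfolding ker by (rule F.normal_kernel)
  \<comment> \<open>Cosets are the fibres of F, so the union that defines scalar multiplication on
    cosets is again one fibre.\<close>
  have coset: "N +>\<^bsub>M\<^esub> x = {y \<in> carrier M. F y = F x}" if x: "x \<in> carrier M" for x
  proof
    show "N +>\<^bsub>M\<^esub> x \<subseteq> {y \<in> carrier M. F y = F x}"
      using x by (auto simp: a_r_coset_def' N lin_hom_add[OF F] lin_hom_closed[OF F])
    show "{y \<in> carrier M. F y = F x} \<subseteq> N +>\<^bsub>M\<^esub> x"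
    proof
      fix y assume y: "y \<in> {y \<in> carrier M. F y = F x}"
      have "F (\<ominus>\<^bsub>M\<^esub> x) = \<ominus>\<^bsub>P\<^esub> F x"
        using F.hom_inv[of x] x by (simp add: a_inv_def)
      then have "y \<ominus>\<^bsub>M\<^esub> x \<in> N"
        using x y by (simp add: N a_minus_def lin_hom_add[OF F] lin_hom_closed[OF F] P.r_neg)
      moreover have "y = (y \<ominus>\<^bsub>M\<^esub> x) \<oplus>\<^bsub>M\<^esub> x"
        using x y by (simp add: a_minus_def M.a_assoc M.l_neg)
      ultimately show "y \<in> N +>\<^bsub>M\<^esub> x"
        by (auto simp: a_r_coset_def')
    qed
  qed
  have smult: "r \<odot>\<^bsub>quot_module M N\<^esub> (N +>\<^bsub>M\<^esub> x) = N +>\<^bsub>M\<^esub> (r \<odot>\<^bsub>M\<^esub> x)"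
    if r: "r \<in> carrier R" and x: "x \<in> carrier M" for r x
    using x by (auto simp: quot_module_def coset r lin_hom_smult[OF F r])
  show proj: "(\<lambda>x. N +>\<^bsub>M\<^esub> x) \<in> lin_hom R M (quot_module M N)"
    using normal.r_coset_hom_Mod[OF normal]
    by (simp add: lin_hom_def hom_def eq smult) (simp add: a_r_coset_def)
  have "(\<lambda>c. the_elem (F ` c)) \<in> iso (add_monoid M Mod N) (add_monoid P)"
    unfolding ker using surj by (intro F.FactGroup_iso_set) simp
  moreover have elem: "the_elem (F ` (N +>\<^bsub>M\<^esub> x)) = F x" if x: "x \<in> carrier M" for x
  proof -
    have "F ` (N +>\<^bsub>M\<^esub> x) = {F x}"
      using x by (auto simp: coset)
    then show ?thesis
      by simp
  qed
  moreover have "the_elem (F ` (r \<odot>\<^bsub>quot_module M N\<^esub> c)) = r \<odot>\<^bsub>P\<^esub> the_elem (F ` c)"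
    if r: "r \<in> carrier R" and c: "c \<in> carrier (quot_module M N)" for r c
  proof -
    obtain x where "x \<in> carrier M" "c = N +>\<^bsub>M\<^esub> x"
      using c by (auto simp: quot_module_def A_RCOSETS_def')
    then show ?thesis
      using r by (simp add: smult elem lin_hom_smult[OF F])
  qed
  ultimately have "(\<lambda>c. the_elem (F ` c)) \<in> module_iso R (quot_module M N) P"
    by (simp add: module_iso_def iso_def hom_def eq)
  then show "\<exists>\<phi>. \<phi> \<in> module_iso R (quot_module M N) P"
    by blast
qed


section \<open>Diagonalising the quotient by a cyclic submodule\<close>

text \<open>The quotient of \<open>R\<^sub>\<lambda>\<^sub>'\<close> by the cyclic submodule generated by the element with coordinates
  \<open>\<pi>\<close> to the power \<open>s j\<close> is diagonalised by the differences \<open>chain_diff\<close> of consecutive coordinates: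
  the \<open>j\<close>-th one is well-defined exactly modulo \<open>\<pi>\<close> to the power \<open>chain_exp\<close>. The last exponent can
  be \<open>0\<close>, and then this summand is dropped.\<close>

definition next_in :: "nat set \<Rightarrow> nat \<Rightarrow> nat" where
  "next_in A j = Min {p \<in> A. j < p}"

definition chain_diff :: "nat set \<Rightarrow> (nat \<Rightarrow> nat) \<Rightarrow> (nat \<Rightarrow> 'a) \<Rightarrow> nat \<Rightarrow> 'a" where
  "chain_diff A s V j =
     (if \<exists>p\<in>A. j < p then V j \<ominus> \<pi> [^] (s j - s (next_in A j)) \<otimes> V (next_in A j) else V j)"

definition chain_exp :: "nat set \<Rightarrow> (nat \<Rightarrow> nat) \<Rightarrow> (nat \<Rightarrow> nat) \<Rightarrow> nat \<Rightarrow> nat" where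
  "chain_exp A s lam j =
     (if \<exists>p\<in>A. j < p then lam (next_in A j) - s (next_in A j) + s j else s j)"

lemma next_in_mem:
  assumes "finite A" "\<exists>p\<in>A. j < p"
  shows "next_in A j \<in> A" "j < next_in A j"
proof -
  have "next_in A j \<in> {p \<in> A. j < p}"
    unfolding next_in_def using assms by (intro Min_in) auto
  then show "next_in A j \<in> A" "j < next_in A j"
    by auto
qed

text \<open>A new least index changes no successor of the old indices. Hence the inductions along
  the chain run from the largest index downwards.\<close>

lemma chain_insert:
  assumes "\<forall>p\<in>A. b < p" "j \<in> A"
  shows "chain_exp (insert b A) s lam j = chain_exp A s lam j"
    and "next_in (insert b A) j = next_in A j"
    and "chain_diff (insert b A) s V j = chain_diff A s V j"
proof -
  have "{p \<in> insert b A. j < p} = {p \<in> A. j < p}" "\<not> j < b"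
    using assms by force+
  then show "chain_exp (insert b A) s lam j = chain_exp A s lam j"
    "next_in (insert b A) j = next_in A j"
    "chain_diff (insert b A) s V j = chain_diff A s V j"
    by (simp_all add: chain_exp_def chain_diff_def next_in_def)
qed

lemma next_in_insert:
  assumes "\<forall>p\<in>A. b < p"
  shows "next_in (insert b A) b = Min A"
proof -
  have "{p \<in> insert b A. b < p} = A"
    using assms by auto
  then show ?thesis
    by (simp add: next_in_def)
qed

lemma chain_diff_cong:
  assumes "finite A" "j \<in> A" "\<And>p. p \<in> A \<Longrightarrow> V p = W p"
  shows "chain_diff A s V j = chain_diff A s W j"
  using assms next_in_mem[of A j] by (auto simp: chain_diff_def)

text \<open>The system is triangular: the value at an index is determined by its difference and the
  value already found at the next index.\<close>

lemma chain_diff_surj: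
  assumes "finite A" and W: "\<And>j. W j \<in> carrier R"
  shows "\<exists>V. (\<forall>j. V j \<in> carrier R) \<and> (\<forall>j\<in>A. chain_diff A s V j = W j)"
  using assms(1)
proof (induction A rule: finite_linorder_min_induct)
  case empty
  show ?case
    using W by blast
next
  case (insert b A)
  then obtain V where V: "\<And>j. V j \<in> carrier R" "\<And>j. j \<in> A \<Longrightarrow> chain_diff A s V j = W j"
    by blast
  have b: "\<forall>p\<in>A. b < p" "b \<notin> A"
    using insert by auto
  define c where "c = (if A = {} then \<zero> else \<pi> [^] (s b - s (Min A)) \<otimes> V (Min A))"
  have c: "c \<in> carrier R"
    using V by (simp add: c_def)
  let ?V = "V(b := W b \<oplus> c)"
  have "chain_diff (insert b A) s ?V j = W j" if "j \<in> A" for j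
  proof -
    have "chain_diff A s ?V j = chain_diff A s V j"
      using that b insert(1) by (intro chain_diff_cong) auto
    then show ?thesis
      using that b V by (simp add: chain_insert)
  qed
  moreover have "chain_diff (insert b A) s ?V b = W b"
  proof (cases "A = {}")
    case True
    then show ?thesis
      using W by (simp add: chain_diff_def c_def)
  next
    case False
    then have "Min A \<in> A"
      using insert by simp
    then have "chain_diff (insert b A) s ?V b = (W b \<oplus> c) \<ominus> c"
      using b False by (auto simp: chain_diff_def next_in_insert[OF b(1)] c_def)
    also have "\<dots> = W b"
      using W[of b] c by algebra
    finally show ?thesis .
  qed
  moreover have "?V j \<in> carrier R" for j
    using V W c by simp
  ultimately show ?case
    by blast
qed

text \<open>A common multiplier c is found from the largest index downwards. A new index b can be
  accommodated by changing c by multiples of \<pi> to the power \<open>lam p - s p\<close>, where p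
  is the next index, and the antichain inequalities make such a change invisible at all larger
  indices.\<close>

lemma chain_diff_kernel:
  assumes "finite A" and V: "\<And>j. V j \<in> carrier R"
    and "\<And>j. j \<in> A \<Longrightarrow> s j \<le> lam j"
    and "\<And>j p. j \<in> A \<Longrightarrow> p \<in> A \<Longrightarrow> j < p \<Longrightarrow> s p \<le> s j \<and> lam p + s j \<le> lam j + s p"
    and "\<And>j. j \<in> A \<Longrightarrow> \<pi> [^] chain_exp A s lam j divides chain_diff A s V j"
  shows "\<exists>c\<in>carrier R. \<forall>j\<in>A. \<pi> [^] lam j divides (V j \<ominus> c \<otimes> \<pi> [^] s j)"
  using assms(1,3-5)
proof (induction A rule: finite_linorder_min_induct)
  case empty
  show ?case
    by blast
next
  case (insert b A)
  have b: "\<forall>p\<in>A. b < p" "b \<notin> A"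
    using insert by auto
  have "\<pi> [^] chain_exp A s lam j divides chain_diff A s V j" if "j \<in> A" for j
    using insert.prems(3)[of j] that by (simp add: chain_insert[OF b(1)])
  then have "\<exists>c\<in>carrier R. \<forall>j\<in>A. \<pi> [^] lam j divides (V j \<ominus> c \<otimes> \<pi> [^] s j)"
    using insert.IH insert.prems(1,2) by auto
  then obtain c where c: "c \<in> carrier R" "\<And>j. j \<in> A \<Longrightarrow> \<pi> [^] lam j divides (V j \<ominus> c \<otimes> \<pi> [^] s j)"
    by blast
  have dvd: "\<pi> [^] chain_exp (insert b A) s lam b divides chain_diff (insert b A) s V b"
    using insert.prems by blast
  show ?case
  proof (cases "A = {}")
    case True
    then have "\<pi> [^] s b divides V b"
      using dvd by (simp add: chain_diff_def chain_exp_def)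
    then obtain d where d: "d \<in> carrier R" "V b = \<pi> [^] s b \<otimes> d"
      by (auto simp: factor_def)
    then have "V b \<ominus> d \<otimes> \<pi> [^] s b = \<zero>"
      by (simp add: m_comm minus_eq r_neg)
    then show ?thesis
      using d(1) True by (intro bexI[of _ d]) simp_all
  next
    case False
    define p where "p = Min A"
    have p: "p \<in> A" "b < p" "\<And>j. j \<in> A \<Longrightarrow> p \<le> j"
      using insert(1) False b by (auto simp: p_def)
    have anti: "s p \<le> s b" "lam p + s b \<le> lam b + s p" "s p \<le> lam p"
      using insert.prems p by auto
    define \<alpha> \<beta> \<gamma> where "\<alpha> = \<pi> [^] (s b - s p)" and "\<beta> = \<pi> [^] s p" and "\<gamma> = \<pi> [^] (lam p - s p)"
    have [simp]: "\<alpha> \<in> carrier R" "\<beta> \<in> carrier R" "\<gamma> \<in> carrier R"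
      by (simp_all add: \<alpha>_def \<beta>_def \<gamma>_def)
    have sb: "\<pi> [^] s b = \<alpha> \<otimes> \<beta>" and lp: "\<pi> [^] lam p = \<beta> \<otimes> \<gamma>"
      using anti by (simp_all add: \<alpha>_def \<beta>_def \<gamma>_def nat_pow_mult)
    have "\<pi> [^] (lam p - s p + s b) = \<gamma> \<otimes> (\<alpha> \<otimes> \<beta>)"
      unfolding sb[symmetric] \<gamma>_def by (simp add: nat_pow_mult)
    moreover have "chain_exp (insert b A) s lam b = lam p - s p + s b"
      "chain_diff (insert b A) s V b = V b \<ominus> \<alpha> \<otimes> V p"
      using p b by (auto simp: chain_exp_def chain_diff_def next_in_insert[OF b(1)] p_def[symmetric] \<alpha>_def)
    ultimately have "\<gamma> \<otimes> (\<alpha> \<otimes> \<beta>) divides (V b \<ominus> \<alpha> \<otimes> V p)"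
      using dvd by simp
    then obtain w where w: "w \<in> carrier R" "V b \<ominus> \<alpha> \<otimes> V p = (\<gamma> \<otimes> (\<alpha> \<otimes> \<beta>)) \<otimes> w"
      by (auto simp: factor_def)
    obtain z where z: "z \<in> carrier R" "V p \<ominus> c \<otimes> \<beta> = (\<beta> \<otimes> \<gamma>) \<otimes> z"
      using c(2)[OF p(1)] by (auto simp: factor_def lp \<beta>_def[symmetric])
    have Vb: "V b = \<alpha> \<otimes> V p \<oplus> (V b \<ominus> \<alpha> \<otimes> V p)" and Vp: "V p = c \<otimes> \<beta> \<oplus> (V p \<ominus> c \<otimes> \<beta>)"
      using V[of b] V[of p] c(1) \<open>\<alpha> \<in> carrier R\<close> \<open>\<beta> \<in> carrier R\<close> by algebra+
    \<comment> \<open>Here z is the error of c at p and w that of the difference at b. Inserting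
      both into \<open>V b\<close> produces the factor
      \<open>c \<oplus> \<gamma> \<otimes> (z \<oplus> w)\<close> exactly.\<close>
    define c' where "c' = c \<oplus> \<gamma> \<otimes> (z \<oplus> w)"
    have c': "c' \<in> carrier R"
      using c z w by (simp add: c'_def)
    have "V b = \<alpha> \<otimes> (c \<otimes> \<beta> \<oplus> (\<beta> \<otimes> \<gamma>) \<otimes> z) \<oplus> (\<gamma> \<otimes> (\<alpha> \<otimes> \<beta>)) \<otimes> w"
      using Vb Vp w z by simp
    also have "\<dots> = c' \<otimes> (\<alpha> \<otimes> \<beta>)"
      unfolding c'_def using c(1) z(1) w(1) \<open>\<alpha> \<in> carrier R\<close> \<open>\<beta> \<in> carrier R\<close> \<open>\<gamma> \<in> carrier R\<close>
      by algebra
    finally have "V b \<ominus> c' \<otimes> \<pi> [^] s b = \<zero>"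
      using c' by (simp add: sb minus_eq r_neg)
    moreover have "\<pi> [^] lam j divides (V j \<ominus> c' \<otimes> \<pi> [^] s j)" if j: "j \<in> A" for j
    proof -
      have "p = j \<or> p < j"
        using p(3)[OF j] by auto
      then have "lam j \<le> (lam p - s p) + s j"
        using insert.prems(2)[of p j] j p(1) anti(3) by auto
      then have "\<pi> [^] lam j divides \<gamma> \<otimes> \<pi> [^] s j"
        by (simp add: \<gamma>_def nat_pow_mult pow_dvd_pow)
      then have "\<pi> [^] lam j divides (z \<oplus> w) \<otimes> (\<gamma> \<otimes> \<pi> [^] s j)"
        using z w by (intro dvd_mult_left[of _ "z \<oplus> w"]) auto
      then have "\<pi> [^] lam j divides ((V j \<ominus> c \<otimes> \<pi> [^] s j) \<ominus> (z \<oplus> w) \<otimes> (\<gamma> \<otimes> \<pi> [^] s j))"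
        using z w c(2)[OF j] V c(1) by (simp add: dvd_diff)
      also have "(V j \<ominus> c \<otimes> \<pi> [^] s j) \<ominus> (z \<oplus> w) \<otimes> (\<gamma> \<otimes> \<pi> [^] s j) = V j \<ominus> c' \<otimes> \<pi> [^] s j"
        unfolding c'_def using V[of j] c(1) z(1) w(1) \<open>\<gamma> \<in> carrier R\<close> uniformizer_pow_closed[of "s j"]
        by algebra
      finally show ?thesis .
    qed
    ultimately show ?thesis
      using c' by (intro bexI[of _ c']) auto
  qed
qed

text \<open>The homomorphism theorem for the map given by the chain differences. On a multiple of
  the generator all proper differences cancel, and the last coordinate is a multiple of \<pi> to its
  own exponent; conversely \<open>chain_diff_kernel\<close> recovers the multiplier.\<close>

lemma quot_cyclic_decomposition:
  assumes fin: "finite S" and lam: "\<And>j. j \<in> S \<Longrightarrow> s j < lam j"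
    and anti: "\<And>j p. j \<in> S \<Longrightarrow> p \<in> S \<Longrightarrow> j < p \<Longrightarrow> s p < s j \<and> lam p + s j < lam j + s p"
    and E: "E \<in> lifts" "\<And>j. j \<in> S \<Longrightarrow> E (j, 1) = \<pi> [^] s j"
    and N: "N = cyclic_submodule R (mod_first R \<pi> lam S)
              (residues (idx_first S) (\<lambda>(i, c). lam i) E)"
  shows "\<exists>T \<mu> \<phi>. is_decomposition R \<pi> (quot_module (mod_first R \<pi> lam S) N) T \<mu> \<phi>"
    and "(\<lambda>x. N +>\<^bsub>mod_first R \<pi> lam S\<^esub> x) \<in>
           lin_hom R (mod_first R \<pi> lam S) (quot_module (mod_first R \<pi> lam S) N)"
proof -
  let ?T = "idx_first S" and ?l = "\<lambda>(i::nat, c::nat). lam i"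
  let ?M = "csum ?T ?l"
  define T where "T = {j \<in> S. 0 < chain_exp S s lam j} \<times> {1::nat}"
  define \<mu> where "\<mu> = (\<lambda>(j, c::nat). chain_exp S s lam j)"
  define \<Phi> where "\<Phi> = (\<lambda>(V :: nat \<times> nat \<Rightarrow> 'a) (j, c::nat). chain_diff S s (\<lambda>j. V (j, 1)) j)"
  have \<Phi>_closed: "\<Phi> V \<in> lifts" if "V \<in> lifts" for V
    using that by (auto simp: \<Phi>_def chain_diff_def)
  have T_S: "T \<subseteq> S \<times> {1}"
    by (auto simp: T_def)
  have nxt: "next_in S j \<in> S" "s (next_in S j) < s j"
    "lam (next_in S j) + s j < lam j + s (next_in S j)" "s (next_in S j) < lam (next_in S j)"
    if "j \<in> S" "\<exists>p\<in>S. j < p" for j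
    using next_in_mem[OF fin that(2)] anti[of j "next_in S j"] lam that by auto
  obtain F where F: "F \<in> lin_hom R ?M (csum T \<mu>)"
    "\<And>V. V \<in> lifts \<Longrightarrow> F (residues ?T ?l V) = residues T \<mu> (\<Phi> V)"
  proof (rule lin_hom_of_lifts[of \<Phi> T ?T ?l \<mu>])
    show "\<Phi> (\<lambda>t. V t \<oplus> W t) t = \<Phi> V t \<oplus> \<Phi> W t" if "V \<in> lifts" "W \<in> lifts" for V W t
    proof (cases t)
      case (Pair j c)
      define p \<alpha> where "p = next_in S j" and "\<alpha> = \<pi> [^] (s j - s p)"
      have "V (j, 1) \<in> carrier R" "W (j, 1) \<in> carrier R" "V (p, 1) \<in> carrier R" "W (p, 1) \<in> carrier R"
        "\<alpha> \<in> carrier R"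
        using that by (auto simp: \<alpha>_def)
      then have "V (j, 1) \<oplus> W (j, 1) \<ominus> \<alpha> \<otimes> (V (p, 1) \<oplus> W (p, 1)) =
          (V (j, 1) \<ominus> \<alpha> \<otimes> V (p, 1)) \<oplus> (W (j, 1) \<ominus> \<alpha> \<otimes> W (p, 1))"
        by algebra
      then show ?thesis
        by (simp add: Pair \<Phi>_def chain_diff_def flip: p_def \<alpha>_def)
    qed
    show "\<Phi> (\<lambda>t. a \<otimes> V t) t = a \<otimes> \<Phi> V t" if "a \<in> carrier R" "V \<in> lifts" for a V t
    proof (cases t)
      case (Pair j c)
      define p \<alpha> where "p = next_in S j" and "\<alpha> = \<pi> [^] (s j - s p)"
      have "V (j, 1) \<in> carrier R" "V (p, 1) \<in> carrier R" "\<alpha> \<in> carrier R"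
        using that by (auto simp: \<alpha>_def)
      then have "a \<otimes> V (j, 1) \<ominus> \<alpha> \<otimes> (a \<otimes> V (p, 1)) = a \<otimes> (V (j, 1) \<ominus> \<alpha> \<otimes> V (p, 1))"
        using that(1) by algebra
      then show ?thesis
        by (simp add: Pair \<Phi>_def chain_diff_def flip: p_def \<alpha>_def)
    qed
    fix V t assume V: "V \<in> lifts" and zero: "\<And>t. t \<in> ?T \<Longrightarrow> \<pi> [^] ?l t divides V t" and "t \<in> T"
    then obtain j where t: "t = (j, 1)" "j \<in> S"
      using T_S by auto
    have dvd: "\<pi> [^] lam p divides V (p, 1)" if "p \<in> S" for p
      using zero[of "(p, 1)"] that by (simp add: idx_first_def)
    show "\<pi> [^] \<mu> t divides \<Phi> V t"
    proof (cases "\<exists>p\<in>S. j < p")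
      case True
      define p where "p = next_in S j"
      have p: "p \<in> S" "s p < s j" "lam p + s j < lam j + s p" "s p < lam p"
        using nxt[OF t(2) True] by (simp_all add: p_def)
      \<comment> \<open>The antichain inequality puts this exponent below \<open>lam j\<close>, and
        the factor with exponent \<open>s j - s p\<close> raises \<open>lam p\<close> to exactly
        this exponent.\<close>
      have "\<pi> [^] (lam p - s p + s j) divides (V (j, 1) \<ominus> \<pi> [^] (s j - s p) \<otimes> V (p, 1))"
        using V p by (intro dvd_diff[OF _ _ _ pow_dvd_le[OF _ _ dvd[OF t(2)]] pow_dvd_mult[OF _ dvd[OF p(1)]]]) auto
      then show ?thesis
        using True by (simp add: t \<mu>_def \<Phi>_def chain_exp_def chain_diff_def p_def)
    next
      case False
      have "\<pi> [^] s j divides V (j, 1)"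
        using V lam[OF t(2)] by (intro pow_dvd_le[OF _ _ dvd[OF t(2)]]) auto
      then show ?thesis
        using False by (simp add: t \<mu>_def \<Phi>_def chain_exp_def chain_diff_def)
    qed
  qed (use \<Phi>_closed in auto)
  have surj: "F ` carrier ?M = carrier (csum T \<mu>)"
  proof
    show "F ` carrier ?M \<subseteq> carrier (csum T \<mu>)"
      using lin_hom_closed[OF F(1)] by auto
    show "carrier (csum T \<mu>) \<subseteq> F ` carrier ?M"
    proof
      fix x assume x: "x \<in> carrier (csum T \<mu>)"
      obtain W where W: "W \<in> lifts" "x = residues T \<mu> W"
        by (rule residues_surj[OF x])
      then obtain V where V: "\<And>j. V j \<in> carrier R" "\<And>j. j \<in> S \<Longrightarrow> chain_diff S s V j = W (j, 1)"
        using chain_diff_surj[OF fin, of "\<lambda>j. W (j, 1)" s] by auto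
      let ?V = "\<lambda>(j, c::nat). V j"
      have "?V \<in> lifts"
        using V by auto
      moreover from this have "F (residues ?T ?l ?V) = x"
        using V(2) T_S by (auto simp: F(2) W(2) \<Phi>_def intro!: residues_cong)
      ultimately show "x \<in> F ` carrier ?M"
        using residues_closed by blast
    qed
  qed
  have M: "mod_first R \<pi> lam S = ?M"
    by (simp add: mod_first_def)
  have "N = {x \<in> carrier ?M. F x = \<zero>\<^bsub>csum T \<mu>\<^esub>}"
  proof
    show "N \<subseteq> {x \<in> carrier ?M. F x = \<zero>\<^bsub>csum T \<mu>\<^esub>}"
    proof
      fix x assume "x \<in> N"
      then obtain a where a: "a \<in> carrier R" and x: "x = residues ?T ?l (\<lambda>t. a \<otimes> E t)"
        using E by (auto simp: N M cyclic_submodule_def residues_smult)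
      have aE: "(\<lambda>t. a \<otimes> E t) \<in> lifts"
        using a E by auto
      have "\<pi> [^] \<mu> t divides \<Phi> (\<lambda>t. a \<otimes> E t) t" if t: "t \<in> T" for t
      proof -
        obtain j where t: "t = (j, 1)" "j \<in> S"
          using t T_S by auto
        show ?thesis
        proof (cases "\<exists>p\<in>S. j < p")
          case True
          define p where "p = next_in S j"
          have p: "p \<in> S" "s p < s j"
            using nxt[OF t(2) True] by (simp_all add: p_def)
          have "\<pi> [^] (s j - s p) \<otimes> (a \<otimes> \<pi> [^] s p) = a \<otimes> \<pi> [^] s j"
            using a p by (simp add: m_lcomm nat_pow_mult)
          then have "\<Phi> (\<lambda>t. a \<otimes> E t) t = \<zero>"
            using True a p E(2) t by (simp add: \<Phi>_def chain_diff_def minus_eq r_neg flip: p_def)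
          then show ?thesis
            by simp
        next
          case False
          then show ?thesis
            using a E(2) t by (auto simp: \<mu>_def \<Phi>_def chain_exp_def chain_diff_def intro!: dvd_mult_left)
        qed
      qed
      then have "F x = \<zero>\<^bsub>csum T \<mu>\<^esub>"
        using aE \<Phi>_closed[OF aE] by (simp add: x F(2) residues_eq_zero_iff)
      then show "x \<in> {x \<in> carrier ?M. F x = \<zero>\<^bsub>csum T \<mu>\<^esub>}"
        using aE by (simp add: x)
    qed
    show "{x \<in> carrier ?M. F x = \<zero>\<^bsub>csum T \<mu>\<^esub>} \<subseteq> N"
    proof
      fix x assume x: "x \<in> {x \<in> carrier ?M. F x = \<zero>\<^bsub>csum T \<mu>\<^esub>}"
      then have "x \<in> carrier ?M"
        by simp
      then obtain V where V: "V \<in> lifts" "x = residues ?T ?l V"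
        by (rule residues_surj)
      have dvd: "\<pi> [^] \<mu> t divides \<Phi> V t" if "t \<in> T" for t
        using x V that \<Phi>_closed[of V] by (auto simp: F(2) residues_eq_zero_iff)
      have "\<pi> [^] chain_exp S s lam j divides chain_diff S s (\<lambda>j. V (j, 1)) j" if "j \<in> S" for j
      \<comment> \<open>At an index missing from T the condition is divisibility by 1, so no
        information was lost with that summand.\<close>
      proof (cases "chain_exp S s lam j = 0")
        case True
        have "chain_diff S s (\<lambda>j. V (j, 1)) j \<in> carrier R"
          using V by (simp add: chain_diff_def)
        then show ?thesis
          using True by simp
      next
        case False
        then show ?thesis
          using dvd[of "(j, 1)"] that by (simp add: T_def \<mu>_def \<Phi>_def)
      qed
      then have "\<exists>c\<in>carrier R. \<forall>j\<in>S. \<pi> [^] lam j divides (V (j, 1) \<ominus> c \<otimes> \<pi> [^] s j)"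
        using V fin lam anti by (intro chain_diff_kernel) (auto simp: less_imp_le)
      then obtain c where c: "c \<in> carrier R"
        "\<And>j. j \<in> S \<Longrightarrow> \<pi> [^] lam j divides (V (j, 1) \<ominus> c \<otimes> \<pi> [^] s j)"
        by blast
      have "(\<lambda>t. c \<otimes> E t) \<in> lifts"
        using c E by auto
      then have "x = residues ?T ?l (\<lambda>t. c \<otimes> E t)"
        using V c E(2) by (auto simp: residues_eq_iff idx_first_def)
      then have "x = c \<odot>\<^bsub>?M\<^esub> residues ?T ?l E"
        using c E by (simp add: residues_smult)
      then show "x \<in> N"
        using c(1) by (auto simp: N M cyclic_submodule_def)
    qed
  qed
  note quot = quot_module_iso[OF csum_module csum_module F(1) surj this]
  have "finite T" "\<And>t. t \<in> T \<Longrightarrow> 0 < \<mu> t"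
    using fin by (auto simp: T_def \<mu>_def)
  then show "\<exists>T \<mu> \<phi>. is_decomposition R \<pi> (quot_module (mod_first R \<pi> lam S) N) T \<mu> \<phi>"
    using quot(1) unfolding is_decomposition_def M by blast
  show "(\<lambda>x. N +>\<^bsub>mod_first R \<pi> lam S\<^esub> x) \<in>
           lin_hom R (mod_first R \<pi> lam S) (quot_module (mod_first R \<pi> lam S) N)"
    using quot(2) unfolding M .
qed

end

section \<open>Maximal elements\<close>

text \<open>Each occurring exponent contributes at most one pair, and an empty block none, its
  infimum being infinite.\<close>

lemma finite_block_vals:
  assumes "finite T"
  shows "finite (block_vals R \<pi> T \<mu> x)"
proof (rule finite_subset)
  let ?v = "\<lambda>l. INF t\<in>{t\<in>T. \<mu> t = l}. val (quot_pow R \<pi> l) (quot_proj R \<pi> l \<pi>) (x t)"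
  show "block_vals R \<pi> T \<mu> x \<subseteq> (\<lambda>l. (the_enat (?v l), l)) ` \<mu> ` T"
  proof (intro subrelI)
    fix v l assume "(v, l) \<in> block_vals R \<pi> T \<mu> x"
    then have v: "enat v = ?v l"
      by (simp add: block_vals_def)
    have "l \<in> \<mu> ` T"
    proof (rule ccontr)
      assume "l \<notin> \<mu> ` T"
      then have "{t\<in>T. \<mu> t = l} = {}"
        by auto
      with v have "enat v = \<infinity>"
        by (simp add: top_enat_def)
      then show False
        by simp
    qed
    moreover have "the_enat (?v l) = v"
      unfolding v[symmetric] by simp
    ultimately show "(v, l) \<in> (\<lambda>l. (the_enat (?v l), l)) ` \<mu> ` T"
      by (force intro: rev_image_eqI)
  qed
qed (use assms in simp)

lemma poset_le_trans: "poset_le p q \<Longrightarrow> poset_le q r \<Longrightarrow> poset_le p r"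
  by (auto simp: poset_le_def)

text \<open>On \<open>\<P>\<close> the function \<open>l - 2v\<close> is strictly monotone, so a generator above \<open>p\<close> at which it is
  largest is a maximal element.\<close>

lemma max_elem_above:
  assumes A: "finite A" and p: "p \<in> gen_ideal A"
  obtains q where "q \<in> max_elems (gen_ideal A)" "poset_le p q"
proof -
  define w :: "nat \<times> nat \<Rightarrow> int" where "w q = int (snd q) - 2 * int (fst q)" for q
  have w: "w q \<le> w q' \<and> (w q = w q' \<longrightarrow> q = q')" if "poset_le q q'" "q \<in> poset_P" for q q'
    using that by (cases q; cases q') (auto simp: poset_le_def poset_P_def w_def)
  \<comment> \<open>A positive difference at p' forces one at q, so a generator above a point of the
    poset lies in the poset itself.\<close>
  have up: "q \<in> gen_ideal A" if "q \<in> A" "poset_le p' q" "p' \<in> poset_P" for p' q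
    using that by (cases q; cases p') (auto simp: gen_ideal_def poset_le_def poset_P_def intro!: bexI[of _ q])
  let ?A = "{q \<in> A. poset_le p q}"
  have "finite (w ` ?A)" "w ` ?A \<noteq> {}"
    using A p by (auto simp: gen_ideal_def)
  then have "Max (w ` ?A) \<in> w ` ?A"
    by (rule Max_in)
  then obtain q where q: "q \<in> ?A" "w q = Max (w ` ?A)"
    by auto
  have "q \<in> gen_ideal A"
    using q(1) p up[of q p] by (auto simp: gen_ideal_def)
  moreover have "q' = q" if q': "q' \<in> gen_ideal A" "poset_le q q'" for q'
  proof -
    obtain a where a: "a \<in> A" "poset_le q' a" "q' \<in> poset_P"
      using q'(1) by (auto simp: gen_ideal_def)
    then have "a \<in> ?A"
      using q(1) q'(2) by (auto intro: poset_le_trans)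
    then have "w a \<le> w q"
      using \<open>finite (w ` ?A)\<close> q(2) by simp
    moreover have "q \<in> poset_P"
      using \<open>q \<in> gen_ideal A\<close> by (simp add: gen_ideal_def)
    ultimately show ?thesis
      using w[of q q'] w[of q' a] a q'(2) by force
  qed
  ultimately show thesis
    using q(1) by (intro that[of q]) (auto simp: max_elems_def)
qed

lemma finite_idx: "finite (idx k \<rho>)"
  by (simp add: idx_def)

lemma char_exp_mem:
  assumes "char_exp lam J K j = enat v"
  shows "(v, lam j) \<in> J \<union> K"
proof -
  have "\<not> enat (Suc v) \<le> char_exp lam J K j"
    using assms by simp
  then obtain w where w: "(w, lam j) \<in> J \<union> K" "w \<le> v"
    unfolding char_exp_def le_INF_iff by (auto simp: not_less_eq_eq)
  have "char_exp lam J K j \<le> enat w"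
    unfolding char_exp_def using w by (intro INF_lower) auto
  then have "w = v"
    using assms w(2) by simp
  then show ?thesis
    using w(1) by simp
qed

section \<open>The canonical form and the ideals J and K\<close>

context discrete_valuation_ring
begin

abbreviation exps :: "(nat \<Rightarrow> nat) \<Rightarrow> nat \<times> nat \<Rightarrow> nat" where
  "exps lam \<equiv> (\<lambda>(i, c). lam i)"

definition canonical_lift :: "nat set \<Rightarrow> (nat \<Rightarrow> nat) \<Rightarrow> nat \<times> nat \<Rightarrow> 'a" where
  "canonical_lift S s = (\<lambda>(i, c). if i \<in> S \<and> c = 1 then \<pi> [^] s i else \<zero>)"

lemma canonical_lift_lifts [simp]: "canonical_lift S s \<in> lifts"
  by (auto simp: canonical_lift_def)

lemma canonical_form_eq: "canonical_form R \<pi> k lam \<rho> S s = residues (idx k \<rho>) (exps lam) (canonical_lift S s)"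
  by (auto simp: canonical_form_def residues_def canonical_lift_def restrict_def fun_eq_iff)

lemma decomposition_parts:
  assumes type: "is_type k lam \<rho>"
  shows "\<exists>T \<mu> \<phi>. is_decomposition R \<pi> (mod_full R \<pi> k lam \<rho>) T \<mu> \<phi>"
    and "\<exists>T \<mu> \<phi>. is_decomposition R \<pi> (mod_rest R \<pi> k lam \<rho> S) T \<mu> \<phi>"
proof -
  have pos: "0 < exps lam t" if "t \<in> idx k \<rho>" for t
    using type that by (force simp: is_type_def idx_def)
  show "\<exists>T \<mu> \<phi>. is_decomposition R \<pi> (mod_full R \<pi> k lam \<rho>) T \<mu> \<phi>"
    unfolding mod_full_def using is_decomposition_csum[OF finite_idx, of k \<rho> "exps lam"] pos by blast
  have "finite (idx_rest k \<rho> S)"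
    by (simp add: idx_rest_def finite_idx)
  then show "\<exists>T \<mu> \<phi>. is_decomposition R \<pi> (mod_rest R \<pi> k lam \<rho> S) T \<mu> \<phi>"
    unfolding mod_rest_def using is_decomposition_csum[of "idx_rest k \<rho> S" "exps lam"] pos
    by (auto simp: idx_rest_def)
qed

text \<open>In a general order ideal of the poset, for instance the whole poset, there need not be
  maximal elements above a point. The ideal of an element has finitely many generators, and this
  suffices.\<close>

lemma ideal_le_max:
  assumes type: "is_type k lam \<rho>" and m: "I = elem_ideal R \<pi> (mod_full R \<pi> k lam \<rho>) m"
    and p: "p \<in> I"
  obtains q where "q \<in> max_elems I" "poset_le p q"
proof -
  obtain T \<mu> \<phi> where "is_decomposition R \<pi> (mod_full R \<pi> k lam \<rho>) T \<mu> \<phi>"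
    "\<forall>e. elem_ideal R \<pi> (mod_full R \<pi> k lam \<rho>) e = gen_ideal (block_vals R \<pi> T \<mu> (\<phi> e))"
    by (rule elem_ideal_eq_gen_ideal[OF decomposition_parts(1)[OF type]])
  then show thesis
    using p max_elem_above[of "block_vals R \<pi> T \<mu> (\<phi> m)" p] that
    by (auto simp: m is_decomposition_def finite_block_vals)
qed

text \<open>For j < p the exponent at p is smaller. So \<open>s p \<ge> s j\<close> would also make
  \<open>lam p - s p\<close> the smaller difference and put p below j. Once \<open>s p < s j\<close>
  is known, the failure of the opposite comparison is the second inequality.\<close>

lemma max_elems_antichain:
  assumes type: "is_type k lam \<rho>" and S: "S \<subseteq> {1..k}" and I: "I \<subseteq> poset_P"
    and max: "max_elems I = {(s j, lam j) |j. j \<in> S}"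
  shows "j \<in> S \<Longrightarrow> s j < lam j"
    and "j \<in> S \<Longrightarrow> p \<in> S \<Longrightarrow> j < p \<Longrightarrow> s p < s j \<and> lam p + s j < lam j + s p"
proof -
  show *: "s j < lam j" if "j \<in> S" for j
  proof -
    have "(s j, lam j) \<in> max_elems I"
      using that max by auto
    then show ?thesis
      using I by (auto simp: max_elems_def poset_P_def)
  qed
  assume jp: "j \<in> S" "p \<in> S" "j < p"
  then have "lam p < lam j"
    using type S by (auto simp: is_type_def monotone_on_def subset_eq)
  have "(s j, lam j) \<in> max_elems I" "(s p, lam p) \<in> max_elems I"
    using jp max by auto
  then have "\<not> poset_le (s j, lam j) (s p, lam p)" "\<not> poset_le (s p, lam p) (s j, lam j)"
    using \<open>lam p < lam j\<close> by (auto simp: max_elems_def)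
  then show "s p < s j \<and> lam p + s j < lam j + s p"
    using *[OF jp(1)] *[OF jp(2)] \<open>lam p < lam j\<close> by (auto simp: poset_le_def)
qed

lemma ideal_J_K_subset:
  assumes type: "is_type k lam \<rho>" and S: "S \<subseteq> {1..k}"
    and m: "m \<in> ideal_part_exact R \<pi> (mod_full R \<pi> k lam \<rho>) I"
    and lt: "\<And>j. j \<in> S \<Longrightarrow> s j < lam j"
    and anti: "\<And>j p. j \<in> S \<Longrightarrow> p \<in> S \<Longrightarrow> j < p \<Longrightarrow> s p < s j \<and> lam p + s j < lam j + s p"
  shows "ideal_J R \<pi> k lam \<rho> S s m \<subseteq> I" and "ideal_K R \<pi> k lam \<rho> S m \<subseteq> I"
proof -
  have I: "I = elem_ideal R \<pi> (mod_full R \<pi> k lam \<rho>) m" and mc: "m \<in> carrier (mod_full R \<pi> k lam \<rho>)"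
    using m by (auto simp: ideal_part_exact_def)
  have M: "module R (mod_full R \<pi> k lam \<rho>)"
    by (simp add: mod_full_def csum_module)
  have "idx_rest k \<rho> S \<subseteq> idx k \<rho>"
    by (auto simp: idx_rest_def)
  then have "(\<lambda>x. restrict x (idx_rest k \<rho> S)) \<in> lin_hom R (mod_full R \<pi> k lam \<rho>) (mod_rest R \<pi> k lam \<rho> S)"
    unfolding mod_full_def mod_rest_def by (rule restrict_lin_hom)
  from elem_ideal_lin_hom_subset[OF M this mc decomposition_parts[OF type]]
  show "ideal_K R \<pi> k lam \<rho> S m \<subseteq> I"
    by (simp add: I ideal_K_def)
  have "\<rho> j \<ge> 1" if "j \<in> S" for j
    using type S that by (auto simp: is_type_def)
  then have first: "idx_first S \<subseteq> idx k \<rho>"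
    using S by (fastforce simp: idx_first_def idx_def)
  then have h: "(\<lambda>x. restrict x (idx_first S)) \<in> lin_hom R (mod_full R \<pi> k lam \<rho>) (mod_first R \<pi> lam S)"
    unfolding mod_full_def mod_first_def by (rule restrict_lin_hom)
  define N where "N = cyclic_submodule R (mod_first R \<pi> lam S)
      (residues (idx_first S) (exps lam) (canonical_lift S s))"
  have "finite S"
    using S finite_subset by blast
  have "canonical_lift S s (j, 1) = \<pi> [^] s j" if "j \<in> S" for j
    using that by (simp add: canonical_lift_def)
  note quot = quot_cyclic_decomposition[OF \<open>finite S\<close> lt anti canonical_lift_lifts this N_def]
  have "(\<lambda>x. N +>\<^bsub>mod_first R \<pi> lam S\<^esub> restrict x (idx_first S)) \<in>
      lin_hom R (mod_full R \<pi> k lam \<rho>) (quot_module (mod_first R \<pi> lam S) N)"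
    by (rule lin_hom_comp[OF h quot(2)])
  from elem_ideal_lin_hom_subset[OF M this mc decomposition_parts(1)[OF type] quot(1)]
  show "ideal_J R \<pi> k lam \<rho> S s m \<subseteq> I"
    by (simp add: I ideal_J_def canonical_form_eq restrict_residues[OF first] N_def Let_def)
qed

section \<open>Automorphisms\<close>

lemma lin_hom_of_aut: "g \<in> module_aut R M \<Longrightarrow> g \<in> lin_hom R M M"
  by (simp add: module_aut_def module_iso_iff)

text \<open>The distinctness of the exponents is what makes a diagonal block invertible modulo
  \<pi>. If the column vanished modulo \<pi>, then the image of \<pi> to the power
  \<open>lam i - 1\<close> times the unit vector would have all its coordinates divisible by \<pi>
  to the power \<open>lam i\<close>, up to the modulus. The inverse of g preserves this, but the
  original vector violates it.\<close>

lemma aut_unit_vector: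
  assumes type: "is_type k lam \<rho>" and i: "i \<in> {1..k}"
    and g: "g \<in> module_aut R (csum (idx k \<rho>) (exps lam))"
    and Z: "Z \<in> lifts" "g (residues (idx k \<rho>) (exps lam) (single (i, 1) \<one>)) = residues (idx k \<rho>) (exps lam) Z"
  obtains c where "c \<in> {1..\<rho> i}" "\<not> \<pi> divides Z (i, c)"
proof (rule ccontr)
  let ?T = "idx k \<rho>" and ?l = "exps lam"
  let ?n = "lam i - 1"
  assume "\<not> thesis"
  with that have dvd: "\<pi> divides Z (i, c)" if "c \<in> {1..\<rho> i}" for c
    using \<open>c \<in> {1..\<rho> i}\<close> by blast
  note lin = lin_hom_of_aut[OF g]
  have lam_i: "0 < lam i" and one: "(i, 1) \<in> ?T"
    using type i by (force simp: is_type_def idx_def)+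
  have lin': "inv_into (carrier (csum ?T ?l)) g \<in> lin_hom R (csum ?T ?l) (csum ?T ?l)"
    using g by (intro lin_hom_inv_into csum_module) (simp add: module_aut_def)
  obtain W where W: "W \<in> lifts" "g (residues ?T ?l (single (i, 1) (\<pi> [^] ?n))) = residues ?T ?l W"
    by (rule residues_surj[OF lin_hom_closed[OF lin residues_closed[OF single_lifts[OF uniformizer_pow_closed]]]])
  have W_dvd: "\<pi> [^] (min (lam i) (?l t)) divides W t" if t: "t \<in> ?T" for t
  proof -
    obtain j c where jc: "t = (j, c)" "j \<in> {1..k}" "c \<in> {1..\<rho> j}"
      using t by (auto simp: idx_def)
    have mem: "\<pi> [^] (min n (lam j)) divides W t"
      if "n \<le> ?n \<or> min n (lam j) + lam i \<le> lam j + ?n" for n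
      using lin_hom_single_mem_multiples[OF lin t, of "\<pi> [^] ?n" ?n n "(i, 1)"] that W t
      by (simp add: jc(1) quot_proj_mem_multiples_iff)
    have anti: "a < b \<Longrightarrow> lam b < lam a" if "a \<in> {1..k}" "b \<in> {1..k}" for a b
      using type that by (auto simp: is_type_def monotone_on_def)
    consider "j < i" | "j = i" | "i < j"
      by linarith
    then show ?thesis
    proof cases
      case 1
      \<comment> \<open>Passing from block i to a longer block gains a factor \<pi> to the power
        \<open>lam j - lam i\<close>, which is at least one factor \<pi>.\<close>
      then have "lam i < lam j"
        using anti jc i by auto
      then have "\<pi> [^] (min (lam i) (lam j)) divides W t"
        using lam_i by (intro mem) auto
      then show ?thesis
        by (simp add: jc(1))
    next
      case 2
      have "single (i, 1) (\<pi> [^] ?n) = (\<lambda>u. \<pi> [^] ?n \<otimes> single (i, 1) \<one> u)"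
        by (auto simp: single_def fun_eq_iff)
      then have "residues ?T ?l W = residues ?T ?l (\<lambda>u. \<pi> [^] ?n \<otimes> Z u)"
        using W Z lin_hom_smult[OF lin, of "\<pi> [^] ?n" "residues ?T ?l (single (i, 1) \<one>)"]
        by (simp add: residues_smult)
      then have "\<pi> [^] lam i divides (W t \<ominus> \<pi> [^] ?n \<otimes> Z t)"
        using W Z t 2 by (auto simp: residues_eq_iff jc(1))
      moreover have "\<pi> [^] lam i divides \<pi> [^] ?n \<otimes> Z t"
        using dvd jc 2 Z lam_i by (intro pow_dvd_mult[of "Z t" 1]) auto
      moreover have "W t = (W t \<ominus> \<pi> [^] ?n \<otimes> Z t) \<oplus> \<pi> [^] ?n \<otimes> Z t"
        using lifts_closed[OF W(1), of t] lifts_closed[OF Z(1), of t] uniformizer_pow_closed[of ?n] by algebra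
      ultimately have "\<pi> [^] lam i divides W t"
        using W Z dvd_add[of "\<pi> [^] lam i" "W t \<ominus> \<pi> [^] ?n \<otimes> Z t" "\<pi> [^] ?n \<otimes> Z t"] by simp
      then show ?thesis
        using 2 by (simp add: jc(1))
    next
      case 3
      \<comment> \<open>Now \<open>lam i - 1\<close> is at least \<open>lam j\<close>, so these
        coordinates of the image are zero.\<close>
      then have "lam j < lam i"
        using anti jc i by auto
      moreover from this have "\<pi> [^] (min ?n (lam j)) divides W t"
        by (intro mem) auto
      ultimately show ?thesis
        by (simp add: jc(1) min_absorb2)
    qed
  qed
  have "inv_into (carrier (csum ?T ?l)) g (residues ?T ?l W) (i, 1) \<in> multiples (?l (i, 1)) (lam i)"
  proof (rule lin_hom_mem_multiples[OF lin' one finite_idx W(1)])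
    fix t assume "t \<in> ?T"
    then show "\<exists>m. \<pi> [^] m divides W t \<and>
        (lam i \<le> m \<or> min (lam i) (?l (i, 1)) + ?l t \<le> ?l (i, 1) + m)"
      using W_dvd by (intro exI[of _ "min (lam i) (?l t)"]) auto
  qed
  moreover have "inv_into (carrier (csum ?T ?l)) g (residues ?T ?l W) = residues ?T ?l (single (i, 1) (\<pi> [^] ?n))"
    using g unfolding W(2)[symmetric]
    by (intro inv_into_f_f) (auto simp: module_aut_def module_iso_iff bij_betw_def)
  ultimately have "\<pi> [^] lam i divides \<pi> [^] ?n \<otimes> \<one>"
    using one by (simp add: quot_proj_mem_multiples_iff single_def)
  then have "lam i \<le> ?n"
    by (intro pow_dvd_unit_mult[of \<one>]) auto
  then show False
    using lam_i by simp
qed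

text \<open>The coordinates t and u lie outside block i, so the map does not alter what it reads,
  and negating the coefficients inverts it. The bounds on a and b say that the two multiplications
  descend to the quotients.\<close>

lemma shear_automorphism:
  assumes A: "\<And>c. A c \<in> carrier R" and B: "\<And>c. B c \<in> carrier R"
    and t: "t \<in> T" "fst t \<noteq> i" and u: "u \<in> T" "fst u \<noteq> i"
    and le: "\<And>c. (i, c) \<in> T \<Longrightarrow> \<mu> (i, c) \<le> a + \<mu> t" "\<And>c. (i, c) \<in> T \<Longrightarrow> \<mu> (i, c) \<le> b + \<mu> u"
  obtains g where "g \<in> module_aut R (csum T \<mu>)"
    "\<And>V. V \<in> lifts \<Longrightarrow> g (residues T \<mu> V) = residues T \<mu>
       (\<lambda>(j, c). if j = i then V (j, c) \<oplus> (A c \<otimes> (\<pi> [^] a \<otimes> V t) \<oplus> B c \<otimes> (\<pi> [^] b \<otimes> V u)) else V (j, c))"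
proof -
  \<comment> \<open>The coefficients are kept as arguments because the inverse is the same map with
    other coefficients.\<close>
  define \<Phi> where "\<Phi> A B V = (\<lambda>(j, c). if j = i
      then V (j, c) \<oplus> (A c \<otimes> (\<pi> [^] a \<otimes> V t) \<oplus> B c \<otimes> (\<pi> [^] b \<otimes> V u)) else V (j, c))"
    for A B :: "nat \<Rightarrow> 'a" and V :: "nat \<times> nat \<Rightarrow> 'a"
  have closed: "\<Phi> A B V \<in> lifts"
    if "\<And>c. A c \<in> carrier R" "\<And>c. B c \<in> carrier R" "V \<in> lifts" for A B V
    using that by (auto simp: \<Phi>_def)
  have ex: "\<exists>g. g \<in> lin_hom R (csum T \<mu>) (csum T \<mu>) \<and>
      (\<forall>V\<in>lifts. g (residues T \<mu> V) = residues T \<mu> (\<Phi> A B V))"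
    if A: "\<And>c. A c \<in> carrier R" and B: "\<And>c. B c \<in> carrier R" for A B
  proof (rule lin_hom_of_lifts[of "\<Phi> A B" T T \<mu> \<mu>])
    have *: "\<pi> [^] a \<in> carrier R" "\<pi> [^] b \<in> carrier R"
      by auto
    show "\<Phi> A B (\<lambda>t. V t \<oplus> W t) v = \<Phi> A B V v \<oplus> \<Phi> A B W v" if "V \<in> lifts" "W \<in> lifts" for V W v
    proof (cases v)
      case (Pair j c)
      have "(x \<oplus> x') \<oplus> (A c \<otimes> (\<pi> [^] a \<otimes> (y \<oplus> y')) \<oplus> B c \<otimes> (\<pi> [^] b \<otimes> (z \<oplus> z'))) =
          (x \<oplus> (A c \<otimes> (\<pi> [^] a \<otimes> y) \<oplus> B c \<otimes> (\<pi> [^] b \<otimes> z))) \<oplus>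
          (x' \<oplus> (A c \<otimes> (\<pi> [^] a \<otimes> y') \<oplus> B c \<otimes> (\<pi> [^] b \<otimes> z')))"
        if "x \<in> carrier R" "x' \<in> carrier R" "y \<in> carrier R" "y' \<in> carrier R" "z \<in> carrier R" "z' \<in> carrier R"
        for x x' y y' z z'
        using that A[of c] B[of c] * by algebra
      then show ?thesis
        using that by (simp add: \<Phi>_def Pair)
    qed
    show "\<Phi> A B (\<lambda>t. d \<otimes> V t) v = d \<otimes> \<Phi> A B V v" if "d \<in> carrier R" "V \<in> lifts" for d V v
    proof (cases v)
      case (Pair j c)
      have "d \<otimes> x \<oplus> (A c \<otimes> (\<pi> [^] a \<otimes> (d \<otimes> y)) \<oplus> B c \<otimes> (\<pi> [^] b \<otimes> (d \<otimes> z))) =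
          d \<otimes> (x \<oplus> (A c \<otimes> (\<pi> [^] a \<otimes> y) \<oplus> B c \<otimes> (\<pi> [^] b \<otimes> z)))"
        if "x \<in> carrier R" "y \<in> carrier R" "z \<in> carrier R" for x y z
        using that A[of c] B[of c] * \<open>d \<in> carrier R\<close> by algebra
      then show ?thesis
        using that by (simp add: \<Phi>_def Pair)
    qed
    fix V v assume V: "V \<in> lifts" and dvd: "\<And>t. t \<in> T \<Longrightarrow> \<pi> [^] \<mu> t divides V t" and "v \<in> T"
    show "\<pi> [^] \<mu> v divides \<Phi> A B V v"
    proof (cases v)
      case (Pair j c)
      show ?thesis
      proof (cases "j = i")
        case True
        have "\<pi> [^] \<mu> v divides A c \<otimes> (\<pi> [^] a \<otimes> V t)"
          using V A dvd[OF t(1)] le(1)[of c] \<open>v \<in> T\<close> Pair True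
          by (intro dvd_mult_left[of _ "A c"] pow_dvd_mult[of "V t" "\<mu> t"]) auto
        moreover have "\<pi> [^] \<mu> v divides B c \<otimes> (\<pi> [^] b \<otimes> V u)"
          using V B dvd[OF u(1)] le(2)[of c] \<open>v \<in> T\<close> Pair True
          by (intro dvd_mult_left[of _ "B c"] pow_dvd_mult[of "V u" "\<mu> u"]) auto
        ultimately have "\<pi> [^] \<mu> v divides (V v \<oplus> (A c \<otimes> (\<pi> [^] a \<otimes> V t) \<oplus> B c \<otimes> (\<pi> [^] b \<otimes> V u)))"
          using V A B dvd[OF \<open>v \<in> T\<close>] by (simp add: dvd_add)
        then show ?thesis
          using True by (simp add: \<Phi>_def Pair)
      next
        case False
        then show ?thesis
          using dvd[OF \<open>v \<in> T\<close>] by (simp add: \<Phi>_def Pair)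
      qed
    qed
  qed (use A B closed in blast)+
  obtain g where g: "g \<in> lin_hom R (csum T \<mu>) (csum T \<mu>)"
    "\<And>V. V \<in> lifts \<Longrightarrow> g (residues T \<mu> V) = residues T \<mu> (\<Phi> A B V)"
    using ex[of A B] A B by auto
  obtain h where h: "h \<in> lin_hom R (csum T \<mu>) (csum T \<mu>)"
    "\<And>V. V \<in> lifts \<Longrightarrow> h (residues T \<mu> V) = residues T \<mu> (\<Phi> (\<lambda>c. \<ominus> A c) (\<lambda>c. \<ominus> B c) V)"
    using ex[of "\<lambda>c. \<ominus> A c" "\<lambda>c. \<ominus> B c"] A B by auto
  have cancel: "x \<oplus> (a' \<otimes> y \<oplus> b' \<otimes> z) \<oplus> ((\<ominus> a') \<otimes> y \<oplus> (\<ominus> b') \<otimes> z) = x"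
    "x \<oplus> ((\<ominus> a') \<otimes> y \<oplus> (\<ominus> b') \<otimes> z) \<oplus> (a' \<otimes> y \<oplus> b' \<otimes> z) = x"
    if "x \<in> carrier R" "y \<in> carrier R" "z \<in> carrier R" "a' \<in> carrier R" "b' \<in> carrier R" for x y z a' b'
    using that by algebra+
  have "h (g x) = x \<and> g (h x) = x" if x: "x \<in> carrier (csum T \<mu>)" for x
  proof -
    obtain V where V: "V \<in> lifts" "x = residues T \<mu> V"
      by (rule residues_surj[OF x])
    have "\<Phi> (\<lambda>c. \<ominus> A c) (\<lambda>c. \<ominus> B c) (\<Phi> A B V) = V" "\<Phi> A B (\<Phi> (\<lambda>c. \<ominus> A c) (\<lambda>c. \<ominus> B c) V) = V"
      using V A B t(2) u(2) by (auto simp: \<Phi>_def fun_eq_iff cancel split: prod.splits)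
    then show ?thesis
      using V A B by (simp add: g(2) h(2) closed)
  qed
  then have "bij_betw g (carrier (csum T \<mu>)) (carrier (csum T \<mu>))"
    using lin_hom_closed[OF g(1)] lin_hom_closed[OF h(1)]
    by (intro bij_betwI[of g _ _ h]) auto
  then have "g \<in> module_aut R (csum T \<mu>)"
    using g(1) by (simp add: module_aut_def module_iso_iff)
  then show thesis
    using g(2) by (intro that[of g]) (simp_all add: \<Phi>_def)
qed

end

section \<open>The components of the orbit of a pair\<close>

text \<open>Assumption \<open>r\<close> is the only trace of J and K: a finite exponent is a point
  of the poset below some maximal element of I.\<close>

locale orbit_pair = discrete_valuation_ring R \<pi> for R (structure) and \<pi> +
  fixes k :: nat and lam \<rho> s :: "nat \<Rightarrow> nat" and S :: "nat set" and r :: "nat \<Rightarrow> enat"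
    and y :: "nat \<Rightarrow> 'a" and i :: nat
  assumes type: "is_type k lam \<rho>"
    and S: "S \<subseteq> {1..k}" "S \<noteq> {}"
    and i: "i \<in> {1..k} - S"
    and y: "\<And>j. j \<in> S \<Longrightarrow> y j \<in> carrier R"
    and r: "\<And>j v. j \<in> {1..k} \<Longrightarrow> r j = enat v \<Longrightarrow>
              v < lam j \<and> (\<exists>p\<in>S. s p \<le> v \<and> lam j - v \<le> lam p - s p)"
begin

abbreviation "T \<equiv> idx k \<rho>"
abbreviation "full \<equiv> csum T (exps lam)"
abbreviation "block \<equiv> csum (idx_block \<rho> i) (exps lam)"
abbreviation "blk a \<equiv> restrict a (idx_block \<rho> i)"

section \<open>Shifts, the boundary valuation and the bound m_i\<close>

text \<open>A homomorphism from block \<open>j\<close> to block \<open>i\<close> raises valuations by at least \<open>shift j\<close>; the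
  truncated subtraction makes this \<open>0\<close> for \<open>j \<le> i\<close>.\<close>

definition shift :: "nat \<Rightarrow> nat" where
  "shift j = lam i - lam j"

text \<open>The two minima of \<open>boundary_val\<close> become one with the help of
  \<open>shift\<close>; for nonempty S the value is finite.\<close>

definition bd :: nat where
  "bd = Min ((\<lambda>j. shift j + s j) ` S)"

lemma finite_S: "finite S"
  using S finite_subset by blast

lemma lam_anti: "a \<in> {1..k} \<Longrightarrow> b \<in> {1..k} \<Longrightarrow> a < b \<Longrightarrow> lam b < lam a"
  using type by (auto simp: is_type_def monotone_on_def)

lemma shift_eq_0: "j \<in> {1..k} \<Longrightarrow> j < i \<Longrightarrow> shift j = 0"
  using lam_anti[of j i] i by (simp add: shift_def)

lemma bd_le: "j \<in> S \<Longrightarrow> bd \<le> shift j + s j"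
  unfolding bd_def using finite_S by (intro Min_le) auto

lemma bd_attained: "\<exists>l\<in>S. bd = shift l + s l"
proof -
  have "bd \<in> (\<lambda>j. shift j + s j) ` S"
    unfolding bd_def using finite_S S(2) by (intro Min_in) auto
  then show ?thesis
    by auto
qed

lemma S_cases: "j \<in> S \<Longrightarrow> j < i \<and> shift j = 0 \<or> i < j \<and> shift j = lam i - lam j"
  using i S shift_eq_0[of j] by (cases j i rule: linorder_cases) (auto simp: shift_def)

lemma boundary_val_eq: "boundary_val lam S s i = enat bd"
proof (rule antisym)
  obtain l where l: "l \<in> S" "bd = shift l + s l"
    using bd_attained by blast
  show "boundary_val lam S s i \<le> enat bd"
  proof (cases "l < i")
    case True
    then have "(INF j\<in>{j \<in> S. j < i}. enat (s j)) \<le> enat (s l)"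
      using l by (intro INF_lower) auto
    then show ?thesis
      using S_cases[OF l(1)] True l(2) by (auto simp: boundary_val_def min_le_iff_disj)
  next
    case False
    then have "i < l" "shift l = lam i - lam l"
      using S_cases[OF l(1)] by auto
    then have "(INF j\<in>{j \<in> S. i < j}. enat (lam i - lam j + s j)) \<le> enat (lam i - lam l + s l)"
      using l by (intro INF_lower) auto
    then show ?thesis
      using \<open>shift l = lam i - lam l\<close> l(2) by (auto simp: boundary_val_def min_le_iff_disj)
  qed
  have "bd \<le> s j" if "j \<in> S" "j < i" for j
    using bd_le[OF that(1)] S_cases[OF that(1)] that by auto
  moreover have "bd \<le> lam i - lam j + s j" if "j \<in> S" "i < j" for j
    using bd_le[OF that(1)] S_cases[OF that(1)] that by auto
  ultimately show "enat bd \<le> boundary_val lam S s i"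
    by (auto simp: boundary_val_def le_INF_iff)
qed

lemma attains_iff:
  "l \<in> S \<and> (l < i \<and> boundary_val lam S s i = enat (s l) \<or>
     i < l \<and> boundary_val lam S s i = enat (lam i - lam l + s l)) \<longleftrightarrow> l \<in> S \<and> bd = shift l + s l"
  using S_cases[of l] by (auto simp: boundary_val_eq)

text \<open>For v < \<open>lam j\<close>, \<open>shift j + v\<close> is the maximum of v and
  \<open>lam i - (lam j - v)\<close>. Both decrease weakly when (v, \<open>lam j\<close>) is
  replaced by a larger element of the poset, here a maximal element of I.\<close>

lemma bd_le_r:
  assumes j: "j \<in> {1..k}"
  shows "enat bd \<le> enat (shift j) + r j"
proof (cases "r j")
  case (enat v)
  then obtain p where p: "v < lam j" "p \<in> S" "s p \<le> v" "lam j - v \<le> lam p - s p"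
    using r[OF j] by blast
  have "bd \<le> shift p + s p"
    by (rule bd_le[OF p(2)])
  also have "\<dots> \<le> shift j + v"
    using p unfolding shift_def by linarith
  finally show ?thesis
    by (simp add: enat)
qed simp

lemma bd_le_r_i: "enat bd \<le> r i"
  using bd_le_r[of i] i by (simp add: shift_def flip: zero_enat_def)

text \<open>Through lower bounds the six infima become quantifiers, empty ones included, and
  \<open>shift\<close> merges j < i with j > i.\<close>

lemma le_m_val_iff:
  "x \<le> m_val R \<pi> lam \<rho> k S s r y l i \<longleftrightarrow>
     (\<forall>j\<in>S. x \<le> enat (shift j + s j) + val R \<pi> (y j \<ominus> y l)) \<and>
     (\<forall>j\<in>S. 1 < \<rho> j \<longrightarrow> x \<le> enat (shift j) + r j) \<and>
     (\<forall>j\<in>{1..k} - S. j \<noteq> i \<longrightarrow> x \<le> enat (shift j) + r j)"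
proof -
  let ?v = "\<lambda>j. val R \<pi> (y j \<ominus> y l)"
  have neq: "j \<in> {1..k} \<and> j \<noteq> i" if "j \<in> S" for j
    using that S i by auto
  have v: "x \<le> enat (shift j + s j) + ?v j \<longleftrightarrow>
      (j < i \<longrightarrow> x \<le> enat (s j) + ?v j) \<and> (i < j \<longrightarrow> x \<le> enat (lam i - lam j + s j) + ?v j)"
    if "j \<in> S" for j
    using S_cases[OF that] by auto
  have r: "x \<le> enat (shift j) + r j \<longleftrightarrow>
      (j < i \<longrightarrow> x \<le> r j) \<and> (i < j \<longrightarrow> x \<le> enat (lam i - lam j) + r j)"
    if "j \<in> {1..k}" "j \<noteq> i" for j
    using that shift_eq_0[of j]
    by (cases j i rule: linorder_cases) (auto simp: shift_def simp flip: zero_enat_def)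
  have Min: "x \<le> Min {a, b, c, d, e, f} \<longleftrightarrow> x \<le> a \<and> x \<le> b \<and> x \<le> c \<and> x \<le> d \<and> x \<le> e \<and> x \<le> f"
    for a b c d e f
    by simp
  have "x \<le> m_val R \<pi> lam \<rho> k S s r y l i \<longleftrightarrow>
      (\<forall>j\<in>S. j < i \<longrightarrow> x \<le> enat (s j) + ?v j) \<and>
      (\<forall>j\<in>S. i < j \<longrightarrow> x \<le> enat (lam i - lam j + s j) + ?v j) \<and>
      (\<forall>j\<in>S. j < i \<and> 1 < \<rho> j \<longrightarrow> x \<le> r j) \<and>
      (\<forall>j\<in>{1..k} - S. j < i \<longrightarrow> x \<le> r j) \<and>
      (\<forall>j\<in>S. i < j \<and> 1 < \<rho> j \<longrightarrow> x \<le> enat (lam i - lam j) + r j) \<and>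
      (\<forall>j\<in>{1..k} - S. i < j \<longrightarrow> x \<le> enat (lam i - lam j) + r j)"
    unfolding m_val_def Min le_INF_iff by blast
  moreover have "(\<forall>j\<in>S. x \<le> enat (shift j + s j) + ?v j) \<longleftrightarrow>
      (\<forall>j\<in>S. j < i \<longrightarrow> x \<le> enat (s j) + ?v j) \<and>
      (\<forall>j\<in>S. i < j \<longrightarrow> x \<le> enat (lam i - lam j + s j) + ?v j)"
    using v by blast
  moreover have "(\<forall>j\<in>S. 1 < \<rho> j \<longrightarrow> x \<le> enat (shift j) + r j) \<longleftrightarrow>
      (\<forall>j\<in>S. j < i \<and> 1 < \<rho> j \<longrightarrow> x \<le> r j) \<and>
      (\<forall>j\<in>S. i < j \<and> 1 < \<rho> j \<longrightarrow> x \<le> enat (lam i - lam j) + r j)"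
    using r neq by blast
  moreover have "(\<forall>j\<in>{1..k} - S. j \<noteq> i \<longrightarrow> x \<le> enat (shift j) + r j) \<longleftrightarrow>
      (\<forall>j\<in>{1..k} - S. j < i \<longrightarrow> x \<le> r j) \<and>
      (\<forall>j\<in>{1..k} - S. i < j \<longrightarrow> x \<le> enat (lam i - lam j) + r j)"
    using r by (metis DiffD1 nat_neq_iff)
  ultimately show ?thesis
    by argo
qed

lemma bd_le_m_val: "enat bd \<le> m_val R \<pi> lam \<rho> k S s r y l i"
proof -
  have "enat bd \<le> enat (shift j + s j) + v" if "j \<in> S" for j v
    using bd_le[OF that] by (cases v) auto
  then show ?thesis
    unfolding le_m_val_iff using bd_le_r S by auto
qed

subsection \<open>Lifts of the pair\<close>

abbreviation "E \<equiv> canonical_lift S s"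

text \<open>For j in S with \<open>\<rho> j = 1\<close> the entry at (j, 2) lies outside T, so
  residues do not see it. An infinite exponent gives the entry zero.\<close>

definition F :: "nat \<times> nat \<Rightarrow> 'a" where
  "F = (\<lambda>(j, c). if j \<in> S \<and> c = 1 then \<pi> [^] s j \<otimes> y j
          else if c = (if j \<in> S then 2 else 1) then epow R \<pi> (r j) else \<zero>)"

definition H :: "nat \<Rightarrow> nat \<times> nat \<Rightarrow> 'a" where
  "H l = (\<lambda>t. F t \<ominus> y l \<otimes> E t)"

lemma epow_closed [simp]: "epow R \<pi> v \<in> carrier R"
  by (cases v) auto

lemma pow_dvd_epow: "enat n \<le> v \<Longrightarrow> \<pi> [^] n divides epow R \<pi> v"
  by (cases v) (auto simp: pow_dvd_pow)

lemma F_lifts [simp]: "F \<in> lifts"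
  using y by (auto simp: F_def)

lemma H_lifts [simp]: "l \<in> S \<Longrightarrow> H l \<in> lifts"
  using y[of l] lifts_closed[OF F_lifts] lifts_closed[OF canonical_lift_lifts] by (auto simp: H_def)

lemma pair_elem_eq: "pair_elem R \<pi> k lam \<rho> S s y (char_elem R \<pi> k lam \<rho> S r) = residues T (exps lam) F"
  by (auto simp: pair_elem_def char_elem_def residues_def F_def restrict_def fun_eq_iff idx_first_def
      idx_rest_def)

lemma H_eq:
  assumes "l \<in> S"
  shows "H l (j, c) = (if j \<in> S \<and> c = 1 then \<pi> [^] s j \<otimes> (y j \<ominus> y l)
     else if c = (if j \<in> S then 2 else 1) then epow R \<pi> (r j) else \<zero>)"
proof -
  have "\<pi> [^] s j \<otimes> a \<ominus> b \<otimes> \<pi> [^] s j = \<pi> [^] s j \<otimes> (a \<ominus> b)" if "a \<in> carrier R" "b \<in> carrier R" for a b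
    using that uniformizer_pow_closed[of "s j"] by algebra
  then show ?thesis
    using y assms by (auto simp: H_def F_def canonical_lift_def minus_eq)
qed

text \<open>Only as much of the valuation is used as n requires, so the witness m is finite even for
  z = 0.\<close>

lemma pow_dvd_shift:
  assumes z: "z \<in> carrier R" and n: "enat n \<le> enat (shift j + a) + val R \<pi> z"
  shows "\<exists>m. \<pi> [^] m divides \<pi> [^] a \<otimes> z \<and> n \<le> shift j + m"
proof -
  have "enat (n - (shift j + a)) \<le> val R \<pi> z"
    using n by (cases "val R \<pi> z") auto
  then have "\<pi> [^] (n - (shift j + a)) divides z"
    using z by (simp add: le_val_iff)
  then have "\<pi> [^] (a + (n - (shift j + a))) divides \<pi> [^] a \<otimes> z"
    using z by (intro pow_dvd_mult) auto
  then show ?thesis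
    by (intro exI[of _ "a + (n - (shift j + a))"]) auto
qed

lemma pow_dvd_shift_epow:
  assumes "enat n \<le> enat (shift j) + v"
  shows "\<exists>m. \<pi> [^] m divides epow R \<pi> v \<and> n \<le> shift j + m"
proof -
  have "enat (n - shift j) \<le> v"
    using assms by (cases v) auto
  then show ?thesis
    by (intro exI[of _ "n - shift j"]) (auto intro: pow_dvd_epow)
qed

lemma E_bound: "n \<le> bd \<Longrightarrow> \<exists>m. \<pi> [^] m divides E (j, c) \<and> n \<le> shift j + m"
  using bd_le[of j]
  by (intro exI[of _ "if j \<in> S \<and> c = 1 then s j else n"]) (auto simp: canonical_lift_def)

lemma F_bound:
  assumes n: "n \<le> bd" and j: "j \<in> {1..k}"
  shows "\<exists>m. \<pi> [^] m divides F (j, c) \<and> n \<le> shift j + m"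
proof -
  consider "j \<in> S \<and> c = 1" | "\<not> (j \<in> S \<and> c = 1)" "c = (if j \<in> S then 2 else 1)"
    | "\<not> (j \<in> S \<and> c = 1)" "c \<noteq> (if j \<in> S then 2 else 1)"
    by blast
  then show ?thesis
  proof cases
    case 1
    then show ?thesis
      using bd_le[of j] n y by (auto simp: F_def intro!: exI[of _ "s j"])
  next
    case 2
    have "enat n \<le> enat (shift j) + r j"
      using bd_le_r[OF j] n by (meson enat_ord_simps(1) order_trans)
    then show ?thesis
      using 2 pow_dvd_shift_epow by (auto simp: F_def)
  next
    case 3
    then show ?thesis
      by (auto simp: F_def intro!: exI[of _ n])
  qed
qed

text \<open>The coordinate (i, 1) is left out because it carries \<pi> to the power r_i, which does
  not occur in m_i.\<close>

lemma H_bound: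
  assumes l: "l \<in> S" and n: "enat n \<le> m_val R \<pi> lam \<rho> k S s r y l i"
    and jc: "(j, c) \<in> T" "(j, c) \<noteq> (i, 1)"
  shows "\<exists>m. \<pi> [^] m divides H l (j, c) \<and> n \<le> shift j + m"
proof -
  have j: "j \<in> {1..k}" "c \<in> {1..\<rho> j}"
    using jc by (auto simp: idx_def)
  consider "j \<in> S \<and> c = 1" | "\<not> (j \<in> S \<and> c = 1)" "c = (if j \<in> S then 2 else 1)"
    | "\<not> (j \<in> S \<and> c = 1)" "c \<noteq> (if j \<in> S then 2 else 1)"
    by blast
  then show ?thesis
  proof cases
    case 1
    then have "\<exists>m. \<pi> [^] m divides \<pi> [^] s j \<otimes> (y j \<ominus> y l) \<and> n \<le> shift j + m"
      using n y l by (intro pow_dvd_shift) (auto simp: le_m_val_iff)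
    then show ?thesis
      using 1 l by (simp add: H_eq)
  next
    case 2
    \<comment> \<open>For j in S the position is 2, so block j has more than one coordinate;
      otherwise it is 1, and then j differs from i. These are the conditions on j in m_i.\<close>
    have "enat n \<le> enat (shift j) + r j"
      using n 2 j jc(2) by (cases "j \<in> S") (auto simp: le_m_val_iff)
    then have "\<exists>m. \<pi> [^] m divides epow R \<pi> (r j) \<and> n \<le> shift j + m"
      by (rule pow_dvd_shift_epow)
    then show ?thesis
      using 2 l by (simp add: H_eq split: if_splits)
  next
    case 3
    then have "H l (j, c) = \<zero>"
      using l by (auto simp: H_eq)
    then show ?thesis
      by (intro exI[of _ n]) simp
  qed
qed

subsection \<open>The three cases\<close>

lemma block_subset: "idx_block \<rho> i \<subseteq> T"
  using i by (auto simp: idx_block_def idx_def)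

lemma blk_lin_hom: "(\<lambda>a. blk a) \<in> lin_hom R full block"
  by (rule restrict_lin_hom[OF block_subset])

lemma blk_mem_pi_multiples_iff:
  assumes "x \<in> carrier full"
  shows "blk x \<in> pi_multiples R \<pi> block v \<longleftrightarrow>
    (\<forall>n c. enat n \<le> v \<longrightarrow> c \<in> {1..\<rho> i} \<longrightarrow> x (i, c) \<in> multiples (lam i) n)"
  using mem_pi_multiples_iff[OF lin_hom_closed[OF blk_lin_hom assms]]
  by (auto simp: idx_block_def)

text \<open>The bound with \<open>shift\<close> covers both alternatives of
  \<open>lin_hom_mem_multiples\<close>: the first if j \<le> i, where the shift is 0, and the second
  if j > i.\<close>

lemma component_mem_multiples:
  assumes g: "g \<in> lin_hom R full full" and V: "V \<in> lifts" and c: "c \<in> {1..\<rho> i}"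
    and bound: "\<And>j c'. (j, c') \<in> T \<Longrightarrow> \<exists>m. \<pi> [^] m divides V (j, c') \<and> n \<le> shift j + m"
  shows "g (residues T (exps lam) V) (i, c) \<in> multiples (lam i) n"
proof -
  have ic: "(i, c) \<in> T"
    using i c by (auto simp: idx_def)
  have "g (residues T (exps lam) V) (i, c) \<in> multiples (exps lam (i, c)) n"
  proof (rule lin_hom_mem_multiples[OF g ic finite_idx V])
    fix t assume t: "t \<in> T"
    obtain j c' where jc: "t = (j, c')"
      by (cases t)
    obtain m where "\<pi> [^] m divides V t" "n \<le> shift j + m"
      using bound[of j c'] t by (auto simp: jc)
    then show "\<exists>m. \<pi> [^] m divides V t \<and>
        (n \<le> m \<or> min n (exps lam (i, c)) + exps lam t \<le> exps lam (i, c) + m)"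
      by (intro exI[of _ m]) (auto simp: jc shift_def)
  qed
  then show ?thesis
    by simp
qed

lemma orbit_components:
  assumes g: "g \<in> lin_hom R full full"
  shows "blk (g (residues T (exps lam) E)) \<in> pi_multiples R \<pi> block (enat bd)"
    and "blk (g (residues T (exps lam) F)) \<in> pi_multiples R \<pi> block (enat bd)"
proof -
  have T: "j \<in> {1..k}" if "(j, c) \<in> T" for j c
    using that by (auto simp: idx_def)
  show "blk (g (residues T (exps lam) E)) \<in> pi_multiples R \<pi> block (enat bd)"
    using E_bound component_mem_multiples[OF g canonical_lift_lifts]
    by (auto simp: blk_mem_pi_multiples_iff lin_hom_closed[OF g])
  show "blk (g (residues T (exps lam) F)) \<in> pi_multiples R \<pi> block (enat bd)"
    using F_bound T component_mem_multiples[OF g F_lifts]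
    by (auto simp: blk_mem_pi_multiples_iff lin_hom_closed[OF g])
qed

lemma component_difference:
  assumes g: "g \<in> lin_hom R full full" and l: "l \<in> S"
  shows "blk (g (residues T (exps lam) F)) \<ominus>\<^bsub>block\<^esub> y l \<odot>\<^bsub>block\<^esub> blk (g (residues T (exps lam) E)) =
    blk (g (residues T (exps lam) (H l)))"
proof -
  interpret B: module R block by (rule csum_module)
  interpret M: module R full by (rule csum_module)
  let ?p = "\<lambda>x. blk (g x)"
  have p: "?p \<in> lin_hom R full block"
    by (rule lin_hom_comp[OF g blk_lin_hom])
  let ?e = "residues T (exps lam) E" and ?h = "residues T (exps lam) (H l)"
  have yE: "(\<lambda>t. y l \<otimes> E t) \<in> lifts"
    using y[OF l] lifts_closed[OF canonical_lift_lifts] by auto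
  have "F t = H l t \<oplus> y l \<otimes> E t" for t
    using y[OF l] lifts_closed[OF F_lifts, of t] lifts_closed[OF canonical_lift_lifts, of S s t]
    unfolding H_def by algebra
  then have "F = (\<lambda>t. H l t \<oplus> y l \<otimes> E t)"
    by blast
  then have "residues T (exps lam) F = ?h \<oplus>\<^bsub>full\<^esub> y l \<odot>\<^bsub>full\<^esub> ?e"
    using y l yE by (simp add: residues_add residues_smult)
  then have "?p (residues T (exps lam) F) = ?p ?h \<oplus>\<^bsub>block\<^esub> y l \<odot>\<^bsub>block\<^esub> ?p ?e"
    using y l by (simp add: lin_hom_add[OF p] lin_hom_smult[OF p] M.smult_closed)
  moreover have "?p ?h \<in> carrier block" "y l \<odot>\<^bsub>block\<^esub> ?p ?e \<in> carrier block"
    using y l lin_hom_closed[OF p] by auto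
  ultimately show ?thesis
    by (simp add: a_minus_def B.a_assoc B.r_neg)
qed

text \<open>This serves case (i) with v = m_i and case (ii) with v = r_i. The bound by m_i controls
  all coordinates except (i, 1), and the bound by r_i controls that one.\<close>

lemma difference_mem:
  assumes g: "g \<in> lin_hom R full full" and l: "l \<in> S"
    and v: "v \<le> m_val R \<pi> lam \<rho> k S s r y l i" "v \<le> r i"
  shows "blk (g (residues T (exps lam) (H l))) \<in> pi_multiples R \<pi> block v"
proof -
  have "g (residues T (exps lam) (H l)) (i, c) \<in> multiples (lam i) n"
    if n: "enat n \<le> v" and c: "c \<in> {1..\<rho> i}" for n c
  proof (rule component_mem_multiples[OF g H_lifts[OF l] c])
    fix j c' assume "(j, c') \<in> T"
    show "\<exists>m. \<pi> [^] m divides H l (j, c') \<and> n \<le> shift j + m"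
    proof (cases "(j, c') = (i, 1)")
      case True
      have "\<pi> [^] n divides epow R \<pi> (r i)"
        using n v(2) by (intro pow_dvd_epow) (rule order_trans)
      then show ?thesis
        using True i l by (intro exI[of _ n]) (simp add: H_eq)
    next
      case False
      then show ?thesis
        using n v(1) \<open>(j, c') \<in> T\<close> by (intro H_bound[OF l]) (auto intro: order_trans)
    qed
  qed
  then show ?thesis
    using l by (simp add: blk_mem_pi_multiples_iff lin_hom_closed[OF g])
qed

text \<open>Away from (i, 1) every contribution to block i is divisible by \<pi> to the power r_i +
  1, as r_i < m_i. What remains is \<pi> to the power r_i times the image of a unit vector, which
  has a coordinate in block i prime to \<pi>.\<close>

lemma difference_not_mem:
  assumes g: "g \<in> module_aut R full" and l: "l \<in> S"
    and lt: "r i < m_val R \<pi> lam \<rho> k S s r y l i"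
  shows "blk (g (residues T (exps lam) (H l))) \<notin> pi_multiples R \<pi> block (r i + 1)"
proof
  note lin = lin_hom_of_aut[OF g]
  interpret B: module R full by (rule csum_module)
  assume mem: "blk (g (residues T (exps lam) (H l))) \<in> pi_multiples R \<pi> block (r i + 1)"
  obtain v where v: "r i = enat v"
    using lt by (cases "r i") auto
  \<comment> \<open>This keeps divisibility by \<pi> to the power v + 1 meaningful modulo \<pi> to
    the power \<open>lam i\<close>.\<close>
  have v_less: "v < lam i"
    using r[of i v] i v by auto
  have le: "enat (Suc v) \<le> m_val R \<pi> lam \<rho> k S s r y l i"
    using lt v by (simp add: Suc_ile_eq)
  let ?H = "(H l)((i, 1) := \<zero>)"
  have H': "?H \<in> lifts"
    using lifts_closed[OF H_lifts[OF l]] by auto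
  have "residues T (exps lam) (H l) =
      \<pi> [^] v \<odot>\<^bsub>full\<^esub> residues T (exps lam) (single (i, 1) \<one>) \<oplus>\<^bsub>full\<^esub> residues T (exps lam) ?H"
  proof -
    have "(\<lambda>u. \<pi> [^] v \<otimes> single (i, 1) \<one> u) \<in> lifts"
      by (auto simp: single_def)
    then have "\<pi> [^] v \<odot>\<^bsub>full\<^esub> residues T (exps lam) (single (i, 1) \<one>) \<oplus>\<^bsub>full\<^esub> residues T (exps lam) ?H =
        residues T (exps lam) (\<lambda>t. \<pi> [^] v \<otimes> single (i, 1) \<one> t \<oplus> ?H t)"
      using H' by (simp only: residues_smult residues_add uniformizer_pow_closed single_lifts one_closed)
    also have "(\<lambda>t. \<pi> [^] v \<otimes> single (i, 1) \<one> t \<oplus> ?H t) = H l"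
    proof
      fix t
      have "H l (i, 1) = \<pi> [^] v"
        using i v by (simp add: H_eq[OF l])
      then show "\<pi> [^] v \<otimes> single (i, 1) \<one> t \<oplus> ?H t = H l t"
        using lifts_closed[OF H_lifts[OF l], of t] by (cases "t = (i, 1)") (simp_all add: single_def)
    qed
    finally show ?thesis ..
  qed
  obtain Z where Z: "Z \<in> lifts" "g (residues T (exps lam) (single (i, 1) \<one>)) = residues T (exps lam) Z"
    by (rule residues_surj[OF lin_hom_closed[OF lin residues_closed[OF single_lifts[OF one_closed]]]])
  obtain W where W: "W \<in> lifts" "g (residues T (exps lam) ?H) = residues T (exps lam) W"
    by (rule residues_surj[OF lin_hom_closed[OF lin residues_closed[OF H']]])
  have piZ: "(\<lambda>t. \<pi> [^] v \<otimes> Z t) \<in> lifts"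
    using Z by auto
  have gH: "g (residues T (exps lam) (H l)) = residues T (exps lam) (\<lambda>t. \<pi> [^] v \<otimes> Z t \<oplus> W t)"
  proof -
    have "g (residues T (exps lam) (H l)) =
        \<pi> [^] v \<odot>\<^bsub>full\<^esub> g (residues T (exps lam) (single (i, 1) \<one>)) \<oplus>\<^bsub>full\<^esub> g (residues T (exps lam) ?H)"
      unfolding \<open>residues T (exps lam) (H l) = _\<close>
      by (simp only: lin_hom_add[OF lin] lin_hom_smult[OF lin] B.smult_closed residues_closed
          single_lifts one_closed H' uniformizer_pow_closed)
    then show ?thesis
      using Z W piZ by (simp only: residues_smult residues_add uniformizer_pow_closed)
  qed
  obtain c where c: "c \<in> {1..\<rho> i}" "\<not> \<pi> divides Z (i, c)"
    using aut_unit_vector[OF type _ g Z] i by blast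
  have ic: "(i, c) \<in> T"
    using i c by (auto simp: idx_def)
  have "g (residues T (exps lam) (H l)) (i, c) \<in> multiples (lam i) (Suc v)"
    using mem c(1) l v by (auto simp: blk_mem_pi_multiples_iff lin_hom_closed[OF lin] plus_1_eSuc eSuc_enat)
  then have "\<pi> [^] Suc v divides (\<pi> [^] v \<otimes> Z (i, c) \<oplus> W (i, c))"
    using Z W ic v_less by (simp add: gH quot_proj_mem_multiples_iff min_absorb1 del: nat_pow_Suc)
  moreover have "g (residues T (exps lam) ?H) (i, c) \<in> multiples (lam i) (Suc v)"
  proof (rule component_mem_multiples[OF lin H' c(1)])
    fix j c' assume jc: "(j, c') \<in> T"
    show "\<exists>m. \<pi> [^] m divides ?H (j, c') \<and> Suc v \<le> shift j + m"
      using H_bound[OF l le jc] by (cases "(j, c') = (i, 1)") (auto intro: exI[of _ "Suc v"])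
  qed
  then have "\<pi> [^] Suc v divides W (i, c)"
    using W ic v_less by (simp add: quot_proj_mem_multiples_iff min_absorb1 del: nat_pow_Suc)
  ultimately have "\<pi> [^] Suc v divides ((\<pi> [^] v \<otimes> Z (i, c) \<oplus> W (i, c)) \<ominus> W (i, c))"
    using Z W by (intro dvd_diff) auto
  also have "(\<pi> [^] v \<otimes> Z (i, c) \<oplus> W (i, c)) \<ominus> W (i, c) = \<pi> [^] v \<otimes> Z (i, c)"
    using lifts_closed[OF Z(1), of "(i, c)"] lifts_closed[OF W(1), of "(i, c)"] uniformizer_pow_closed[of v]
    by algebra
  finally have "\<pi> [^] (1::nat) divides Z (i, c)"
    using Z by (intro pow_dvd_cancel[of "Z (i, c)" "Suc v" v 1]) auto
  then show False
    using c(2) by simp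
qed

text \<open>At \<open>t\<close>, the element \<open>f - y\<^sub>l e\<close> has the coordinate \<open>\<pi>\<close> to the power \<open>q\<close> times the unit \<open>u\<close>.\<close>

lemma witness:
  assumes l: "l \<in> S" and eq: "m_val R \<pi> lam \<rho> k S s r y l i = enat bd"
  obtains t q u \<epsilon> where "t \<in> T" "fst t \<noteq> i" "shift (fst t) + q = bd" "u \<in> Units R" "\<epsilon> \<in> carrier R"
    "E t = \<pi> [^] q \<otimes> \<epsilon>" "F t = \<pi> [^] q \<otimes> (u \<oplus> y l \<otimes> \<epsilon>)"
proof -
  have rho: "1 \<le> \<rho> j" if "j \<in> {1..k}" for j
    using type that by (auto simp: is_type_def)
  \<comment> \<open>Some term of the minimum m_i is therefore at most \<open>bd\<close>. As no term
    is smaller, it equals \<open>bd\<close>.\<close>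
  have "\<not> enat (Suc bd) \<le> m_val R \<pi> lam \<rho> k S s r y l i"
    by (simp add: eq)
  then consider j where "j \<in> S" "enat (shift j + s j) + val R \<pi> (y j \<ominus> y l) < enat (Suc bd)"
    | j where "j \<in> S" "1 < \<rho> j" "enat (shift j) + r j < enat (Suc bd)"
    | j where "j \<in> {1..k} - S" "j \<noteq> i" "enat (shift j) + r j < enat (Suc bd)"
    unfolding le_m_val_iff by (auto simp: not_le)
  then show thesis
  proof cases
    case 1
    obtain w where w: "val R \<pi> (y j \<ominus> y l) = enat w"
      using 1 by (cases "val R \<pi> (y j \<ominus> y l)") auto
    with 1 bd_le[OF 1(1)] have "shift j + s j = bd" "w = 0"
      by auto
    have "\<not> \<pi> divides (y j \<ominus> y l)"
      using le_val_iff[of "y j \<ominus> y l" 1] w \<open>w = 0\<close> y 1 l by simp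
    then have unit: "y j \<ominus> y l \<in> Units R"
      using y 1 l by (intro unit_if_not_dvd) auto
    \<comment> \<open>Here e has the entry \<pi> to the power \<open>s j\<close>, so \<epsilon> is
      1; the valuation 0 of the difference makes it the required unit.\<close>
    show thesis
    proof (rule that[of "(j, 1)" "s j" "y j \<ominus> y l" \<one>])
      show "(j, 1) \<in> T"
        using 1 S rho[of j] by (auto simp: idx_def)
      show "fst (j, 1::nat) \<noteq> i"
        using 1 i by auto
      have "y j \<ominus> y l \<oplus> y l \<otimes> \<one> = y j"
        using y[OF 1(1)] y[OF l] by algebra
      then show "F (j, 1) = \<pi> [^] s j \<otimes> (y j \<ominus> y l \<oplus> y l \<otimes> \<one>)"
        using 1 by (simp add: F_def)
    qed (use 1 \<open>shift j + s j = bd\<close> unit in \<open>auto simp: canonical_lift_def\<close>)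
  next
    case 2
    obtain w where w: "r j = enat w"
      using 2 by (cases "r j") auto
    with 2 bd_le_r[of j] S have "shift j + w = bd"
      by auto
    \<comment> \<open>At a second coordinate e vanishes, so \<epsilon> is 0, and the entry of f is a
      pure power of \<pi>.\<close>
    show thesis
    proof (rule that[of "(j, 2)" w \<one> \<zero>])
      show "(j, 2) \<in> T"
        using 2 S by (auto simp: idx_def)
      show "fst (j, 2::nat) \<noteq> i"
        using 2 i by auto
    qed (use 2 w \<open>shift j + w = bd\<close> y[OF l] in \<open>auto simp: canonical_lift_def F_def\<close>)
  next
    case 3
    obtain w where w: "r j = enat w"
      using 3 by (cases "r j") auto
    with 3 bd_le_r[of j] have "shift j + w = bd"
      by auto
    show thesis
    proof (rule that[of "(j, 1)" w \<one> \<zero>])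
      show "(j, 1) \<in> T"
        using 3 rho[of j] by (auto simp: idx_def)
    qed (use 3 w \<open>shift j + w = bd\<close> y[OF l] in \<open>auto simp: canonical_lift_def F_def\<close>)
  qed
qed

text \<open>After division by \<pi> to the power \<open>bd\<close>, a shear using (l, 1) and t turns
  e into A + B \<epsilon> and f into \<eta> + A y_l + B (\<upsilon> + y_l \<epsilon>) on block i.
  Equating these with U and W gives a linear system with determinant \<upsilon>, a unit.\<close>

lemma all_pairs_attained:
  assumes l: "l \<in> S" "bd = shift l + s l" and eq: "m_val R \<pi> lam \<rho> k S s r y l i = enat bd"
    and u: "u \<in> pi_multiples R \<pi> block (enat bd)" and w: "w \<in> pi_multiples R \<pi> block (enat bd)"
  obtains g where "g \<in> module_aut R full"
    "blk (g (residues T (exps lam) E)) = u" "blk (g (residues T (exps lam) F)) = w"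
proof -
  obtain t q \<upsilon> \<epsilon> where t: "t \<in> T" "fst t \<noteq> i" "shift (fst t) + q = bd"
    and \<upsilon>: "\<upsilon> \<in> Units R" and \<epsilon>: "\<epsilon> \<in> carrier R"
    and Et: "E t = \<pi> [^] q \<otimes> \<epsilon>" and Ft: "F t = \<pi> [^] q \<otimes> (\<upsilon> \<oplus> y l \<otimes> \<epsilon>)"
    by (rule witness[OF l(1) eq])
  have "\<exists>V\<in>lifts. x = residues (idx_block \<rho> i) (exps lam) (\<lambda>t. \<pi> [^] bd \<otimes> V t)"
    if x: "x \<in> pi_multiples R \<pi> block (enat bd)" for x
  proof -
    obtain x' where x': "x' \<in> carrier block" "x = \<pi> [^] bd \<odot>\<^bsub>block\<^esub> x'"
      using x by (auto simp: pi_multiples_def smult_image_def)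
    obtain V where "V \<in> lifts" "x' = residues (idx_block \<rho> i) (exps lam) V"
      by (rule residues_surj[OF x'(1)])
    then show ?thesis
      using x' by (auto simp: residues_smult)
  qed
  from this[OF u] this[OF w] obtain U W where U: "U \<in> lifts" "u = residues (idx_block \<rho> i) (exps lam) (\<lambda>t. \<pi> [^] bd \<otimes> U t)"
    and W: "W \<in> lifts" "w = residues (idx_block \<rho> i) (exps lam) (\<lambda>t. \<pi> [^] bd \<otimes> W t)"
    by blast
  \<comment> \<open>Block i of f need not vanish, but its exponent r_i is at least
    \<open>bd\<close>, so its contribution can be corrected.\<close>
  have "\<exists>\<eta>\<in>carrier R. F (i, c) = \<pi> [^] bd \<otimes> \<eta>" for c
  proof -
    obtain n where "\<pi> [^] n divides F (i, c)" "bd \<le> n"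
      using F_bound[of bd i c] i by (auto simp: shift_def)
    then have "\<pi> [^] bd divides F (i, c)"
      by (intro pow_dvd_le[of bd n]) auto
    then show ?thesis
      by (auto simp: factor_def)
  qed
  then obtain \<eta> where \<eta>: "\<And>c. \<eta> c \<in> carrier R" "\<And>c. F (i, c) = \<pi> [^] bd \<otimes> \<eta> c"
    by metis
  \<comment> \<open>Subtracting y_l times the equation for U from that for W leaves \<upsilon> B = W
    - y_l U - \<eta>; then A follows from U.\<close>
  define B where "B c = inv \<upsilon> \<otimes> ((W (i, c) \<ominus> y l \<otimes> U (i, c)) \<ominus> \<eta> c)" for c
  define A where "A c = U (i, c) \<ominus> B c \<otimes> \<epsilon>" for c
  have B: "B c \<in> carrier R" "\<upsilon> \<otimes> B c = (W (i, c) \<ominus> y l \<otimes> U (i, c)) \<ominus> \<eta> c" for c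
  proof -
    have "W (i, c) \<ominus> y l \<otimes> U (i, c) \<ominus> \<eta> c \<in> carrier R"
      using U(1) W(1) \<eta>(1)[of c] y[OF l(1)] by simp
    then show "B c \<in> carrier R" "\<upsilon> \<otimes> B c = (W (i, c) \<ominus> y l \<otimes> U (i, c)) \<ominus> \<eta> c"
      using \<upsilon> m_assoc[of \<upsilon> "inv \<upsilon>" "W (i, c) \<ominus> y l \<otimes> U (i, c) \<ominus> \<eta> c"]
      by (simp_all add: B_def Units_closed)
  qed
  have A: "A c \<in> carrier R" for c
    using U(1) B(1)[of c] \<epsilon> by (simp add: A_def)
  have l_T: "(l, 1) \<in> T" "l \<noteq> i"
    using l S i type by (auto simp: idx_def is_type_def)
  obtain g where g: "g \<in> module_aut R full"
    "\<And>V. V \<in> lifts \<Longrightarrow> g (residues T (exps lam) V) = residues T (exps lam)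
       (\<lambda>(j, c). if j = i then V (j, c) \<oplus>
          (A c \<otimes> (\<pi> [^] shift l \<otimes> V (l, 1)) \<oplus> B c \<otimes> (\<pi> [^] shift (fst t) \<otimes> V t)) else V (j, c))"
  proof (rule shear_automorphism[of A B "(l, 1)" T i t "exps lam" "shift l" "shift (fst t)"])
    show "exps lam (i, c) \<le> shift l + exps lam (l, 1)" "exps lam (i, c) \<le> shift (fst t) + exps lam t" for c
      by (auto simp: shift_def split: prod.splits)
  qed (use A B(1) l_T t in auto)
  have pow: "\<pi> [^] shift l \<otimes> \<pi> [^] s l = \<pi> [^] bd" "\<pi> [^] shift (fst t) \<otimes> \<pi> [^] q = \<pi> [^] bd"
    by (simp_all add: nat_pow_mult l(2)) (simp add: t(3) flip: l(2))
  have assoc: "\<pi> [^] a \<otimes> (\<pi> [^] b \<otimes> z) = (\<pi> [^] a \<otimes> \<pi> [^] b) \<otimes> z" if "z \<in> carrier R" for a b :: nat and z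
    using that by (simp add: m_assoc)
  have "\<pi> [^] bd \<otimes> U (i, c) = E (i, c) \<oplus>
      (A c \<otimes> (\<pi> [^] shift l \<otimes> E (l, 1)) \<oplus> B c \<otimes> (\<pi> [^] shift (fst t) \<otimes> E t))" for c
  proof -
    have "E (i, c) = \<zero>" "E (l, 1) = \<pi> [^] s l"
      using i l by (auto simp: canonical_lift_def)
    moreover have "A c \<otimes> p \<oplus> B c \<otimes> (p \<otimes> \<epsilon>) = p \<otimes> U (i, c)" if "p \<in> carrier R" for p
      unfolding A_def using that lifts_closed[OF U(1), of "(i, c)"] B(1)[of c] \<epsilon> by algebra
    ultimately show ?thesis
      using A B(1)[of c] U(1) \<epsilon> by (simp add: Et assoc pow)
  qed
  then have "blk (g (residues T (exps lam) E)) = u"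
    unfolding g(2)[OF canonical_lift_lifts] U(2) restrict_residues[OF block_subset]
    by (intro residues_cong) (auto simp: idx_block_def simp del: One_nat_def)
  moreover have "\<pi> [^] bd \<otimes> W (i, c) = F (i, c) \<oplus>
      (A c \<otimes> (\<pi> [^] shift l \<otimes> F (l, 1)) \<oplus> B c \<otimes> (\<pi> [^] shift (fst t) \<otimes> F t))" for c
  proof -
    have *: "\<upsilon> \<in> carrier R" "y l \<in> carrier R" "U (i, c) \<in> carrier R" "W (i, c) \<in> carrier R"
      "B c \<in> carrier R" "\<eta> c \<in> carrier R"
      using \<upsilon> y l U W B \<eta> by auto
    have "p \<otimes> \<eta> c \<oplus> (A c \<otimes> (p \<otimes> y l) \<oplus> B c \<otimes> (p \<otimes> (\<upsilon> \<oplus> y l \<otimes> \<epsilon>))) = p \<otimes> W (i, c)"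
      if p: "p \<in> carrier R" for p
    proof -
      have "p \<otimes> \<eta> c \<oplus> (A c \<otimes> (p \<otimes> y l) \<oplus> B c \<otimes> (p \<otimes> (\<upsilon> \<oplus> y l \<otimes> \<epsilon>))) =
          p \<otimes> (\<eta> c \<oplus> y l \<otimes> U (i, c) \<oplus> \<upsilon> \<otimes> B c)"
        unfolding A_def using p * \<epsilon> by algebra
      also have "\<dots> = p \<otimes> W (i, c)"
        unfolding B(2) using p * by algebra
      finally show ?thesis .
    qed
    moreover have "F (l, 1) = \<pi> [^] s l \<otimes> y l"
      using l by (simp add: F_def)
    ultimately show ?thesis
      using * A[of c] \<epsilon> by (simp add: Ft \<eta>(2) assoc pow)
  qed
  then have "blk (g (residues T (exps lam) F)) = w"
    unfolding g(2)[OF F_lifts] W(2) restrict_residues[OF block_subset]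
    by (intro residues_cong) (auto simp: idx_block_def simp del: One_nat_def)
  ultimately show thesis
    by (rule that[OF g(1)])
qed

end

section \<open>The trichotomy for the components in block i\<close>

theorem theorem17:
  fixes R :: "('a, 'b) ring_scheme" and \<pi> :: 'a
    and k :: nat and lam \<rho> s :: "nat \<Rightarrow> nat"
    and I J K :: "(nat \<times> nat) set" and S :: "nat set"
    and m e x f :: "nat \<times> nat \<Rightarrow> 'a set"
    and r :: "nat \<Rightarrow> enat" and y :: "nat \<Rightarrow> 'a" and i :: nat
    and Orb :: "((nat \<times> nat \<Rightarrow> 'a set) \<times> (nat \<times> nat \<Rightarrow> 'a set)) set"
  assumes dvr: "discrete_valuation_ring R \<pi>"
    and finite_residue_field: "finite (carrier (R Quot (PIdl\<^bsub>R\<^esub> \<pi>)))"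
    and type: "is_type k lam \<rho>"
    and I: "I \<in> ideals_of_type k lam"
    and S: "S \<subseteq> {1..k}" "S \<noteq> {}"
    and max_I: "max_elems I = {(s j, lam j) |j. j \<in> S}"
    and m: "m \<in> ideal_part_exact R \<pi> (mod_full R \<pi> k lam \<rho>) I"
    and J: "J = ideal_J R \<pi> k lam \<rho> S s m"
    and K: "K = ideal_K R \<pi> k lam \<rho> S m"
    and r: "r = char_exp lam J K"
    and x: "x = char_elem R \<pi> k lam \<rho> S r"
    and y: "\<forall>j\<in>S. y j \<in> Units R"
    and f: "f = pair_elem R \<pi> k lam \<rho> S s y x"
    and f_in: "f \<in> orbit_set R \<pi> k lam \<rho> S (restrict m (idx_first S)) J K"
    and e: "e = canonical_form R \<pi> k lam \<rho> S s"
    and Orb: "Orb = {(g e, g f) |g. g \<in> module_aut R (mod_full R \<pi> k lam \<rho>)}"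
    and i: "i \<in> {1..k} - S"
  shows
    "let B = mod_block R \<pi> lam \<rho> i;
         d = boundary_val lam S s i;
         comp = (\<lambda>a. restrict a (idx_block \<rho> i));
         attains = (\<lambda>l. l \<in> S \<and> (l < i \<and> d = enat (s l) \<or> i < l \<and> d = enat (lam i - lam l + s l)))
     in (\<exists>l. attains l) \<and>
        (\<forall>(a, b)\<in>Orb. comp a \<in> pi_multiples R \<pi> B d \<and> comp b \<in> pi_multiples R \<pi> B d) \<and>
        (\<forall>l. attains l \<longrightarrow>
           (let mi = m_val R \<pi> lam \<rho> k S s r y l i;
                num1 = (r i \<ge> mi \<and> mi > d);
                num2 = (mi > r i \<and> r i \<ge> d);
                c1 = (num1 \<and> (\<forall>(a, b)\<in>Orb.
                        comp b \<ominus>\<^bsub>B\<^esub> (y l \<odot>\<^bsub>B\<^esub> comp a) \<in> pi_multiples R \<pi> B mi));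
                c2 = (num2 \<and> (\<forall>(a, b)\<in>Orb.
                        comp b \<ominus>\<^bsub>B\<^esub> (y l \<odot>\<^bsub>B\<^esub> comp a) \<in> pi_multiples_exact R \<pi> B (r i)));
                c3 = (\<not> num1 \<and> \<not> num2 \<and>
                        (\<forall>u\<in>pi_multiples R \<pi> B d. \<forall>w\<in>pi_multiples R \<pi> B d.
                           \<exists>(a, b)\<in>Orb. comp a = u \<and> comp b = w))
            in mi \<ge> d \<and> (c1 \<or> c2 \<or> c3) \<and> \<not> (c1 \<and> c2) \<and> \<not> (c1 \<and> c3) \<and> \<not> (c2 \<and> c3)))"
proof -
  interpret discrete_valuation_ring R \<pi>
    by (rule dvr)
  have I_eq: "I = elem_ideal R \<pi> (mod_full R \<pi> k lam \<rho>) m"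
    using m by (simp add: ideal_part_exact_def)
  have I_P: "I \<subseteq> poset_P"
    using I by (simp add: ideals_of_type_def order_ideal_def)
  note anti = max_elems_antichain[OF type S(1) I_P max_I]
  have JK: "J \<union> K \<subseteq> I"
    using ideal_J_K_subset[OF type S(1) m anti] J K by simp
  interpret orbit_pair R \<pi> k lam \<rho> s S r y i
  proof (unfold_locales)
    fix j v assume "j \<in> {1..k}" "r j = enat v"
    then have I_mem: "(v, lam j) \<in> I"
      using char_exp_mem[of lam J K j v] JK r by auto
    obtain q where q: "q \<in> max_elems I" "poset_le (v, lam j) q"
      by (rule ideal_le_max[OF type I_eq I_mem])
    then obtain p where "p \<in> S" "q = (s p, lam p)"
      using max_I by auto
    then show "v < lam j \<and> (\<exists>p\<in>S. s p \<le> v \<and> lam j - v \<le> lam p - s p)"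
      using q(2) I_mem I_P by (auto simp: poset_le_def poset_P_def)
  qed (use type S i y Units_closed in blast)+
  have e_eq: "e = residues T (exps lam) E"
    by (simp add: e canonical_form_eq)
  have f_eq: "f = residues T (exps lam) F"
    by (simp add: f x pair_elem_eq)
  have B: "mod_block R \<pi> lam \<rho> i = block"
    by (simp add: mod_block_def)
  have Orb_eq: "Orb = {(g (residues T (exps lam) E), g (residues T (exps lam) F)) |g. g \<in> module_aut R full}"
    by (simp add: Orb e_eq f_eq mod_full_def)
  have lin: "g \<in> lin_hom R full full" if "g \<in> module_aut R full" for g
    by (rule lin_hom_of_aut[OF that])
  have ex: "\<exists>l. l \<in> S \<and> bd = shift l + s l"
    using bd_attained by blast
  have comps: "\<forall>(a, b)\<in>Orb. blk a \<in> pi_multiples R \<pi> block (enat bd) \<and> blk b \<in> pi_multiples R \<pi> block (enat bd)"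
    using orbit_components lin by (auto simp: Orb_eq)
  have main: "let mi = m_val R \<pi> lam \<rho> k S s r y l i;
                num1 = (r i \<ge> mi \<and> mi > enat bd);
                num2 = (mi > r i \<and> r i \<ge> enat bd);
                c1 = (num1 \<and> (\<forall>(a, b)\<in>Orb.
                        blk b \<ominus>\<^bsub>block\<^esub> (y l \<odot>\<^bsub>block\<^esub> blk a) \<in> pi_multiples R \<pi> block mi));
                c2 = (num2 \<and> (\<forall>(a, b)\<in>Orb.
                        blk b \<ominus>\<^bsub>block\<^esub> (y l \<odot>\<^bsub>block\<^esub> blk a) \<in> pi_multiples_exact R \<pi> block (r i)));
                c3 = (\<not> num1 \<and> \<not> num2 \<and>
                        (\<forall>u\<in>pi_multiples R \<pi> block (enat bd). \<forall>w\<in>pi_multiples R \<pi> block (enat bd).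
                           \<exists>(a, b)\<in>Orb. blk a = u \<and> blk b = w))
            in mi \<ge> enat bd \<and> (c1 \<or> c2 \<or> c3) \<and> \<not> (c1 \<and> c2) \<and> \<not> (c1 \<and> c3) \<and> \<not> (c2 \<and> c3)"
    if l: "l \<in> S" "bd = shift l + s l" for l
  proof -
    define mi where "mi = m_val R \<pi> lam \<rho> k S s r y l i"
    have ge: "enat bd \<le> mi"
      unfolding mi_def by (rule bd_le_m_val)
    have case1: "\<forall>(a, b)\<in>Orb. blk b \<ominus>\<^bsub>block\<^esub> (y l \<odot>\<^bsub>block\<^esub> blk a) \<in> pi_multiples R \<pi> block mi"
      if "mi \<le> r i"
      using that difference_mem[OF lin l(1)] component_difference[OF lin l(1)]
      by (auto simp: Orb_eq mi_def)
    have case2: "\<forall>(a, b)\<in>Orb. blk b \<ominus>\<^bsub>block\<^esub> (y l \<odot>\<^bsub>block\<^esub> blk a) \<in> pi_multiples_exact R \<pi> block (r i)"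
      if "r i < mi"
      using that difference_mem[OF lin l(1)] component_difference[OF lin l(1)] difference_not_mem[OF _ l(1)]
      by (auto simp: Orb_eq mi_def pi_multiples_exact_def less_imp_le)
    have case3: "\<exists>(a, b)\<in>Orb. blk a = u \<and> blk b = w"
      if "mi = enat bd" and u: "u \<in> pi_multiples R \<pi> block (enat bd)" and w: "w \<in> pi_multiples R \<pi> block (enat bd)" for u w
    proof -
      have "m_val R \<pi> lam \<rho> k S s r y l i = enat bd"
        using that(1) by (simp add: mi_def)
      then obtain g where "g \<in> module_aut R full"
        "blk (g (residues T (exps lam) E)) = u" "blk (g (residues T (exps lam) F)) = w"
        by (rule all_pairs_attained[OF l _ u w])
      then show ?thesis
        by (auto simp: Orb_eq)
    qed
    \<comment> \<open>Since r_i is at least \<open>bd\<close>, equality of m_i with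
      \<open>bd\<close> excludes both numerical conditions, and these three cases are
      exhaustive.\<close>
    consider "mi \<le> r i" "enat bd < mi" | "r i < mi" | "mi \<le> r i" "mi = enat bd"
      using ge by fastforce
    then show ?thesis
      unfolding Let_def mi_def[symmetric] using ge bd_le_r_i case1 case2 case3
      by cases auto
  qed
  show ?thesis
    \<comment> \<open>\<open>attains_iff\<close> mentions \<open>boundary_val\<close>, so it has to
      rewrite before that is replaced by \<open>bd\<close>.\<close>
    unfolding Let_def B attains_iff
    unfolding boundary_val_eq
    by (rule conjI[OF ex conjI[OF comps allI[OF impI]]]) (elim conjE, rule main[unfolded Let_def])
qed

end
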